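(* Let $A$ be a self-adjoint operator in a Hilbert space $H$. Let $V$ be a non-negative self-adjoint trace class operator in $H$ such that $$ \bigvee_{\operatorname{Im}\lambda\neq 0}(A-\lambda)^{-1}VH=H, $$ and let $E$ be the closure of the range of $V$. Then there exist scalar bounded outer analytic functions $\delta_+$ in $\mathbb C_+$ and $\delta_-$ in $\mathbb C_-$ (independent of $u$) such that for every vector $u$ in the singular spectral subspace $H_s$ of $A$ the vector function $\sqrt V(A-\lambda)^{-1}u$ belongs to the vector Smirnov classes $N^2_\pm(E)$, namely $$ \sqrt V(A-\lambda)^{-1}u=\frac{h_\pm(\lambda)}{\delta_\pm(\lambda)},\qquad \lambda\in\mathbb C_\pm, $$ for some $h_\pm\in H^2_\pm(E)$.
   Context: $\bigvee$ denotes the closed linear span. $\mathbb C_\pm$ are the open upper and lower half-planes. The singular spectral subspace $H_s$ of $A$ is the set of all $u\in H$ for which the measure $\langle E_A(\cdot)u,u\rangle$ is singular with respect to Lebesgue measure, $E_A$ being the projection-valued spectral measure of $A$. $H^2_\pm(E)$ is the Hardy class of $E$-valued analytic functions $f$ in $\mathbb C_\pm$ with $\sup_{y>0}\int_{\mathbb R}\|f(x\pm iy)\|_E^2\,dx<\infty$. A bounded analytic scalar function $\delta$ in $\mathbb C_+$ is outer if it is not identically zero and $$\delta(\lambda)=e^{ic}\exp\Bigl\{\frac{i}{\pi}\int_{\mathbb R}\Bigl(\frac{1}{\lambda-t}+\frac{t}{1+t^2}\Bigr)\log|\delta(t+i0)|\,dt\Bigr\},\qquad \lambda\in\mathbb C_+,$$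 for some real constant $c$, where $\delta(t+i0)$ are the non-tangential boundary values. A function on $\mathbb C_-$ is outer if it becomes outer in $\mathbb C_+$ after the transformation $f(\lambda)\mapsto\overline{f(\overline\lambda)}$. *)

theory Defs
  imports "HOL-Complex_Analysis.Complex_Analysis"
begin

section \<open>Complex Hilbert spaces\<close>

text \<open>
  The inner product is linear in its first argument. Positive definiteness is not listed as an
  axiom: it follows from \<open>cinner_commute\<close> and \<open>norm_eq_sqrt_cinner\<close>, as the norm is that of a
  Banach space.
\<close>

class complex_hilbert = banach +
  fixes scaleC :: "complex \<Rightarrow> 'a \<Rightarrow> 'a" (infixr "*\<^sub>C" 75)
    and cinner :: "'a \<Rightarrow> 'a \<Rightarrow> complex"
  assumes scaleC_add_right: "c *\<^sub>C (x + y) = c *\<^sub>C x + c *\<^sub>C y"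
    and scaleC_add_left: "(c + d) *\<^sub>C x = c *\<^sub>C x + d *\<^sub>C x"
    and scaleC_scaleC: "c *\<^sub>C (d *\<^sub>C x) = (c * d) *\<^sub>C x"
    and scaleC_of_real: "complex_of_real r *\<^sub>C x = r *\<^sub>R x"
    and cinner_commute: "cinner x y = cnj (cinner y x)"
    and cinner_add_left: "cinner (x + y) z = cinner x z + cinner y z"
    and cinner_scaleC_left: "cinner (c *\<^sub>C x) y = c * cinner x y"
    and norm_eq_sqrt_cinner: "norm x = sqrt (Re (cinner x x))"

lemma module_scaleC: "module (scaleC :: complex \<Rightarrow> 'a::complex_hilbert \<Rightarrow> 'a)"
proof
  fix x :: 'a
  show "1 *\<^sub>C x = x"
    using scaleC_of_real[of 1 x] by simp
qed (simp_all add: scaleC_add_right scaleC_add_left scaleC_scaleC)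

abbreviation csubspace :: "'a::complex_hilbert set \<Rightarrow> bool" where
  "csubspace \<equiv> module.subspace scaleC"

abbreviation cspan :: "'a::complex_hilbert set \<Rightarrow> 'a set" where
  "cspan \<equiv> module.span scaleC"

definition closed_cspan :: "'a::complex_hilbert set \<Rightarrow> 'a set" where
  "closed_cspan S = closure (cspan S)"

definition orthonormal_basis :: "'a::complex_hilbert set \<Rightarrow> bool" where
  "orthonormal_basis B \<longleftrightarrow>
     (\<forall>e\<in>B. norm e = 1) \<and>
     (\<forall>e\<in>B. \<forall>f\<in>B. e \<noteq> f \<longrightarrow> cinner e f = 0) \<and>
     closed_cspan B = UNIV"


section \<open>Bounded operators\<close>

definition bounded_op :: "('a::complex_hilbert \<Rightarrow> 'a) \<Rightarrow> bool" where
  "bounded_op T \<longleftrightarrow> bounded_linear T \<and> (\<forall>c x. T (c *\<^sub>C x) = c *\<^sub>C T x)"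

definition bounded_selfadjoint :: "('a::complex_hilbert \<Rightarrow> 'a) \<Rightarrow> bool" where
  "bounded_selfadjoint T \<longleftrightarrow> bounded_op T \<and> (\<forall>x y. cinner (T x) y = cinner x (T y))"

definition nonneg_selfadjoint :: "('a::complex_hilbert \<Rightarrow> 'a) \<Rightarrow> bool" where
  "nonneg_selfadjoint T \<longleftrightarrow> bounded_selfadjoint T \<and> (\<forall>x. 0 \<le> Re (cinner (T x) x))"

definition op_sqrt :: "('a::complex_hilbert \<Rightarrow> 'a) \<Rightarrow> 'a \<Rightarrow> 'a" where
  "op_sqrt T = (THE S. nonneg_selfadjoint S \<and> S \<circ> S = T)"

definition op_adjoint :: "('a::complex_hilbert \<Rightarrow> 'a) \<Rightarrow> 'a \<Rightarrow> 'a" where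
  "op_adjoint T y = (THE z. \<forall>x. cinner (T x) y = cinner x z)"

definition op_abs :: "('a::complex_hilbert \<Rightarrow> 'a) \<Rightarrow> 'a \<Rightarrow> 'a" where
  "op_abs T = op_sqrt (op_adjoint T \<circ> T)"

definition trace_class :: "('a::complex_hilbert \<Rightarrow> 'a) \<Rightarrow> bool" where
  "trace_class T \<longleftrightarrow> bounded_op T \<and>
     (\<exists>B. orthonormal_basis B \<and> (\<lambda>e. Re (cinner (op_abs T e) e)) summable_on B)"


section \<open>Unbounded self-adjoint operators\<close>

text \<open>
  A possibly unbounded operator is a partial function, defined on its domain \<open>dom A\<close> only.
\<close>

definition linear_operator :: "('a::complex_hilbert \<rightharpoonup> 'a) \<Rightarrow> bool" where
  "linear_operator A \<longleftrightarrow> csubspace (dom A) \<and>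
     (\<forall>x\<in>dom A. \<forall>y\<in>dom A. the (A (x + y)) = the (A x) + the (A y)) \<and>
     (\<forall>c. \<forall>x\<in>dom A. the (A (c *\<^sub>C x)) = c *\<^sub>C the (A x))"

text \<open>The adjoint is meaningful for densely defined \<open>A\<close>, where the vector \<open>z\<close> is unique.\<close>

definition adjoint_operator :: "('a::complex_hilbert \<rightharpoonup> 'a) \<Rightarrow> ('a \<rightharpoonup> 'a)" where
  "adjoint_operator A y =
     (if \<exists>z. \<forall>x\<in>dom A. cinner (the (A x)) y = cinner x z
      then Some (THE z. \<forall>x\<in>dom A. cinner (the (A x)) y = cinner x z)
      else None)"

definition selfadjoint_operator :: "('a::complex_hilbert \<rightharpoonup> 'a) \<Rightarrow> bool" where
  "selfadjoint_operator A \<longleftrightarrow>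
     linear_operator A \<and> closure (dom A) = UNIV \<and> adjoint_operator A = A"

text \<open>\<open>resolvent A z u\<close> is the vector \<open>(A - z)\<^sup>-\<^sup>1 u\<close>, for \<open>z\<close> in the resolvent set of \<open>A\<close>.\<close>

definition resolvent :: "('a::complex_hilbert \<rightharpoonup> 'a) \<Rightarrow> complex \<Rightarrow> 'a \<Rightarrow> 'a" where
  "resolvent A z u = (THE x. x \<in> dom A \<and> the (A x) - z *\<^sub>C x = u)"


section \<open>Spectral measure and singular subspace\<close>

definition projection_valued_measure :: "(real set \<Rightarrow> 'a::complex_hilbert \<Rightarrow> 'a) \<Rightarrow> bool" where
  "projection_valued_measure P \<longleftrightarrow>
     (\<forall>S\<in>sets borel. bounded_selfadjoint (P S) \<and> P S \<circ> P S = P S) \<and>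
     P UNIV = id \<and>
     (\<forall>F :: nat \<Rightarrow> real set. range F \<subseteq> sets borel \<longrightarrow> disjoint_family F \<longrightarrow>
        (\<forall>x. (\<lambda>n. P (F n) x) sums P (\<Union>n. F n) x))"

definition scalar_measure :: "(real set \<Rightarrow> 'a::complex_hilbert \<Rightarrow> 'a) \<Rightarrow> 'a \<Rightarrow> real measure" where
  "scalar_measure P u = measure_of UNIV (sets borel) (\<lambda>S. ennreal (Re (cinner (P S u) u)))"

text \<open>
  \<open>A = \<integral> t dP(t)\<close>. The operator is determined by its domain and its quadratic form, because of
  polarization.
\<close>

definition is_spectral_measure ::
  "('a::complex_hilbert \<rightharpoonup> 'a) \<Rightarrow> (real set \<Rightarrow> 'a \<Rightarrow> 'a) \<Rightarrow> bool" where
  "is_spectral_measure A P \<longleftrightarrow> projection_valued_measure P \<and>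
     dom A = {u. integrable (scalar_measure P u) (\<lambda>t. t\<^sup>2)} \<and>
     (\<forall>u\<in>dom A. cinner (the (A u)) u = complex_of_real (\<integral>t. t \<partial>scalar_measure P u))"

text \<open>
  By the spectral theorem a self-adjoint operator has a spectral measure, whose values on Borel
  sets are unique. The choice operator only affects the irrelevant values on other sets.
\<close>

definition spectral_measure :: "('a::complex_hilbert \<rightharpoonup> 'a) \<Rightarrow> real set \<Rightarrow> 'a \<Rightarrow> 'a" where
  "spectral_measure A = (SOME P. is_spectral_measure A P)"

definition lebesgue_singular :: "real measure \<Rightarrow> bool" where
  "lebesgue_singular M \<longleftrightarrow> (\<exists>N\<in>null_sets lborel. emeasure M (- N) = 0)"

definition singular_subspace :: "('a::complex_hilbert \<rightharpoonup> 'a) \<Rightarrow> 'a set" where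
  "singular_subspace A = {u. lebesgue_singular (scalar_measure (spectral_measure A) u)}"


section \<open>Function classes in the half-planes\<close>

abbreviation upper_half_plane :: "complex set" where
  "upper_half_plane \<equiv> {z. Im z > 0}"

abbreviation lower_half_plane :: "complex set" where
  "lower_half_plane \<equiv> {z. Im z < 0}"

text \<open>Analyticity of vector functions on an open set: complex differentiability in norm.\<close>

definition vector_analytic_on :: "(complex \<Rightarrow> 'a::complex_hilbert) \<Rightarrow> complex set \<Rightarrow> bool" where
  "vector_analytic_on f S \<longleftrightarrow> (\<forall>z\<in>S. \<exists>d. (f has_derivative (\<lambda>h. h *\<^sub>C d)) (at z))"

definition hardy2_plus :: "'a::complex_hilbert set \<Rightarrow> (complex \<Rightarrow> 'a) set" where
  "hardy2_plus E = {f. f ` upper_half_plane \<subseteq> E \<and> vector_analytic_on f upper_half_plane \<and>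
     (SUP y\<in>{0<..}. \<integral>\<^sup>+x. ennreal ((norm (f (Complex x y)))\<^sup>2) \<partial>lborel) < \<infinity>}"

definition hardy2_minus :: "'a::complex_hilbert set \<Rightarrow> (complex \<Rightarrow> 'a) set" where
  "hardy2_minus E = {f. f ` lower_half_plane \<subseteq> E \<and> vector_analytic_on f lower_half_plane \<and>
     (SUP y\<in>{0<..}. \<integral>\<^sup>+x. ennreal ((norm (f (Complex x (- y))))\<^sup>2) \<partial>lborel) < \<infinity>}"

text \<open>Non-tangential boundary value from the upper half-plane, over cones of every aperture.\<close>

definition boundary_value :: "(complex \<Rightarrow> complex) \<Rightarrow> real \<Rightarrow> complex" where
  "boundary_value f t = (THE l. \<forall>a>0.
     (f \<longlongrightarrow> l) (at (complex_of_real t) within {z. Im z > 0 \<and> \<bar>Re z - t\<bar> < a * Im z}))"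

text \<open>
  For a bounded analytic \<open>d\<close> that is not identically zero, boundary values exist and are nonzero
  almost everywhere, and the integral below converges. So neither the conventional values of
  \<open>THE\<close> and of \<open>ln\<close> at \<open>0\<close> (which occur on a null set only) nor that of the integral of a
  non-integrable function matters.
\<close>

definition outer_plus :: "(complex \<Rightarrow> complex) \<Rightarrow> bool" where
  "outer_plus d \<longleftrightarrow>
     d holomorphic_on upper_half_plane \<and> bounded (d ` upper_half_plane) \<and>
     (\<exists>z\<in>upper_half_plane. d z \<noteq> 0) \<and>
     (\<exists>c::real. \<forall>z\<in>upper_half_plane.
        d z = exp (\<i> * complex_of_real c) *
          exp (\<i> / complex_of_real pi *
            (\<integral>t. (1 / (z - complex_of_real t) + complex_of_real (t / (1 + t\<^sup>2))) *
                complex_of_real (ln (cmod (boundary_value d t))) \<partial>lebesgue)))"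

definition outer_minus :: "(complex \<Rightarrow> complex) \<Rightarrow> bool" where
  "outer_minus d \<longleftrightarrow> outer_plus (\<lambda>z. cnj (d (cnj z)))"

definition smirnov2_plus :: "'a::complex_hilbert set \<Rightarrow> (complex \<Rightarrow> 'a) set" where
  "smirnov2_plus E = {f. \<exists>d h. outer_plus d \<and> h \<in> hardy2_plus E \<and>
     (\<forall>z\<in>upper_half_plane. f z = (1 / d z) *\<^sub>C h z)}"

definition smirnov2_minus :: "'a::complex_hilbert set \<Rightarrow> (complex \<Rightarrow> 'a) set" where
  "smirnov2_minus E = {f. \<exists>d h. outer_minus d \<and> h \<in> hardy2_minus E \<and>
     (\<forall>z\<in>lower_half_plane. f z = (1 / d z) *\<^sub>C h z)}"

end

(*
Write x = sqrt(V) (A - z)^{-1} u and x' = sqrt(V) (A - conj z)^{-1} u for Im z > 0, and let phi(z) be the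
trace of sqrt(V) (A - z)^{-1} sqrt(V), so that b = Im phi >= 0. Put c = Im <(A - z)^{-1} u, u>. The resolvent
identity and Cauchy-Schwarz give |x - x'|^2 <= 4 b c, and hence by the arithmetic-geometric mean inequality
  |x|^2 <= |1 - i phi|^2 Im F,   F = <(A - z)^{-1} u, u> + i <x, x'> / (1 - i phi).
As F is analytic and of size O(1 / Im z) at infinity, the Poisson formula bounds the integral of Im F over every
horizontal line. So delta_+ = 1 / (1 - i phi) works for every u in H; for the lower half-plane the same argument is
applied to -A, whose resolvent at z is -(A + z)^{-1}.

The function d = delta_+ has positive real part and modulus at most 1. By Fatou's theorem it has non-tangential
boundary values: a primitive of d is Lipschitz, hence differentiable at almost every boundary point, and its
derivative there is the boundary value. The Schwarz formula for the bounded function Ln (d + 1/k), in which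
|d + 1/k| decreases to |d| on the boundary, then shows that d is outer.
*)
theory Submission
  imports Defs "HOL-Probability.Sinc_Integral"
begin

section \<open>Complex Hilbert spaces\<close>

text \<open>The product <x, x'> replaces |x|^2 because x is analytic and x' antianalytic in z, so
  that <x, x'> is analytic; the error <x, x - x'> of this replacement is what the trace controls.
  The trace is a sum over a basis, and the same basis expands x - x', so Im phi bounds all
  coefficients of x - x' at once. The denominator 1 - i phi is dictated by two demands. Its real
  part is 1 + b, where b pays, together with c, for the error and the 1 leaves |x|^2 over. And this
  real part is at least 1, which makes the reciprocal bounded with values in the right half-plane.

  On the outer side the obstacle is that the integral formulas hold for functions bounded on the
  half-plane and continuous up to the real line, while Ln d may be unbounded and has boundary values
  only almost everywhere. Hence two independent regularizations: the shift of z by i/n gives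
  continuity, the shift of d by 1/k gives boundedness. Moreover \<open>boundary_value\<close> asks
  for limits in cones of every aperture, so vertical limits alone would not identify it.\<close>

lemma scaleC_of_real_neg: "(-1) *\<^sub>C x = - (x::'a::complex_hilbert)"
  using scaleC_of_real[of "-1" x] by simp

lemma scaleC_one [simp]: "1 *\<^sub>C x = (x::'a::complex_hilbert)"
  using scaleC_of_real[of 1 x] by simp

lemma scaleC_zero_left [simp]: "0 *\<^sub>C x = (0::'a::complex_hilbert)"
  using scaleC_of_real[of 0 x] by simp

lemma scaleC_zero_right [simp]: "c *\<^sub>C (0::'a::complex_hilbert) = 0"
  using scaleC_scaleC[of c 0 "0::'a"] by simp

lemma scaleC_minus_left: "(-c) *\<^sub>C x = - (c *\<^sub>C (x::'a::complex_hilbert))"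
  using scaleC_add_left[of "-c" c x] by (simp add: eq_neg_iff_add_eq_0)

lemma scaleC_minus_right: "c *\<^sub>C (- x) = - (c *\<^sub>C (x::'a::complex_hilbert))"
  using scaleC_add_right[of c "-x" x] by (simp add: eq_neg_iff_add_eq_0)

lemma scaleC_diff_right: "c *\<^sub>C (x - y) = c *\<^sub>C x - c *\<^sub>C (y::'a::complex_hilbert)"
  using scaleC_add_right[of c x "-y"] by (simp add: scaleC_minus_right)

lemma scaleC_diff_left: "(c - d) *\<^sub>C x = c *\<^sub>C x - d *\<^sub>C (x::'a::complex_hilbert)"
  using scaleC_add_left[of c "-d" x] by (simp add: scaleC_minus_left)

lemma cinner_add_right: "cinner x (y + z) = cinner x y + cinner x (z::'a::complex_hilbert)"
  by (metis cinner_commute cinner_add_left complex_cnj_add)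

lemma cinner_scaleC_right: "cinner x (c *\<^sub>C y) = cnj c * cinner x (y::'a::complex_hilbert)"
  by (metis cinner_commute cinner_scaleC_left complex_cnj_mult)

lemma cinner_zero_left [simp]: "cinner 0 (y::'a::complex_hilbert) = 0"
  using cinner_add_left[of 0 0 y] by simp

lemma cinner_zero_right [simp]: "cinner (y::'a::complex_hilbert) 0 = 0"
  using cinner_add_right[of y 0 0] by simp

lemma cinner_minus_left: "cinner (- x) (y::'a::complex_hilbert) = - cinner x y"
  using cinner_add_left[of "-x" x y] by (simp add: eq_neg_iff_add_eq_0)

lemma cinner_minus_right: "cinner x (- y::'a::complex_hilbert) = - cinner x y"
  using cinner_add_right[of x "-y" y] by (simp add: eq_neg_iff_add_eq_0)

lemma cinner_diff_left: "cinner (x - z) (y::'a::complex_hilbert) = cinner x y - cinner z y"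
  using cinner_add_left[of x "-z" y] by (simp add: cinner_minus_left)

lemma cinner_diff_right: "cinner x (y - z::'a::complex_hilbert) = cinner x y - cinner x z"
  using cinner_add_right[of x y "-z"] by (simp add: cinner_minus_right)

lemma cinner_scaleR_left: "cinner (r *\<^sub>R x) (y::'a::complex_hilbert) = of_real r * cinner x y"
  by (metis cinner_scaleC_left scaleC_of_real)

lemma cinner_scaleR_right: "cinner x (r *\<^sub>R y::'a::complex_hilbert) = of_real r * cinner x y"
  by (metis cinner_scaleC_right scaleC_of_real complex_cnj_complex_of_real)

lemmas cinner_simps = cinner_add_left cinner_add_right cinner_diff_left cinner_diff_right
  cinner_minus_left cinner_minus_right cinner_scaleC_left cinner_scaleC_right
  cinner_scaleR_left cinner_scaleR_right

lemma cinner_sum_left: "cinner (\<Sum>i\<in>F. f i) (y::'a::complex_hilbert) = (\<Sum>i\<in>F. cinner (f i) y)"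
  by (induction F rule: infinite_finite_induct) (simp_all add: cinner_add_left)

lemma cinner_sum_right: "cinner y (\<Sum>i\<in>F. f i :: 'a::complex_hilbert) = (\<Sum>i\<in>F. cinner y (f i))"
  by (induction F rule: infinite_finite_induct) (simp_all add: cinner_add_right)

lemma cinner_self: "cinner x x = complex_of_real ((norm (x::'a::complex_hilbert))^2)"
proof -
  have im: "Im (cinner x x) = 0"
    using cinner_commute[of x x] by (simp add: complex_eq_iff)
  have "Re (cinner x x) \<ge> 0"
    using norm_eq_sqrt_cinner[of x] norm_ge_zero[of x] by (metis real_sqrt_ge_0_iff)
  then have "(norm x)^2 = Re (cinner x x)"
    by (simp add: norm_eq_sqrt_cinner[of x])
  then show ?thesis using im by (simp add: complex_eq_iff)
qed

lemma norm_sq_cinner: "(norm (x::'a::complex_hilbert))^2 = Re (cinner x x)"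
  by (simp add: cinner_self)

lemma norm_scaleC: "norm (c *\<^sub>C x) = cmod c * norm (x::'a::complex_hilbert)"
proof -
  have "cinner (c *\<^sub>C x) (c *\<^sub>C x) = (c * cnj c) * cinner x x"
    by (simp add: cinner_simps)
  also have "\<dots> = of_real ((cmod c * norm x)^2)"
    by (simp only: complex_norm_square[symmetric] cinner_self power_mult_distrib of_real_mult)
  finally have "(norm (c *\<^sub>C x))^2 = (cmod c * norm x)^2"
    by (simp add: norm_sq_cinner)
  then show ?thesis
    by (simp add: power2_eq_iff_nonneg)
qed

text \<open>The form may be degenerate, because the lemma also serves the forms <T x, y> of
  non-negative operators. Expanding q at x - t p y with p = q x y makes the linear term in t real,
  so that a real parameter t suffices.\<close>

lemma psd_form_Cauchy_Schwarz:
  fixes q :: "'a::complex_hilbert \<Rightarrow> 'a \<Rightarrow> complex"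
  assumes add: "\<And>x y z. q (x + y) z = q x z + q y z"
    and scale: "\<And>c x y. q (c *\<^sub>C x) y = c * q x y"
    and herm: "\<And>x y. q x y = cnj (q y x)"
    and pos: "\<And>x. 0 \<le> Re (q x x)"
  shows "(cmod (q x y))^2 \<le> Re (q x x) * Re (q y y)"
proof -
  have addr: "q x (y + z) = q x y + q x z" for x y z
    by (metis add herm complex_cnj_add)
  have scaler: "q x (c *\<^sub>C y) = cnj c * q x y" for c x y
    by (metis scale herm complex_cnj_mult)
  define p where "p = q x y"
  define P where "P = (cmod p)^2"
  have key: "0 \<le> Re (q x x) - 2 * t * P + t^2 * P * Re (q y y)" for t :: real
  proof -
    define c where "c = - of_real t * p"
    have pp: "p * cnj p = of_real P"
      by (simp add: P_def complex_norm_square[symmetric])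
    have ryx: "q y x = cnj p"
      using herm[of y x] by (simp add: p_def)
    have "q (x + c *\<^sub>C y) (x + c *\<^sub>C y) = q x x + cnj c * p + c * cnj p + c * cnj c * q y y"
      by (simp add: add addr scale scaler ryx p_def[symmetric] algebra_simps)
    also have "\<dots> = q x x - 2 * of_real t * (p * cnj p) + (of_real t)^2 * (p * cnj p) * q y y"
      by (simp add: c_def algebra_simps power2_eq_square)
    also have "\<dots> = q x x - of_real (2 * t * P) + of_real (t^2 * P) * q y y"
      by (simp only: pp of_real_mult of_real_power mult.assoc of_real_numeral)
    finally have "Re (q (x + c *\<^sub>C y) (x + c *\<^sub>C y)) = Re (q x x) - 2 * t * P + t^2 * P * Re (q y y)"
      by (simp only: minus_complex.sel plus_complex.sel times_complex.sel Re_complex_of_real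
            Im_complex_of_real)
    then show ?thesis
      using pos[of "x + c *\<^sub>C y"] by simp
  qed
  show ?thesis
  proof (cases "Re (q y y) = 0")
    case True
    \<comment> \<open>With q y y = 0 the inequality \<open>key\<close> is affine in t; the chosen t
      makes its right side equal to -1.\<close>
    have "P = 0"
    proof (rule ccontr)
      assume "P \<noteq> 0"
      then show False
        using key[of "(Re (q x x) + 1) / (2 * P)"] True by simp
    qed
    then show ?thesis using True by (simp add: P_def p_def)
  next
    case False
    then have b: "Re (q y y) > 0" using pos[of y] by simp
    have "0 \<le> Re (q x x) - P / Re (q y y)"
      using key[of "1 / Re (q y y)"] b by (simp add: field_simps power2_eq_square)
    then show ?thesis
      using b by (simp add: field_simps P_def p_def)
  qed
qed

lemma cinner_Cauchy_Schwarz: "cmod (cinner x y) \<le> norm x * norm (y::'a::complex_hilbert)"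
proof -
  have "(cmod (cinner x y))^2 \<le> Re (cinner x x) * Re (cinner y y)"
    by (rule psd_form_Cauchy_Schwarz)
       (auto simp: cinner_simps cinner_self intro: cinner_commute)
  also have "\<dots> = (norm x * norm y)^2"
    by (simp add: cinner_self power_mult_distrib)
  finally show ?thesis
    by (rule power2_le_imp_le) simp
qed

lemma bounded_bilinear_cinner: "bounded_bilinear (cinner :: 'a::complex_hilbert \<Rightarrow> 'a \<Rightarrow> complex)"
proof
  show "\<exists>K. \<forall>a b::'a. cmod (cinner a b) \<le> norm a * norm b * K"
    by (rule exI[of _ 1]) (simp add: cinner_Cauchy_Schwarz)
qed (simp_all add: cinner_simps scaleR_conv_of_real)

lemma bounded_bilinear_scaleC: "bounded_bilinear (scaleC :: complex \<Rightarrow> 'a::complex_hilbert \<Rightarrow> 'a)"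
proof
  show "(r *\<^sub>R a) *\<^sub>C b = r *\<^sub>R (a *\<^sub>C b)" for r a and b :: 'a
    by (simp add: scaleR_conv_of_real scaleC_of_real[symmetric] scaleC_scaleC)
  show "a *\<^sub>C (r *\<^sub>R b) = r *\<^sub>R (a *\<^sub>C b)" for r a and b :: 'a
    by (simp add: scaleC_of_real[symmetric] scaleC_scaleC mult.commute)
  show "\<exists>K. \<forall>(a::complex) b::'a. norm (a *\<^sub>C b) \<le> norm a * norm b * K"
    by (rule exI[of _ 1]) (simp add: norm_scaleC)
qed (simp_all add: scaleC_add_left scaleC_add_right)

lemmas tendsto_cinner = bounded_bilinear.tendsto[OF bounded_bilinear_cinner]
lemmas tendsto_scaleC = bounded_bilinear.tendsto[OF bounded_bilinear_scaleC]

lemma cinner_eqI: "(\<And>x. cinner x y = cinner x z) \<Longrightarrow> y = (z::'a::complex_hilbert)"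
proof -
  assume "\<And>x. cinner x y = cinner x z"
  then have "cinner (y - z) (y - z) = 0"
    by (simp add: cinner_diff_right)
  then show "y = z" by (simp add: cinner_self)
qed

section \<open>Orthogonal projection and Bessel's inequality\<close>

lemma parallelogram_law:
  "(norm (x + y))^2 + (norm (x - y))^2 = 2 * (norm x)^2 + 2 * (norm (y::'a::complex_hilbert))^2"
  by (simp add: norm_sq_cinner cinner_simps)

lemma csubspace_iff:
  "csubspace (M :: 'a::complex_hilbert set) \<longleftrightarrow>
     0 \<in> M \<and> (\<forall>x\<in>M. \<forall>y\<in>M. x + y \<in> M) \<and> (\<forall>c. \<forall>x\<in>M. c *\<^sub>C x \<in> M)"
  by (rule module.subspace_def[OF module_scaleC])

lemma csubspace_scaleR:
  assumes "csubspace (M :: 'a::complex_hilbert set)" "x \<in> M"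
  shows "r *\<^sub>R x \<in> M"
  using assms by (metis csubspace_iff scaleC_of_real)

text \<open>A minimizing sequence is Cauchy by the parallelogram law. The residual of its limit is
  orthogonal to M, since otherwise moving the limit by a small multiple of y would come closer to
  x.\<close>

theorem orthogonal_projection_exists:
  fixes M :: "'a::complex_hilbert set"
  assumes sub: "csubspace M" and cl: "closed M"
  obtains m where "m \<in> M" "\<And>y. y \<in> M \<Longrightarrow> cinner (x - m) y = 0"
proof -
  define D where "D = infdist x M"
  have ne: "M \<noteq> {}" using sub by (auto simp: csubspace_iff)
  have Dle: "D \<le> norm (x - y)" if "y \<in> M" for y
    using infdist_le[OF that, of x] by (simp add: D_def dist_norm)
  have D0: "0 \<le> D" by (simp add: D_def infdist_nonneg)
  have "\<exists>y\<in>M. norm (x - y) < D + 1 / Suc n" for n :: nat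
  proof -
    have "(INF y\<in>M. dist x y) < infdist x M + 1 / Suc n"
      by (simp add: infdist_notempty[OF ne])
    then have "\<exists>y\<in>M. dist x y < infdist x M + 1 / Suc n"
      by (subst (asm) cINF_less_iff[OF ne]) auto
    then show ?thesis by (simp add: D_def dist_norm)
  qed
  then obtain s where sM: "\<And>n. s n \<in> M" and s: "\<And>n::nat. norm (x - s n) < D + 1 / Suc n"
    by metis
  have lim: "(\<lambda>n. norm (x - s n)) \<longlonglongrightarrow> D"
  proof (rule tendsto_sandwich[where f="\<lambda>_. D" and h="\<lambda>n. D + 1 / Suc n"])
    show "(\<lambda>n. D + 1 / real (Suc n)) \<longlonglongrightarrow> D"
      using tendsto_add[OF tendsto_const[of D] LIMSEQ_inverse_real_of_nat] by (simp add: field_simps)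
    show "\<forall>\<^sub>F n in sequentially. norm (x - s n) \<le> D + 1 / real (Suc n)"
      using s by (intro always_eventually allI less_imp_le) auto
  qed (use Dle sM in auto)
  \<comment> \<open>The midpoint of \<open>s m\<close> and \<open>s n\<close> lies in M and so has
    distance at least D from x; in the parallelogram law this bounds the difference.\<close>
  have sq: "(norm (s m - s n))^2 \<le> 2 * (norm (x - s m))^2 + 2 * (norm (x - s n))^2 - 4 * D^2" for m n
  proof -
    have "s m + s n \<in> M" using sub sM by (simp add: csubspace_iff)
    then have "(1/2) *\<^sub>R (s m + s n) \<in> M" by (rule csubspace_scaleR[OF sub])
    then have "D \<le> norm (x - (1/2) *\<^sub>R (s m + s n))" by (rule Dle)
    also have "\<dots> = norm ((x - s m) + (x - s n)) / 2"
    proof -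
      have "x - (1/2) *\<^sub>R (s m + s n) = (1/2) *\<^sub>R ((x - s m) + (x - s n))"
        by (simp add: algebra_simps flip: scaleR_left_distrib)
      then show ?thesis by simp
    qed
    finally have "2 * D \<le> norm ((x - s m) + (x - s n))" by simp
    then have "(2 * D)^2 \<le> (norm ((x - s m) + (x - s n)))^2"
      using D0 by (intro power_mono) auto
    moreover have "(x - s m) - (x - s n) = - (s m - s n)" by simp
    ultimately show ?thesis
      using parallelogram_law[of "x - s m" "x - s n"]
      by (simp add: power_mult_distrib norm_minus_commute)
  qed
  have "Cauchy s"
  proof (rule metric_CauchyI)
    fix e :: real assume e: "0 < e"
    have "(\<lambda>n. (norm (x - s n))^2) \<longlonglongrightarrow> D^2" by (intro tendsto_intros lim)
    then have "\<forall>\<^sub>F n in sequentially. (norm (x - s n))^2 < D^2 + e^2 / 4"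
      by (rule order_tendstoD) (use e in auto)
    then obtain N where N: "\<And>n. n \<ge> N \<Longrightarrow> (norm (x - s n))^2 < D^2 + e^2 / 4"
      by (auto simp: eventually_sequentially)
    show "\<exists>N. \<forall>m\<ge>N. \<forall>n\<ge>N. dist (s m) (s n) < e"
    proof (intro exI[of _ N] allI impI)
      fix m n assume "N \<le> m" "N \<le> n"
      then have "(norm (s m - s n))^2 < e^2"
        using sq[of m n] N[of m] N[of n] by linarith
      then show "dist (s m) (s n) < e"
        using e by (simp add: dist_norm power2_less_imp_less)
    qed
  qed
  then obtain m where m: "s \<longlonglongrightarrow> m"
    using Cauchy_convergent_iff convergent_def by blast
  have mM: "m \<in> M"
    using closed_sequentially[OF cl _ m] sM by auto
  have nm: "norm (x - m) = D"
    by (rule LIMSEQ_unique[OF _ lim]) (intro tendsto_intros m)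
  have "cinner (x - m) y = 0" if y: "y \<in> M" for y
  proof -
    define p where "p = cinner (x - m) y"
    define b where "b = (norm y)^2"
    define P where "P = (cmod p)^2"
    have pp: "p * cnj p = of_real P"
      by (simp add: P_def complex_norm_square[symmetric])
    have pyx: "cinner y (x - m) = cnj p"
      using cinner_commute[of y "x - m"] by (simp add: p_def)
    have key: "2 * t * P \<le> t^2 * P * b" for t :: real
    proof -
      define c where "c = of_real t * p"
      have "m + c *\<^sub>C y \<in> M" using sub mM y by (simp add: csubspace_iff)
      then have "D \<le> norm (x - (m + c *\<^sub>C y))" by (rule Dle)
      then have "D^2 \<le> (norm ((x - m) - c *\<^sub>C y))^2"
        using D0 by (simp add: diff_diff_eq power_mono)
      also have "\<dots> = Re (cinner (x - m) (x - m) - cnj c * p - c * cnj p + c * cnj c * cinner y y)"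
        by (simp only: norm_sq_cinner cinner_diff_left[of "x - m"] cinner_diff_right[of _ "x - m"]
              cinner_scaleC_left cinner_scaleC_right pyx p_def[symmetric])
           (simp add: algebra_simps)
      also have "cinner (x - m) (x - m) - cnj c * p - c * cnj p + c * cnj c * cinner y y
          = of_real (D^2) - 2 * of_real t * (p * cnj p) + (of_real t)^2 * (p * cnj p) * of_real b"
        by (simp only: cinner_self nm b_def) (simp add: c_def algebra_simps power2_eq_square)
      also have "\<dots> = of_real (D^2 - 2 * t * P + t^2 * P * b)"
        by (simp only: pp) simp
      finally show ?thesis by simp
    qed
    have "P = 0"
    proof (rule ccontr)
      assume "P \<noteq> 0"
      then have P: "P > 0" by (simp add: P_def)
      \<comment> \<open>Any t > 0 with t b < 2 contradicts \<open>key\<close> when P > 0; this one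
        also covers b = 0.\<close>
      define t where "t = 1 / (b + 1)"
      have b: "b \<ge> 0" by (simp add: b_def)
      have t: "t > 0" using b by (simp add: t_def)
      have "P * (t * 2) \<le> P * (t * (t * b))" using key[of t] by (simp add: power2_eq_square mult_ac)
      then have "2 \<le> t * b" using P t by (simp only: mult_le_cancel_left_pos)
      moreover have "t * b \<le> 1" using b by (simp add: t_def field_simps)
      ultimately show False by simp
    qed
    then show ?thesis by (simp add: P_def p_def)
  qed
  then show ?thesis using that mM by blast
qed

text \<open>Bessel's identity makes the partial sums the best approximations from finite spans.\<close>

lemma norm_sq_le_if_coefficients_bounded:
  fixes w :: "'a::complex_hilbert"
  assumes B: "orthonormal_basis B"
    and M: "\<And>F. finite F \<Longrightarrow> F \<subseteq> B \<Longrightarrow> (\<Sum>e\<in>F. (cmod (cinner w e))^2) \<le> M"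
  shows "(norm w)^2 \<le> M"
proof (rule field_le_epsilon)
  fix \<epsilon> :: real assume eps: "0 < \<epsilon>"
  have nrm: "\<And>e. e \<in> B \<Longrightarrow> norm e = 1"
    and orth: "\<And>e f. e \<in> B \<Longrightarrow> f \<in> B \<Longrightarrow> e \<noteq> f \<Longrightarrow> cinner e f = 0"
    and dense: "closure (cspan B) = UNIV"
    using B by (auto simp: orthonormal_basis_def closed_cspan_def)
  have "w \<in> closure (cspan B)" using dense by simp
  then obtain y where y: "y \<in> cspan B" "dist y w < sqrt \<epsilon>"
    using eps by (meson closure_approachable real_sqrt_gt_zero)
  obtain F r where F: "finite F" "F \<subseteq> B" and yr: "y = (\<Sum>e\<in>F. r e *\<^sub>C e)"
    using y(1) module.span_explicit[OF module_scaleC, of B] by blast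
  define a where "a e = cinner w e" for e
  define P where "P = (\<Sum>e\<in>F. a e *\<^sub>C e)"
  have ce: "cinner (\<Sum>f\<in>F. c f *\<^sub>C f) e = c e" if "e \<in> F" for e and c :: "'a \<Rightarrow> complex"
  proof -
    have "cinner (\<Sum>f\<in>F. c f *\<^sub>C f) e = (\<Sum>f\<in>F. c f * cinner f e)"
      by (simp add: cinner_sum_left cinner_scaleC_left)
    also have "\<dots> = (\<Sum>f\<in>F. if f = e then c f else 0)"
    proof (rule sum.cong[OF refl])
      fix f assume f: "f \<in> F"
      show "c f * cinner f e = (if f = e then c f else 0)"
      proof (cases "f = e")
        case True
        then show ?thesis using nrm[of e] that F by (auto simp: cinner_self)
      next
        case False
        then show ?thesis using orth[of f e] that f F by auto
      qed
    qed
    also have "\<dots> = c e" using that F by simp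
    finally show ?thesis .
  qed
  have orthP: "cinner (w - P) e = 0" if "e \<in> F" for e
    using ce[OF that, of a] by (simp add: P_def cinner_diff_left a_def)
  have "cinner (w - P) (P - y) = 0"
    unfolding P_def yr sum_subtractf[symmetric] scaleC_diff_left[symmetric] cinner_sum_right
    using orthP by (intro sum.neutral) (auto simp: cinner_scaleC_right P_def)
  moreover then have "cinner (P - y) (w - P) = 0"
    using cinner_commute[of "P - y" "w - P"] by simp
  moreover have "w - y = (w - P) + (P - y)" by simp
  ultimately have "(norm (w - y))^2 = (norm (w - P))^2 + (norm (P - y))^2"
    by (simp only: norm_sq_cinner cinner_add_left[of "w - P"] cinner_add_right[of _ "w - P"]) simp
  then have wP: "(norm (w - P))^2 \<le> (norm (w - y))^2"
    by simp
  have "(norm (w - y))^2 < \<epsilon>"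
    using y(2) eps by (metis dist_norm norm_minus_commute norm_ge_zero real_sqrt_less_iff real_sqrt_power
        real_sqrt_pow2 less_eq_real_def power_strict_mono pos2)
  moreover have "cinner (w - P) P = 0"
    unfolding P_def cinner_sum_right
    using orthP by (intro sum.neutral) (auto simp: cinner_scaleC_right P_def)
  then have 1: "cinner (w - P) w = cinner (w - P) (w - P)"
    by (simp add: cinner_diff_right)
  have split: "(norm w)^2 = Re (cinner (w - P) w) + Re (cinner P w)"
    by (simp add: norm_sq_cinner cinner_diff_left)
  have "cinner P w = of_real (\<Sum>e\<in>F. (cmod (a e))^2)"
  proof -
    have ae: "cinner e w = cnj (a e)" for e
      using cinner_commute[of e w] by (simp add: a_def)
    have "cinner P w = (\<Sum>e\<in>F. a e * cnj (a e))"
      unfolding P_def cinner_sum_left cinner_scaleC_left by (simp add: ae)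
    then show ?thesis
      by (simp only: complex_norm_square[symmetric] of_real_sum)
  qed
  then have "Re (cinner P w) \<le> M"
    using M[OF F] by (simp add: a_def)
  moreover have "Re (cinner (w - P) w) = (norm (w - P))^2"
    by (simp add: 1 norm_sq_cinner)
  ultimately have "(norm w)^2 \<le> (norm (w - P))^2 + M" using split by linarith
  then show "(norm w)^2 \<le> M + \<epsilon>"
    using wP \<open>(norm (w - y))^2 < \<epsilon>\<close> by linarith
qed

section \<open>Square roots of non-negative operators\<close>

lemma bounded_opI:
  assumes "\<And>x y. T (x + y) = T x + T y" "\<And>c x. T (c *\<^sub>C x) = c *\<^sub>C T x"
    and "\<And>x. norm (T x) \<le> K * norm (x::'a::complex_hilbert)"
  shows "bounded_op T"
  unfolding bounded_op_def
proof (intro conjI allI)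
  show "bounded_linear T"
  proof (rule bounded_linear_intro)
    show "T (r *\<^sub>R x) = r *\<^sub>R T x" for r x
      using assms(2)[of "of_real r" x] by (simp add: scaleC_of_real)
    show "norm (T x) \<le> norm x * K" for x
      using assms(3)[of x] by (simp add: mult.commute)
  qed (rule assms)
qed (rule assms)

lemma
  assumes "bounded_op (T :: 'a::complex_hilbert \<Rightarrow> 'a)"
  shows bounded_op_linear: "bounded_linear T"
    and bounded_op_add: "T (x + y) = T x + T y"
    and bounded_op_diff: "T (x - y) = T x - T y"
    and bounded_op_minus: "T (- x) = - T x"
    and bounded_op_zero: "T 0 = 0"
    and bounded_op_scaleC: "T (c *\<^sub>C x) = c *\<^sub>C T x"
    and bounded_op_scaleR: "T (r *\<^sub>R x) = r *\<^sub>R T x"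
proof -
  interpret bounded_linear T using assms by (simp add: bounded_op_def)
  show "bounded_linear T" by (rule bounded_linear_axioms)
  show "T (x + y) = T x + T y" "T (x - y) = T x - T y" "T (- x) = - T x" "T 0 = 0" "T (r *\<^sub>R x) = r *\<^sub>R T x"
    using scaleR[of "-1" x] by (simp_all add: add diff scaleR)
  show "T (c *\<^sub>C x) = c *\<^sub>C T x" using assms by (simp add: bounded_op_def)
qed

lemma bounded_op_bound:
  assumes "bounded_op (T :: 'a::complex_hilbert \<Rightarrow> 'a)"
  obtains K where "K > 0" "\<And>x. norm (T x) \<le> K * norm x"
  using bounded_linear.pos_bounded[OF bounded_op_linear[OF assms]] by (auto simp: mult.commute)

lemma nonneg_selfadjointD:
  assumes "nonneg_selfadjoint T"
  shows "bounded_op T" "cinner (T x) y = cinner x (T y)" "0 \<le> Re (cinner (T x) x)"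
  using assms by (auto simp: nonneg_selfadjoint_def bounded_selfadjoint_def)

text \<open>Cauchy-Schwarz for the semidefinite form <T x, y> at x and T x gives |T x|^4 \<le> <T x,
  x> <T T x, T x>, and the last factor is at most K |T x|^2. So a small quadratic form forces a
  small image.\<close>

lemma nonneg_selfadjoint_norm_sq_le:
  assumes T: "nonneg_selfadjoint T" and K: "\<And>x. norm (T x) \<le> K * norm x"
  shows "(norm (T x))^2 \<le> K * Re (cinner (T x) x)"
proof -
  note T' = nonneg_selfadjointD[OF T]
  have "(cmod (cinner (T x) (T x)))^2 \<le> Re (cinner (T x) x) * Re (cinner (T (T x)) (T x))"
  proof (rule psd_form_Cauchy_Schwarz[where q="\<lambda>x y. cinner (T x) y"])
    show "cinner (T x) y = cnj (cinner (T y) x)" for x y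
      by (metis T'(2) cinner_commute)
  qed (simp_all add: bounded_op_add[OF T'(1)] bounded_op_scaleC[OF T'(1)] cinner_simps T'(3))
  also have "\<dots> \<le> Re (cinner (T x) x) * (K * (norm (T x))^2)"
  proof (rule mult_left_mono[OF _ T'(3)])
    have "Re (cinner (T (T x)) (T x)) \<le> cmod (cinner (T (T x)) (T x))" by (rule complex_Re_le_cmod)
    also have "\<dots> \<le> norm (T (T x)) * norm (T x)" by (rule cinner_Cauchy_Schwarz)
    also have "\<dots> \<le> (K * norm (T x)) * norm (T x)" by (intro mult_right_mono K) auto
    finally show "Re (cinner (T (T x)) (T x)) \<le> K * (norm (T x))^2" by (simp add: power2_eq_square)
  qed
  finally have le: "(norm (T x))^2 * (norm (T x))^2 \<le> (K * Re (cinner (T x) x)) * (norm (T x))^2"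
    by (simp add: cinner_self norm_power norm_mult power2_eq_square mult_ac)
  show ?thesis
  proof (cases "T x = 0")
    case False
    then have "0 < (norm (T x))^2" by simp
    then show ?thesis using le by (simp only: mult_le_cancel_right_pos)
  qed simp
qed

section \<open>The non-negative square root: existence by iteration, uniqueness\<close>

text \<open>A fixed point Y = (X + Y^2) / 2 satisfies (1 - Y)^2 = 1 - X, so it yields a square root
  of 1 - X without any functional calculus.\<close>

primrec sqrt_iter :: "('a::complex_hilbert \<Rightarrow> 'a) \<Rightarrow> nat \<Rightarrow> 'a \<Rightarrow> 'a" where
  "sqrt_iter X 0 x = 0"
| "sqrt_iter X (Suc n) x = (1/2) *\<^sub>R (X x + sqrt_iter X n (sqrt_iter X n x))"

text \<open>The same iteration with the number 1 in place of X. It majorizes the operator iteration: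
  norms of iterates by its values and norms of increments by its increments.\<close>

primrec sqrt_iter_bound :: "nat \<Rightarrow> real" where
  "sqrt_iter_bound 0 = 0"
| "sqrt_iter_bound (Suc n) = (1 + (sqrt_iter_bound n)^2) / 2"

lemma sqrt_iter_bound_range: "0 \<le> sqrt_iter_bound n \<and> sqrt_iter_bound n \<le> 1"
proof (induction n)
  case (Suc n)
  then have "(sqrt_iter_bound n)^2 \<le> 1" by (simp add: power_le_one)
  then show ?case by simp
qed simp

lemma sqrt_iter_bound_Suc: "sqrt_iter_bound n \<le> sqrt_iter_bound (Suc n)"
proof -
  have "0 \<le> (1 - sqrt_iter_bound n)^2" by simp
  then show ?thesis by (simp add: power2_eq_square algebra_simps)
qed

lemma sqrt_iter_bound_mono: "m \<le> n \<Longrightarrow> sqrt_iter_bound m \<le> sqrt_iter_bound n"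
  by (rule lift_Suc_mono_le[of sqrt_iter_bound, OF sqrt_iter_bound_Suc])

text \<open>Increments of the operator iterates are dominated by increments of the scalar iterates,
  which form a bounded monotone sequence; so the iterates converge pointwise.\<close>

lemma contraction_sqrt:
  fixes X :: "'a::complex_hilbert \<Rightarrow> 'a"
  assumes X: "bounded_selfadjoint X" and X1: "\<And>x. norm (X x) \<le> norm x"
  obtains Y where "bounded_selfadjoint Y" "\<And>x. norm (Y x) \<le> norm x"
    "\<And>x. 2 *\<^sub>R Y x = X x + Y (Y x)"
proof -
  have Xop: "bounded_op X" and Xs: "\<And>x y. cinner (X x) y = cinner x (X y)"
    using X by (auto simp: bounded_selfadjoint_def)
  let ?Y = "sqrt_iter X" and ?y = sqrt_iter_bound
  have add: "?Y n (x + z) = ?Y n x + ?Y n z" for n x z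
    by (induction n arbitrary: x z) (simp_all add: bounded_op_add[OF Xop] algebra_simps)
  have scale: "?Y n (c *\<^sub>C x) = c *\<^sub>C ?Y n x" for n c x
    by (induction n arbitrary: x)
       (simp_all add: bounded_op_scaleC[OF Xop] scaleC_add_right
          bounded_bilinear.scaleR_right[OF bounded_bilinear_scaleC])
  have sym: "cinner (?Y n x) z = cinner x (?Y n z)" for n x z
    by (induction n arbitrary: x z) (simp_all add: cinner_simps Xs)
  have minus: "?Y n (x - z) = ?Y n x - ?Y n z" for n x z
    using add[of n x "(-1) *\<^sub>C z"] scale[of n "-1" z] by (simp add: scaleC_of_real_neg)
  have bd: "norm (?Y n x) \<le> ?y n * norm x" for n x
  proof (induction n arbitrary: x)
    case (Suc n)
    have "norm (?Y n (?Y n x)) \<le> ?y n * norm (?Y n x)" by (rule Suc)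
    also have "\<dots> \<le> ?y n * (?y n * norm x)"
      using Suc sqrt_iter_bound_range by (intro mult_left_mono) auto
    finally have "norm (?Y (Suc n) x) \<le> (norm x + (?y n)^2 * norm x) / 2"
      using norm_triangle_ineq[of "X x" "?Y n (?Y n x)"] X1[of x]
      by (simp add: power2_eq_square mult.assoc)
    then show ?case by (simp add: algebra_simps)
  qed simp
  have bd1: "norm (?Y n x) \<le> norm x" for n x
    using bd[of n x] sqrt_iter_bound_range[of n] mult_right_mono[of "?y n" 1 "norm x"] by simp
  \<comment> \<open>The difference of squares is split as Y' (Y' - Y) + (Y' - Y) Y for consecutive
    iterates Y and Y'. The induction hypothesis applies at x and at Y x, and the scalar bounds
    recombine to half the difference of the scalar squares.\<close>
  have step: "norm (?Y (Suc n) x - ?Y n x) \<le> (?y (Suc n) - ?y n) * norm x" for n x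
  proof (induction n arbitrary: x)
    case 0
    then show ?case using bd[of 1 x] by simp
  next
    case (Suc n)
    let ?d = "?y (Suc n) - ?y n"
    have d0: "0 \<le> ?d" using sqrt_iter_bound_Suc[of n] by linarith
    have "?Y (Suc (Suc n)) x - ?Y (Suc n) x = (1/2) *\<^sub>R (?Y (Suc n) (?Y (Suc n) x) - ?Y n (?Y n x))"
      by (simp only: sqrt_iter.simps(2)[of X "Suc n"] sqrt_iter.simps(2)[of X n x])
         (simp add: algebra_simps)
    also have "?Y (Suc n) (?Y (Suc n) x) - ?Y n (?Y n x)
        = ?Y (Suc n) (?Y (Suc n) x - ?Y n x) + (?Y (Suc n) (?Y n x) - ?Y n (?Y n x))"
      by (simp only: minus) simp
    finally have 1: "norm (?Y (Suc (Suc n)) x - ?Y (Suc n) x)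
        \<le> (norm (?Y (Suc n) (?Y (Suc n) x - ?Y n x)) + norm (?Y (Suc n) (?Y n x) - ?Y n (?Y n x))) / 2"
      using norm_triangle_ineq[of "?Y (Suc n) (?Y (Suc n) x - ?Y n x)" "?Y (Suc n) (?Y n x) - ?Y n (?Y n x)"]
      by simp
    have 2: "norm (?Y (Suc n) (?Y (Suc n) x - ?Y n x)) \<le> ?y (Suc n) * (?d * norm x)"
      by (rule order_trans[OF bd]) (intro mult_left_mono Suc; use sqrt_iter_bound_range in blast)
    have 3: "norm (?Y (Suc n) (?Y n x) - ?Y n (?Y n x)) \<le> ?d * (?y n * norm x)"
      by (rule order_trans[OF Suc]) (intro mult_left_mono bd d0)
    have "norm (?Y (Suc (Suc n)) x - ?Y (Suc n) x)
        \<le> (?y (Suc n) * (?d * norm x) + ?d * (?y n * norm x)) / 2"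
      by (rule order_trans[OF 1 divide_right_mono[OF add_mono[OF 2 3]]]) simp
    also have "\<dots> = (((?y (Suc n))^2 - (?y n)^2) / 2) * norm x"
      by (simp only: power2_eq_square) (simp add: algebra_simps)
    also have "((?y (Suc n))^2 - (?y n)^2) / 2 = ?y (Suc (Suc n)) - ?y (Suc n)"
      by (simp only: sqrt_iter_bound.simps(2)[of "Suc n"] sqrt_iter_bound.simps(2)[of n]) (simp add: field_simps)
    finally show ?case .
  qed
  have diff: "norm (?Y (n + k) x - ?Y n x) \<le> (?y (n + k) - ?y n) * norm x" for n k x
  proof (induction k)
    case (Suc k)
    have "norm (?Y (n + Suc k) x - ?Y n x) \<le> norm (?Y (Suc (n + k)) x - ?Y (n + k) x) + norm (?Y (n + k) x - ?Y n x)"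
      using norm_triangle_ineq[of "?Y (Suc (n + k)) x - ?Y (n + k) x" "?Y (n + k) x - ?Y n x"]
      by (simp del: sqrt_iter.simps)
    also have "\<dots> \<le> (?y (Suc (n + k)) - ?y (n + k)) * norm x + (?y (n + k) - ?y n) * norm x"
      by (intro add_mono step Suc)
    finally show ?case by (simp add: algebra_simps del: sqrt_iter.simps sqrt_iter_bound.simps)
  qed simp
  have "incseq ?y" by (simp add: incseq_SucI sqrt_iter_bound_Suc del: sqrt_iter_bound.simps)
  then have "convergent ?y"
    using sqrt_iter_bound_range by (intro Bseq_mono_convergent BseqI'[of _ 1]) (auto simp: incseq_def)
  then have cy: "Cauchy ?y" by (simp add: Cauchy_convergent_iff)
  have "Cauchy (\<lambda>n. ?Y n x)" for x
  proof (rule metric_CauchyI)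
    fix e :: real assume e: "0 < e"
    then have "0 < e / (norm x + 1)" by (simp add: add_nonneg_pos)
    then obtain N where N: "\<And>m n. m \<ge> N \<Longrightarrow> n \<ge> N \<Longrightarrow> dist (?y m) (?y n) < e / (norm x + 1)"
      using cy by (meson metric_CauchyD)
    have main: "dist (?Y (n + k) x) (?Y n x) < e" if "n \<ge> N" for n k
    proof -
      have "dist (?Y (n + k) x) (?Y n x) \<le> (?y (n + k) - ?y n) * norm x"
        using diff[of n k x] by (simp add: dist_norm)
      also have "\<dots> \<le> (?y (n + k) - ?y n) * (norm x + 1)"
        using sqrt_iter_bound_mono[of n "n + k"] by (intro mult_left_mono) auto
      also have "\<dots> < e"
      proof -
        have "?y (n + k) - ?y n < e / (norm x + 1)"
          using N[of "n + k" n] that by (simp add: dist_real_def)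
        then show ?thesis by (subst (asm) pos_less_divide_eq) (simp_all add: add_nonneg_pos)
      qed
      finally show ?thesis .
    qed
    show "\<exists>N. \<forall>m\<ge>N. \<forall>n\<ge>N. dist (?Y m x) (?Y n x) < e"
    proof (intro exI[of _ N] allI impI)
      fix m n assume "N \<le> m" "N \<le> n"
      then show "dist (?Y m x) (?Y n x) < e"
        using main[of n "m - n"] main[of m "n - m"] by (cases "n \<le> m") (auto simp: dist_commute)
    qed
  qed
  then have "\<exists>l. (\<lambda>n. ?Y n x) \<longlonglongrightarrow> l" for x
    using Cauchy_convergent_iff convergent_def by blast
  then obtain Y where Y: "\<And>x. (\<lambda>n. ?Y n x) \<longlonglongrightarrow> Y x" by metis
  have Yadd: "Y (x + z) = Y x + Y z" for x z
    using tendsto_add[OF Y Y, of x z] Y[of "x + z"] by (simp add: add LIMSEQ_unique)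
  have Yscale: "Y (c *\<^sub>C x) = c *\<^sub>C Y x" for c x
    using tendsto_scaleC[OF tendsto_const Y, of c x] Y[of "c *\<^sub>C x"] by (simp add: scale LIMSEQ_unique)
  have Y1: "norm (Y x) \<le> norm x" for x
    by (rule LIMSEQ_le_const2[OF tendsto_norm[OF Y]]) (use bd1 in auto)
  have Ysym: "cinner (Y x) z = cinner x (Y z)" for x z
    using tendsto_cinner[OF Y tendsto_const, of x z] tendsto_cinner[OF tendsto_const Y, of x z]
    by (simp add: sym LIMSEQ_unique)
  \<comment> \<open>Both the operator and its argument vary with n; all iterates being contractions
    makes pointwise convergence enough.\<close>
  have YY: "(\<lambda>n. ?Y n (?Y n x)) \<longlonglongrightarrow> Y (Y x)" for x
  proof -
    have "(\<lambda>n. ?Y n (?Y n x - Y x)) \<longlonglongrightarrow> 0"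
    proof (rule Lim_null_comparison)
      show "\<forall>\<^sub>F n in sequentially. norm (?Y n (?Y n x - Y x)) \<le> norm (?Y n x - Y x)"
        using bd1 by simp
      show "(\<lambda>n. norm (?Y n x - Y x)) \<longlonglongrightarrow> 0"
        using Y[of x] by (simp add: LIM_zero tendsto_norm_zero)
    qed
    from tendsto_add[OF this Y[of "Y x"]] show ?thesis by (simp add: minus)
  qed
  have "(\<lambda>n. ?Y (Suc n) x) \<longlonglongrightarrow> (1/2) *\<^sub>R (X x + Y (Y x))" for x
    unfolding sqrt_iter.simps by (intro tendsto_intros YY)
  then have fixpoint: "Y x = (1/2) *\<^sub>R (X x + Y (Y x))" for x
    by (rule LIMSEQ_unique[OF LIMSEQ_Suc[OF Y[of x]]])
  have "2 *\<^sub>R Y x = X x + Y (Y x)" for x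
    by (subst fixpoint) simp
  moreover have "bounded_selfadjoint Y"
    unfolding bounded_selfadjoint_def
    using bounded_opI[of Y 1] Yadd Yscale Y1 Ysym by auto
  ultimately show ?thesis using that Y1 by blast
qed

text \<open>After scaling by a norm bound K, X = 1 - T / K is a contraction, and S = sqrt K (1 - Y)
  has the square K (1 - X) = T.\<close>

lemma nonneg_selfadjoint_sqrt_exists:
  assumes T: "nonneg_selfadjoint (T :: 'a::complex_hilbert \<Rightarrow> 'a)"
  shows "\<exists>S. nonneg_selfadjoint S \<and> S \<circ> S = T"
proof -
  note T' = nonneg_selfadjointD[OF T]
  obtain K where K: "K > 0" "\<And>x. norm (T x) \<le> K * norm x"
    using bounded_op_bound[OF T'(1)] by blast
  define X where "X x = x - (1/K) *\<^sub>R T x" for x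
  have X1: "norm (X x) \<le> norm x" for x
  proof -
    have "(norm (X x))^2 = (norm x)^2 - 2 / K * Re (cinner (T x) x) + (norm (T x))^2 / K^2"
      using K(1) by (simp add: X_def norm_sq_cinner cinner_simps T'(2)) (simp add: power2_eq_square field_simps)
    \<comment> \<open>Half of the negative cross term absorbs this term; here the non-negativity of
      T makes X a contraction.\<close>
    also have "(norm (T x))^2 / K^2 \<le> K * Re (cinner (T x) x) / K^2"
      using nonneg_selfadjoint_norm_sq_le[OF T K(2)] by (intro divide_right_mono) auto
    also have "\<dots> = Re (cinner (T x) x) / K" using K by (simp add: power2_eq_square)
    finally have "(norm (X x))^2 \<le> (norm x)^2 - Re (cinner (T x) x) / K" by simp
    also have "\<dots> \<le> (norm x)^2" using T'(3) K by simp
    finally show ?thesis by (rule power2_le_imp_le) simp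
  qed
  have "bounded_selfadjoint X"
    unfolding bounded_selfadjoint_def
  proof (intro conjI allI bounded_opI[of _ 1])
    show "X (c *\<^sub>C x) = c *\<^sub>C X x" for c x
      by (simp add: X_def bounded_op_scaleC[OF T'(1)] scaleC_diff_right
          bounded_bilinear.scaleR_right[OF bounded_bilinear_scaleC])
  qed (use X1 in \<open>simp_all add: X_def bounded_op_add[OF T'(1)] algebra_simps cinner_simps T'(2)\<close>)
  then obtain Y where Y: "bounded_selfadjoint Y" "\<And>x. norm (Y x) \<le> norm x"
    "\<And>x. 2 *\<^sub>R Y x = X x + Y (Y x)"
    using contraction_sqrt[OF _ X1] by blast
  have Yop: "bounded_op Y" and Ys: "\<And>x y. cinner (Y x) y = cinner x (Y y)"
    using Y(1) by (auto simp: bounded_selfadjoint_def)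
  define S where "S x = sqrt K *\<^sub>R (x - Y x)" for x
  have S1: "norm (S x) \<le> (sqrt K * 2) * norm x" for x
    using norm_triangle_ineq4[of x "Y x"] Y(2)[of x] K by (simp add: S_def)
  have "nonneg_selfadjoint S"
    unfolding nonneg_selfadjoint_def bounded_selfadjoint_def
  proof (intro conjI allI bounded_opI[OF _ _ S1])
    show "S (c *\<^sub>C x) = c *\<^sub>C S x" for c x
      by (simp add: S_def bounded_op_scaleC[OF Yop] scaleC_diff_right
          bounded_bilinear.scaleR_right[OF bounded_bilinear_scaleC])
    show "0 \<le> Re (cinner (S x) x)" for x
    proof -
      have "Re (cinner (Y x) x) \<le> norm (Y x) * norm x"
        by (rule order_trans[OF complex_Re_le_cmod cinner_Cauchy_Schwarz])
      also have "\<dots> \<le> norm x * norm x" by (intro mult_right_mono Y) auto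
      finally have "0 \<le> Re (cinner (x - Y x) x)"
        by (simp add: cinner_simps cinner_self power2_eq_square)
      then show ?thesis using K by (simp add: S_def cinner_scaleR_left)
    qed
  qed (simp_all add: S_def bounded_op_add[OF Yop] algebra_simps cinner_simps Ys)
  moreover have "S (S x) = T x" for x
  proof -
    have "S (S x) = (sqrt K * sqrt K) *\<^sub>R (x - 2 *\<^sub>R Y x + Y (Y x))"
      by (simp add: S_def bounded_op_scaleR[OF Yop] bounded_op_diff[OF Yop] algebra_simps
          scaleR_2)
    also have "x - 2 *\<^sub>R Y x + Y (Y x) = x - X x" by (simp add: Y(3))
    finally show ?thesis using K by (simp add: X_def)
  qed
  ultimately show ?thesis by (auto simp: fun_eq_iff)
qed

text \<open>
  For \<open>D = S - S'\<close> the equations \<open>S D = - D S'\<close> and \<open>S' D = - D S\<close> force \<open>S\<close> and \<open>S'\<close> to be small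
  on approximate eigenvectors of \<open>D^2\<close> at its norm, whence \<open>D = 0\<close>.
\<close>

lemma nonneg_selfadjoint_sqrt_unique:
  assumes S: "nonneg_selfadjoint S" and S': "nonneg_selfadjoint S'" and eq: "S \<circ> S = S' \<circ> S'"
  shows "S = (S' :: 'a::complex_hilbert \<Rightarrow> 'a)"
proof -
  define D where "D x = S x - S' x" for x
  define k where "k = onorm D"
  have Sop: "bounded_op S" and Sop': "bounded_op S'"
    using S S' by (auto simp: nonneg_selfadjoint_def bounded_selfadjoint_def)
  have Dlin: "bounded_linear D"
    unfolding D_def by (intro bounded_linear_sub bounded_op_linear Sop Sop')
  have Dsym: "cinner (D x) y = cinner x (D y)" for x y
    using nonneg_selfadjointD(2)[OF S] nonneg_selfadjointD(2)[OF S'] by (simp add: D_def cinner_simps)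
  have eq': "S (S x) = S' (S' x)" for x using eq by (metis comp_apply)
  have k0: "0 \<le> k" by (simp add: k_def onorm_pos_le[OF Dlin])
  have Dk: "norm (D x) \<le> k * norm x" for x by (simp add: k_def onorm[OF Dlin])
  have "k \<le> 0"
  proof (rule ccontr)
    assume "\<not> k \<le> 0"
    then have kpos: "k > 0" by simp
    have "\<exists>x. norm x = 1 \<and> k - 1 / Suc n < norm (D x)" for n
    proof -
      \<comment> \<open>The maximum with 0 keeps the constant admissible in
        \<open>onorm_bound\<close> even when k - 1 / Suc n is negative.\<close>
      have "\<not> (\<forall>x. norm (D x) \<le> max 0 (k - 1 / Suc n) * norm x)"
      proof
        assume "\<forall>x. norm (D x) \<le> max 0 (k - 1 / Suc n) * norm x"
        then have "k \<le> max 0 (k - 1 / Suc n)"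
          using onorm_bound[of "max 0 (k - 1 / Suc n)" D] by (simp add: k_def)
        then show False using kpos by (simp add: max_def split: if_splits)
      qed
      then obtain x where x: "max 0 (k - 1 / Suc n) * norm x < norm (D x)" by (auto simp: not_le)
      moreover have "(k - 1 / Suc n) * norm x \<le> max 0 (k - 1 / Suc n) * norm x"
        by (intro mult_right_mono) auto
      ultimately have x: "(k - 1 / Suc n) * norm x < norm (D x)" by linarith
      then have "x \<noteq> 0" using linear_0[OF bounded_linear.linear[OF Dlin]] by auto
      moreover have "D ((1 / norm x) *\<^sub>R x) = (1 / norm x) *\<^sub>R D x"
        by (rule linear_scale[OF bounded_linear.linear[OF Dlin]])
      ultimately show ?thesis using x
        by (intro exI[of _ "(1 / norm x) *\<^sub>R x"]) (simp add: field_simps)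
    qed
    then obtain x where x1: "\<And>n. norm (x n) = 1" and xk: "\<And>n. k - 1 / Suc n < norm (D (x n))"
      by metis
    have Dx: "(\<lambda>n. norm (D (x n))) \<longlonglongrightarrow> k"
    proof (rule tendsto_sandwich[where f="\<lambda>n. k - 1 / Suc n" and h="\<lambda>_. k"])
      show "(\<lambda>n. k - 1 / real (Suc n)) \<longlonglongrightarrow> k"
        using tendsto_diff[OF tendsto_const[of k] LIMSEQ_inverse_real_of_nat] by (simp add: field_simps)
      show "\<forall>\<^sub>F n in sequentially. norm (D (x n)) \<le> k"
        by (intro always_eventually allI, rule order_trans[OF Dk]) (simp add: x1)
    qed (use xk in \<open>auto intro!: always_eventually less_imp_le\<close>)
    \<comment> \<open>The defect of \<open>x n\<close> as an eigenvector of D^2 for the value k^2.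
      Its squared norm is at most k^2 (k^2 - |D x|^2), which tends to 0 along vectors that nearly
      attain the norm k.\<close>
    define r where "r n = D (D (x n)) - k^2 *\<^sub>R x n" for n
    have r_le: "(norm (r n))^2 \<le> k^2 * (k^2 - (norm (D (x n)))^2)" for n
    proof -
      have "(norm (r n))^2 = (norm (D (D (x n))))^2 - 2 * k^2 * (norm (D (x n)))^2 + k^2 * k^2 * (norm (x n))^2"
        by (simp add: r_def norm_sq_cinner cinner_simps Dsym)
           (simp add: power2_eq_square power4_eq_xxxx algebra_simps)
      also have "(norm (D (D (x n))))^2 \<le> (k * norm (D (x n)))^2"
        by (rule power_mono[OF Dk]) simp
      finally show ?thesis by (simp add: x1 power_mult_distrib algebra_simps)
    qed
    have "(\<lambda>n. (norm (r n))^2) \<longlonglongrightarrow> 0"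
    proof (rule tendsto_sandwich[where f="\<lambda>_. 0"])
      have "(\<lambda>n. k^2 * (k^2 - (norm (D (x n)))^2)) \<longlonglongrightarrow> k^2 * (k^2 - k^2)" by (intro tendsto_intros Dx)
      then show "(\<lambda>n. k^2 * (k^2 - (norm (D (x n)))^2)) \<longlonglongrightarrow> 0" by simp
    qed (use r_le in auto)
    then have "(\<lambda>n. sqrt ((norm (r n))^2)) \<longlonglongrightarrow> sqrt 0" by (rule tendsto_real_sqrt)
    then have r0: "(\<lambda>n. norm (r n)) \<longlonglongrightarrow> 0" by simp
    \<comment> \<open>By \<open>anti\<close>, <U D D x, x> = - <U' D x, D x> \<le> 0, while D D x is
      close to k^2 x. So <U x, x> is bounded by a null sequence, and U x tends to 0 by the
      inequality |U x|^2 \<le> K <U x, x>. Applied to both roots it forces D x to 0, against |D x|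
      tending to k.\<close>
    have small: "(\<lambda>n. norm (U (x n))) \<longlonglongrightarrow> 0"
      if U: "nonneg_selfadjoint U" and U': "nonneg_selfadjoint U'"
        and anti: "\<And>y. U (D y) = - D (U' y)" for U U' :: "'a \<Rightarrow> 'a"
    proof -
      note Uop = nonneg_selfadjointD(1)[OF U]
      obtain K where K: "K > 0" "\<And>x. norm (U x) \<le> K * norm x"
        using bounded_op_bound[OF Uop] by blast
      have le: "(norm (U (x n)))^2 \<le> K * (K * norm (r n) / k^2)" for n
      proof -
        let ?x = "x n"
        have "cinner (U (D (D ?x))) ?x = - cinner (U' (D ?x)) (D ?x)"
          by (simp add: anti cinner_minus_left Dsym)
        then have "Re (cinner (U (D (D ?x))) ?x) \<le> 0"
          using nonneg_selfadjointD(3)[OF U', of "D ?x"] by simp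
        moreover have "D (D ?x) = k^2 *\<^sub>R ?x + r n" by (simp add: r_def)
        ultimately have "k^2 * Re (cinner (U ?x) ?x) + Re (cinner (U (r n)) ?x) \<le> 0"
          by (simp add: bounded_op_add[OF Uop] bounded_op_scaleR[OF Uop] cinner_simps)
        moreover have "\<bar>Re (cinner (U (r n)) ?x)\<bar> \<le> K * norm (r n)"
          using abs_Re_le_cmod[of "cinner (U (r n)) ?x"] cinner_Cauchy_Schwarz[of "U (r n)" ?x]
            K(2)[of "r n"] x1[of n] by simp
        ultimately have "k^2 * Re (cinner (U ?x) ?x) \<le> K * norm (r n)" by linarith
        then have "Re (cinner (U ?x) ?x) \<le> K * norm (r n) / k^2"
          using kpos by (simp add: field_simps)
        then show ?thesis
          using nonneg_selfadjoint_norm_sq_le[OF U K(2), of ?x] K(1)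
          by (meson mult_left_mono order_trans less_imp_le)
      qed
      have "(\<lambda>n. (norm (U (x n)))^2) \<longlonglongrightarrow> 0"
      proof (rule tendsto_sandwich[where f="\<lambda>_. 0"])
        have "(\<lambda>n. K * (K * norm (r n) / k^2)) \<longlonglongrightarrow> K * (K * 0 / k^2)"
          using kpos by (intro tendsto_intros r0) auto
        then show "(\<lambda>n. K * (K * norm (r n) / k^2)) \<longlonglongrightarrow> 0" by simp
      qed (use le in auto)
      then have "(\<lambda>n. sqrt ((norm (U (x n)))^2)) \<longlonglongrightarrow> sqrt 0" by (rule tendsto_real_sqrt)
      then show ?thesis by simp
    qed
    have "(\<lambda>n. norm (S (x n)) + norm (S' (x n))) \<longlonglongrightarrow> 0 + 0"
    proof (intro tendsto_add)
      show "(\<lambda>n. norm (S (x n))) \<longlonglongrightarrow> 0"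
        by (rule small[OF S S']) (simp add: D_def bounded_op_diff[OF Sop] bounded_op_diff[OF Sop'] eq')
      show "(\<lambda>n. norm (S' (x n))) \<longlonglongrightarrow> 0"
        by (rule small[OF S' S]) (simp add: D_def bounded_op_diff[OF Sop] bounded_op_diff[OF Sop'] eq')
    qed
    then have lim: "(\<lambda>n. norm (S (x n)) + norm (S' (x n))) \<longlonglongrightarrow> 0" by simp
    have "norm (norm (D (x n))) \<le> norm (S (x n)) + norm (S' (x n))" for n
      by (simp add: D_def norm_triangle_ineq4)
    from Lim_null_comparison[OF always_eventually[OF allI[OF this]] lim]
    have "(\<lambda>n. norm (D (x n))) \<longlonglongrightarrow> 0" .
    from LIMSEQ_unique[OF this Dx] show False using kpos by simp
  qed
  then have "D x = 0" for x using Dk[of x] k0 by simp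
  then show ?thesis by (auto simp: D_def)
qed

lemma op_sqrt_works:
  assumes "nonneg_selfadjoint T"
  shows "nonneg_selfadjoint (op_sqrt T)" "op_sqrt T \<circ> op_sqrt T = T"
proof -
  have "\<exists>!S. nonneg_selfadjoint S \<and> S \<circ> S = T"
    using nonneg_selfadjoint_sqrt_exists[OF assms] nonneg_selfadjoint_sqrt_unique by metis
  from theI'[OF this] show "nonneg_selfadjoint (op_sqrt T)" "op_sqrt T \<circ> op_sqrt T = T"
    by (simp_all add: op_sqrt_def)
qed

section \<open>Trace condition and range of the square root\<close>

text \<open>T is a non-negative root of T T, and such a root is unique. This turns the absolute
  value in \<open>trace_class\<close> into the operator itself.\<close>

lemma op_abs_nonneg:
  assumes T: "nonneg_selfadjoint (T :: 'a::complex_hilbert \<Rightarrow> 'a)"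
  shows "op_abs T = T"
proof -
  note T' = nonneg_selfadjointD[OF T]
  have "op_adjoint T = T"
    unfolding op_adjoint_def
  proof (intro ext the_equality)
    fix y z assume "\<forall>x. cinner (T x) y = cinner x z"
    then show "z = T y" by (intro cinner_eqI) (simp add: T'(2))
  qed (simp add: T'(2))
  then have "op_abs T = op_sqrt (T \<circ> T)" by (simp add: op_abs_def)
  also have "\<dots> = T"
    unfolding op_sqrt_def using T nonneg_selfadjoint_sqrt_unique by blast
  finally show ?thesis .
qed

text \<open>Since <V e, e> = |sqrt V e|^2, the trace condition says that sqrt V is Hilbert-Schmidt;
  all later sums over B are dominated by these squares.\<close>

lemma trace_class_sqrt_Hilbert_Schmidt:
  assumes V: "nonneg_selfadjoint V" and tr: "trace_class V"
  obtains B where "orthonormal_basis B" "(\<lambda>e. (norm (op_sqrt V e))^2) summable_on B"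
proof -
  let ?S = "op_sqrt V"
  obtain B where B: "orthonormal_basis B" "(\<lambda>e. Re (cinner (op_abs V e) e)) summable_on B"
    using tr by (auto simp: trace_class_def)
  have "Re (cinner (op_abs V e) e) = (norm (?S e))^2" for e
  proof -
    have "V e = ?S (?S e)" using op_sqrt_works(2)[OF V] by (metis comp_apply)
    then show ?thesis
      using nonneg_selfadjointD(2)[OF op_sqrt_works(1)[OF V]]
      by (simp add: op_abs_nonneg[OF V] norm_sq_cinner)
  qed
  then show ?thesis using B that by simp
qed

lemma csubspace_closure_range:
  assumes T: "bounded_op (T :: 'a::complex_hilbert \<Rightarrow> 'a)"
  shows "csubspace (closure (range T))"
  unfolding csubspace_iff
proof (intro conjI ballI allI)
  show "0 \<in> closure (range T)"
    using closure_subset[of "range T"] rangeI[of T 0] by (auto simp: bounded_op_zero[OF T])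
next
  fix x y assume "x \<in> closure (range T)" "y \<in> closure (range T)"
  then obtain f g where f: "\<And>n::nat. f n \<in> range T" "f \<longlonglongrightarrow> x" and g: "\<And>n::nat. g n \<in> range T" "g \<longlonglongrightarrow> y"
    by (auto simp: closure_sequential)
  have "f n + g n \<in> range T" for n
    using f(1)[of n] g(1)[of n] by (auto simp flip: bounded_op_add[OF T])
  then show "x + y \<in> closure (range T)"
    unfolding closure_sequential
    by (intro exI[of _ "\<lambda>n. f n + g n"] conjI allI tendsto_add f(2) g(2))
next
  fix c x assume "x \<in> closure (range T)"
  then obtain f where f: "\<And>n::nat. f n \<in> range T" "f \<longlonglongrightarrow> x"
    by (auto simp: closure_sequential)
  have "c *\<^sub>C f n \<in> range T" for n
    using f(1)[of n] by (auto simp flip: bounded_op_scaleC[OF T])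
  then show "c *\<^sub>C x \<in> closure (range T)"
    unfolding closure_sequential
    by (intro exI[of _ "\<lambda>n. c *\<^sub>C f n"] conjI allI tendsto_scaleC tendsto_const f(2))
qed

text \<open>Let n be the part of sqrt V w orthogonal to the closure of the range of V. Then V n = 0,
  so |sqrt V n|^2 = <V n, n> = 0, and n is orthogonal to sqrt V w as well as to its projection;
  hence n = 0. This puts the Hardy functions into E.\<close>

lemma op_sqrt_in_closure_range:
  assumes V: "nonneg_selfadjoint (V :: 'a::complex_hilbert \<Rightarrow> 'a)"
  shows "op_sqrt V w \<in> closure (range V)"
proof -
  let ?S = "op_sqrt V"
  note V' = nonneg_selfadjointD[OF V] and S' = nonneg_selfadjointD[OF op_sqrt_works(1)[OF V]]
  obtain m where m: "m \<in> closure (range V)"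
    and orth: "\<And>y. y \<in> closure (range V) \<Longrightarrow> cinner (?S w - m) y = 0"
    using orthogonal_projection_exists[OF csubspace_closure_range[OF V'(1)] closed_closure, of "?S w"]
    by blast
  define n where "n = ?S w - m"
  have nV: "cinner n (V x) = 0" for x
    using orth[of "V x"] closure_subset[of "range V"] by (auto simp: n_def)
  then have "cinner (V n) n = 0" by (simp add: V'(2))
  moreover have "V n = ?S (?S n)" using op_sqrt_works(2)[OF V] by (metis comp_apply)
  ultimately have "cinner (?S n) (?S n) = 0" by (simp add: S'(2))
  then have "?S n = 0" by (simp add: cinner_self)
  then have "cinner n (?S w) = 0" by (simp add: S'(2)[symmetric])
  moreover have "cinner n m = 0" using orth[OF m] by (simp add: n_def)
  ultimately have "cinner n n = 0" by (subst (2) n_def) (simp add: cinner_diff_right)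
  then have "n = 0" by (simp add: cinner_self)
  then show ?thesis using m by (simp add: n_def)
qed

section \<open>Resolvents of self-adjoint operators\<close>

lemma eventually_Im_nonzero:
  assumes "Im z \<noteq> 0"
  shows "\<forall>\<^sub>F w in at z. Im w \<noteq> 0"
  by (rule tendsto_imp_eventually_ne[OF _ assms]) (intro tendsto_intros)

text \<open>The analytic argument uses the operator only through these four properties. They are
  inherited by the resolvent of -A, so the upper half-plane estimates can be instantiated
  twice.\<close>

locale selfadjoint_resolvent =
  fixes R :: "complex \<Rightarrow> 'a::complex_hilbert \<Rightarrow> 'a"
  assumes R_op: "Im z \<noteq> 0 \<Longrightarrow> bounded_op (R z)"
    and R_bound: "Im z \<noteq> 0 \<Longrightarrow> norm (R z u) \<le> norm u / \<bar>Im z\<bar>"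
    and R_adjoint: "Im z \<noteq> 0 \<Longrightarrow> cinner (R z u) v = cinner u (R (cnj z) v)"
    and R_identity: "Im z \<noteq> 0 \<Longrightarrow> Im w \<noteq> 0 \<Longrightarrow> R z u - R w u = (z - w) *\<^sub>C R z (R w u)"

lemma (in selfadjoint_resolvent) reflected: "selfadjoint_resolvent (\<lambda>z u. - R (- z) u)"
proof
  fix z w :: complex and u v :: 'a assume z: "Im z \<noteq> 0"
  then have z': "Im (- z) \<noteq> 0" by simp
  note op = R_op[OF z']
  show "bounded_op (\<lambda>u. - R (- z) u)"
    by (rule bounded_opI[where K="1 / \<bar>Im z\<bar>"])
       (use R_bound[OF z'] in \<open>simp_all add: bounded_op_add[OF op] bounded_op_scaleC[OF op] scaleC_minus_right\<close>)
  show "norm (- R (- z) u) \<le> norm u / \<bar>Im z\<bar>" using R_bound[OF z'] by simp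
  show "cinner (- R (- z) u) v = cinner u (- R (- cnj z) v)"
    using R_adjoint[OF z'] by (simp add: cinner_simps)
  show "- R (- z) u - - R (- w) u = (z - w) *\<^sub>C - R (- z) (- R (- w) u)" if "Im w \<noteq> 0"
  proof -
    have "Im (- w) \<noteq> 0" using that by simp
    from R_identity[OF z' this, of u] have "- R (- z) u - - R (- w) u = - ((- z - - w) *\<^sub>C R (- z) (R (- w) u))"
      by (simp add: algebra_simps)
    also have "\<dots> = (z - w) *\<^sub>C R (- z) (R (- w) u)"
      by (simp flip: scaleC_minus_left)
    finally show ?thesis by (simp add: bounded_op_minus[OF op])
  qed
qed

locale selfadjoint =
  fixes A :: "'a::complex_hilbert \<rightharpoonup> 'a"
  assumes sa: "selfadjoint_operator A"
begin

abbreviation a :: "'a \<Rightarrow> 'a" where "a x \<equiv> the (A x)"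

lemma dom_subspace: "csubspace (dom A)"
  and a_add: "x \<in> dom A \<Longrightarrow> y \<in> dom A \<Longrightarrow> a (x + y) = a x + a y"
  and a_scaleC: "x \<in> dom A \<Longrightarrow> a (c *\<^sub>C x) = c *\<^sub>C a x"
  and dom_dense: "closure (dom A) = UNIV"
  using sa by (auto simp: selfadjoint_operator_def linear_operator_def)

lemma dom_add: "x \<in> dom A \<Longrightarrow> y \<in> dom A \<Longrightarrow> x + y \<in> dom A"
  and dom_scaleC: "x \<in> dom A \<Longrightarrow> c *\<^sub>C x \<in> dom A"
  and dom_zero: "0 \<in> dom A"
  using dom_subspace by (auto simp only: csubspace_iff)

lemma dom_diff: "x \<in> dom A \<Longrightarrow> y \<in> dom A \<Longrightarrow> x - y \<in> dom A"
  and a_diff: "x \<in> dom A \<Longrightarrow> y \<in> dom A \<Longrightarrow> a (x - y) = a x - a y"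
  using dom_add[of x "(-1) *\<^sub>C y"] a_add[of x "(-1) *\<^sub>C y"] dom_scaleC[of y "-1"] a_scaleC[of y "-1"]
  by (simp_all add: scaleC_of_real_neg)

lemma eq_on_domI:
  assumes "\<And>x. x \<in> dom A \<Longrightarrow> cinner x y = cinner x z"
  shows "y = z"
proof -
  have "y - z \<in> closure (dom A)" using dom_dense by simp
  then obtain f where f: "\<And>n::nat. f n \<in> dom A" "f \<longlonglongrightarrow> y - z"
    unfolding closure_sequential by blast
  have "(\<lambda>n. cinner (f n) (y - z)) \<longlonglongrightarrow> cinner (y - z) (y - z)"
    by (intro tendsto_cinner f tendsto_const)
  moreover have "cinner (f n) (y - z) = 0" for n
    using assms[OF f(1)] by (simp add: cinner_diff_right)
  ultimately have "cinner (y - z) (y - z) = 0"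
    by (simp add: LIMSEQ_const_iff)
  then show ?thesis by (simp add: cinner_self)
qed

text \<open>Self-adjointness enters through this criterion: a vector for which x -> <A x, y> is
  represented by some z belongs to the domain. Density of the domain makes z unique, as the
  \<open>THE\<close> in \<open>adjoint_operator\<close> requires.\<close>

lemma adjoint_domI:
  assumes "\<And>x. x \<in> dom A \<Longrightarrow> cinner (a x) y = cinner x z"
  shows "y \<in> dom A" "a y = z"
proof -
  have "(THE z. \<forall>x\<in>dom A. cinner (a x) y = cinner x z) = z"
  proof (rule the_equality)
    show "\<forall>x\<in>dom A. cinner (a x) y = cinner x z" using assms by blast
    show "z' = z" if "\<forall>x\<in>dom A. cinner (a x) y = cinner x z'" for z'
      by (rule eq_on_domI) (metis that assms)
  qed
  then have "adjoint_operator A y = Some z"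
    using assms unfolding adjoint_operator_def by auto
  then have "A y = Some z" using sa by (simp add: selfadjoint_operator_def)
  then show "y \<in> dom A" "a y = z" by auto
qed

lemma a_symmetric:
  assumes x: "x \<in> dom A" and y: "y \<in> dom A"
  shows "cinner (a x) y = cinner x (a y)"
proof -
  have "adjoint_operator A y \<noteq> None" using sa y by (auto simp: selfadjoint_operator_def)
  then obtain z where z: "\<forall>x\<in>dom A. cinner (a x) y = cinner x z"
    unfolding adjoint_operator_def by (auto split: if_splits)
  then have "a y = z" by (intro adjoint_domI) auto
  then show ?thesis using z x by simp
qed

text \<open><A x, x> is real, so the imaginary part of <(A - z) x, x> is - Im z |x|^2;
  Cauchy-Schwarz does the rest.\<close>

lemma norm_lower_bound:
  assumes x: "x \<in> dom A"
  shows "\<bar>Im z\<bar> * norm x \<le> norm (a x - z *\<^sub>C x)"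
proof (cases "x = 0")
  case False
  have "Im (cinner (a x) x) = 0"
    using a_symmetric[OF x x] cinner_commute[of "a x" x] by (metis Reals_cnj_iff complex_is_Real_iff)
  then have "\<bar>Im z\<bar> * (norm x)^2 = \<bar>Im (cinner (a x - z *\<^sub>C x) x)\<bar>"
    by (simp add: cinner_simps cinner_self abs_mult)
  also have "\<dots> \<le> norm (a x - z *\<^sub>C x) * norm x"
    by (rule order_trans[OF abs_Im_le_cmod cinner_Cauchy_Schwarz])
  finally have "(\<bar>Im z\<bar> * norm x) * norm x \<le> norm (a x - z *\<^sub>C x) * norm x"
    by (simp add: power2_eq_square mult.assoc)
  then show ?thesis using False by simp
qed simp

lemma resolvent_unique:
  assumes "Im z \<noteq> 0" "x \<in> dom A" "y \<in> dom A" "a x - z *\<^sub>C x = a y - z *\<^sub>C y"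
  shows "x = y"
proof -
  have "a (x - y) - z *\<^sub>C (x - y) = 0"
    using assms by (simp add: a_diff scaleC_diff_right algebra_simps)
  with norm_lower_bound[OF dom_diff[OF assms(2,3)], of z] assms(1) show ?thesis
    by (simp add: mult_le_0_iff)
qed

text \<open>The range of A - z is closed by the lower bound, and a vector orthogonal to it is an
  eigenvector of A for the value cnj z, which the lower bound excludes unless it is 0.\<close>

lemma resolvent_exists:
  assumes z: "Im z \<noteq> 0"
  shows "\<exists>x\<in>dom A. a x - z *\<^sub>C x = u"
proof -
  define M where "M = (\<lambda>x. a x - z *\<^sub>C x) ` dom A"
  have sub: "csubspace M"
    unfolding csubspace_iff
  proof (intro conjI ballI allI)
    show "0 \<in> M"
      unfolding M_def using dom_zero a_scaleC[OF dom_zero, of 0] by (intro image_eqI[of _ _ 0]) auto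
    show "p + q \<in> M" if "p \<in> M" "q \<in> M" for p q
    proof -
      from that obtain x y where "x \<in> dom A" "y \<in> dom A" "p = a x - z *\<^sub>C x" "q = a y - z *\<^sub>C y"
        by (auto simp only: M_def image_iff)
      then show ?thesis
        unfolding M_def by (intro image_eqI[of _ _ "x + y"]) (simp_all add: a_add dom_add scaleC_add_right)
    qed
    show "c *\<^sub>C p \<in> M" if "p \<in> M" for c p
    proof -
      from that obtain x where "x \<in> dom A" "p = a x - z *\<^sub>C x"
        by (auto simp only: M_def image_iff)
      then show ?thesis
        unfolding M_def
        by (intro image_eqI[of _ _ "c *\<^sub>C x"])
           (simp_all add: a_scaleC dom_scaleC scaleC_diff_right scaleC_scaleC mult.commute)
    qed
  qed
  have "closed M"
    unfolding closed_sequential_limits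
  proof (intro allI impI)
    fix f l assume "(\<forall>n. f n \<in> M) \<and> f \<longlonglongrightarrow> l"
    then have f: "\<And>n. f n \<in> M" "f \<longlonglongrightarrow> l" by auto
    then have "\<exists>x. \<forall>n. x n \<in> dom A \<and> f n = a (x n) - z *\<^sub>C x n"
      by (intro choice) (auto simp only: M_def image_iff Bex_def)
    then obtain x where x: "\<And>n. x n \<in> dom A" "\<And>n. f n = a (x n) - z *\<^sub>C x n" by blast
    have "Cauchy x"
    proof (rule metric_CauchyI)
      fix e :: real assume e: "0 < e"
      have "Cauchy f" using f(2) by (rule LIMSEQ_imp_Cauchy)
      then obtain N where N: "\<And>m n. m \<ge> N \<Longrightarrow> n \<ge> N \<Longrightarrow> dist (f m) (f n) < \<bar>Im z\<bar> * e"
        using e z by (meson metric_CauchyD mult_pos_pos zero_less_abs_iff)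
      show "\<exists>N. \<forall>m\<ge>N. \<forall>n\<ge>N. dist (x m) (x n) < e"
      proof (intro exI[of _ N] allI impI)
        fix m n assume mn: "N \<le> m" "N \<le> n"
        have "\<bar>Im z\<bar> * norm (x m - x n) \<le> norm (f m - f n)"
          using norm_lower_bound[OF dom_diff[OF x(1) x(1)], of z m n]
          by (simp add: x a_diff scaleC_diff_right algebra_simps)
        also have "\<dots> < \<bar>Im z\<bar> * e" using N[OF mn] by (simp add: dist_norm)
        finally show "dist (x m) (x n) < e" using z by (simp add: dist_norm)
      qed
    qed
    then obtain y where y: "x \<longlonglongrightarrow> y" using Cauchy_convergent_iff convergent_def by blast
    have ax: "(\<lambda>n. a (x n)) \<longlonglongrightarrow> l + z *\<^sub>C y"
    proof -
      have "(\<lambda>n. f n + z *\<^sub>C x n) \<longlonglongrightarrow> l + z *\<^sub>C y"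
        by (intro tendsto_add f tendsto_scaleC y tendsto_const)
      then show ?thesis by (simp add: x)
    qed
    \<comment> \<open>A is closed because it equals its adjoint: passing to the limit in the
      symmetry relation places y in the domain.\<close>
    have "cinner (a w) y = cinner w (l + z *\<^sub>C y)" if w: "w \<in> dom A" for w
    proof -
      have "(\<lambda>n. cinner (a w) (x n)) \<longlonglongrightarrow> cinner (a w) y"
        by (intro tendsto_cinner y tendsto_const)
      moreover have "(\<lambda>n. cinner w (a (x n))) \<longlonglongrightarrow> cinner w (l + z *\<^sub>C y)"
        by (intro tendsto_cinner ax tendsto_const)
      ultimately show ?thesis by (simp add: a_symmetric[OF w x(1)] LIMSEQ_unique)
    qed
    from adjoint_domI[OF this] have "y \<in> dom A" "l = a y - z *\<^sub>C y" by auto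
    then show "l \<in> M" unfolding M_def by (rule image_eqI[rotated])
  qed
  then obtain m where m: "m \<in> M" and orth: "\<And>y. y \<in> M \<Longrightarrow> cinner (u - m) y = 0"
    using orthogonal_projection_exists[OF sub, of u] by blast
  define n where "n = u - m"
  have "cinner (a x) n = cinner x (cnj z *\<^sub>C n)" if x: "x \<in> dom A" for x
  proof -
    have "a x - z *\<^sub>C x \<in> M" unfolding M_def using x by (rule imageI)
    then have "cinner n (a x - z *\<^sub>C x) = 0" using orth by (simp only: n_def)
    then have "cinner (a x - z *\<^sub>C x) n = 0" using cinner_commute[of "a x - z *\<^sub>C x" n] by simp
    then show ?thesis by (simp add: cinner_simps)
  qed
  from adjoint_domI[OF this] have "n \<in> dom A" "a n = cnj z *\<^sub>C n" by auto
  with norm_lower_bound[of n "cnj z"] z have "n = 0" by (simp add: mult_le_0_iff)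
  then show ?thesis using m by (auto simp: n_def M_def)
qed

lemma resolvent_eq:
  assumes "Im z \<noteq> 0" "x \<in> dom A" "a x - z *\<^sub>C x = u"
  shows "resolvent A z u = x"
  unfolding resolvent_def using assms resolvent_unique[OF assms(1)] by (intro the_equality) auto

lemma resolvent_works:
  assumes z: "Im z \<noteq> 0"
  shows "resolvent A z u \<in> dom A" "a (resolvent A z u) - z *\<^sub>C resolvent A z u = u"
proof -
  obtain x where x: "x \<in> dom A" "a x - z *\<^sub>C x = u" using resolvent_exists[OF z] by blast
  show "resolvent A z u \<in> dom A" "a (resolvent A z u) - z *\<^sub>C resolvent A z u = u"
    unfolding resolvent_eq[OF z x] by (fact x)+
qed

lemma selfadjoint_resolvent: "selfadjoint_resolvent (resolvent A)"
proof
  fix z w :: complex and u v :: 'a assume z: "Im z \<noteq> 0"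
  let ?R = "resolvent A"
  note Rz = resolvent_works[OF z]
  show bound: "norm (?R z u) \<le> norm u / \<bar>Im z\<bar>" for u
    using norm_lower_bound[OF Rz(1), of z u] z by (simp add: Rz(2) field_simps)
  show "bounded_op (?R z)"
  proof (rule bounded_opI[where K="1 / \<bar>Im z\<bar>"])
    show "norm (?R z x) \<le> 1 / \<bar>Im z\<bar> * norm x" for x using bound[of x] by simp
    show "?R z (x + y) = ?R z x + ?R z y" for x y
      using Rz(2)[of x] Rz(2)[of y]
      by (intro resolvent_eq[OF z] dom_add Rz(1)) (simp add: a_add Rz(1) scaleC_add_right algebra_simps)
    show "?R z (c *\<^sub>C x) = c *\<^sub>C ?R z x" for c x
    proof (rule resolvent_eq[OF z dom_scaleC[OF Rz(1)]])
      show "a (c *\<^sub>C ?R z x) - z *\<^sub>C c *\<^sub>C ?R z x = c *\<^sub>C x"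
        by (subst (3) Rz(2)[symmetric])
           (simp add: a_scaleC Rz(1) scaleC_diff_right scaleC_scaleC mult.commute)
    qed
  qed
  show "cinner (?R z u) v = cinner u (?R (cnj z) v)"
  proof -
    have cz: "Im (cnj z) \<noteq> 0" using z by simp
    note Rc = resolvent_works[OF cz]
    have "cinner (?R z u) v = cinner (?R z u) (a (?R (cnj z) v)) - z * cinner (?R z u) (?R (cnj z) v)"
      by (subst (1) Rc(2)[symmetric]) (simp add: cinner_simps)
    also have "\<dots> = cinner (a (?R z u) - z *\<^sub>C ?R z u) (?R (cnj z) v)"
      by (simp add: cinner_simps a_symmetric[OF Rz(1) Rc(1)])
    also have "\<dots> = cinner u (?R (cnj z) v)" by (simp only: Rz(2))
    finally show ?thesis .
  qed
  show "?R z u - ?R w u = (z - w) *\<^sub>C ?R z (?R w u)" if w: "Im w \<noteq> 0"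
  proof -
    note Rw = resolvent_works[OF w]
    \<comment> \<open>The candidate is the right side of the resolvent identity; it solves (A - z) x
      = u, and solutions are unique.\<close>
    define x where "x = ?R w u + (z - w) *\<^sub>C ?R z (?R w u)"
    have "a (?R z (?R w u)) = ?R w u + z *\<^sub>C ?R z (?R w u)"
      using Rz(2)[of "?R w u"] by (simp add: algebra_simps)
    moreover have "a (?R w u) = u + w *\<^sub>C ?R w u"
      using Rw(2)[of u] by (simp add: algebra_simps)
    moreover have "a x = a (?R w u) + (z - w) *\<^sub>C a (?R z (?R w u))"
      by (simp add: x_def a_add a_scaleC dom_scaleC Rz(1) Rw(1))
    ultimately have ax: "a x = (u + w *\<^sub>C ?R w u) + (z - w) *\<^sub>C (?R w u + z *\<^sub>C ?R z (?R w u))"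
      by (simp only:)
    have "a x - z *\<^sub>C x = u"
      unfolding ax by (simp add: x_def scaleC_add_right scaleC_diff_left scaleC_diff_right scaleC_scaleC algebra_simps)
    moreover have "x \<in> dom A" by (simp add: x_def dom_add dom_scaleC Rz(1) Rw(1))
    ultimately have "?R z u = x" by (intro resolvent_eq[OF z])
    then show ?thesis by (simp add: x_def)
  qed
qed

end

section \<open>Cauchy, Poisson and Schwarz formulas in the half-plane\<close>

lemma integrable_inverse_1_plus_square_lborel: "integrable lborel (\<lambda>t::real. 1 / (1 + t^2))"
  using integrable_inverse_1_plus_square by (simp add: set_integrable_def inverse_eq_divide)

text \<open>Makes each Cauchy kernel comparable with 1 / sqrt (1 + t^2), so that products of two
  kernels are dominated by the integrable 1 / (1 + t^2).\<close>

lemma square_le_dist_nonreal: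
  assumes "Im a \<noteq> 0"
  obtains K where "K > 0" "\<And>t::real. sqrt (1 + t^2) \<le> K * cmod (of_real t - a)"
proof -
  \<comment> \<open>The first summand absorbs 1 + |a| through |Im a| \<le> |t - a|; the final 1
    absorbs the remaining |t - a| of the triangle inequality.\<close>
  define K where "K = (1 + cmod a) / \<bar>Im a\<bar> + 1"
  have K: "K > 0" using assms by (simp add: K_def add_pos_pos add_nonneg_pos)
  have "sqrt (1 + t^2) \<le> K * cmod (of_real t - a)" for t :: real
  proof -
    have "\<bar>Im a\<bar> \<le> cmod (of_real t - a)"
      using abs_Im_le_cmod[of "of_real t - a"] by simp
    then have 1: "1 + cmod a \<le> (1 + cmod a) / \<bar>Im a\<bar> * cmod (of_real t - a)"
      using assms mult_left_mono[of "\<bar>Im a\<bar>" "cmod (of_real t - a)" "(1 + cmod a) / \<bar>Im a\<bar>"] by simp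
    have "sqrt (1 + t^2) \<le> 1 + \<bar>t\<bar>"
      by (rule real_le_lsqrt) (auto simp: power2_eq_square algebra_simps)
    also have "\<bar>t\<bar> = cmod (of_real t)" by simp
    also have "\<dots> \<le> cmod (of_real t - a) + cmod a"
      using norm_triangle_ineq[of "of_real t - a" a] by simp
    finally show ?thesis using 1 by (simp add: K_def algebra_simps)
  qed
  then show ?thesis using that K by blast
qed

lemma of_real_ne_nonreal: "Im a \<noteq> 0 \<Longrightarrow> complex_of_real t \<noteq> a"
  by auto

text \<open>A single Cauchy kernel decays only like 1 / |t| and is not integrable against a bounded
  function; the difference of two decays like 1 / t^2.\<close>

lemma kernel_difference_bound:
  assumes "Im a \<noteq> 0" "Im b \<noteq> 0"
  obtains K where "K > 0"
    "\<And>t::real. cmod (1 / (of_real t - a) - 1 / (of_real t - b)) \<le> K * (1 / (1 + t^2))"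
proof -
  obtain K1 where K1: "K1 > 0" "\<And>t::real. sqrt (1 + t^2) \<le> K1 * cmod (of_real t - a)"
    using square_le_dist_nonreal[OF assms(1)] by blast
  obtain K2 where K2: "K2 > 0" "\<And>t::real. sqrt (1 + t^2) \<le> K2 * cmod (of_real t - b)"
    using square_le_dist_nonreal[OF assms(2)] by blast
  have "cmod (1 / (of_real t - a) - 1 / (of_real t - b)) \<le> (cmod (a - b) * (K1 * K2) + 1) * (1 / (1 + t^2))" for t :: real
  proof -
    have ne: "complex_of_real t \<noteq> a" "complex_of_real t \<noteq> b"
      using assms of_real_ne_nonreal by auto
    have pos: "cmod (of_real t - a) * cmod (of_real t - b) > 0" using ne by simp
    have "1 + t^2 = sqrt (1 + t^2) * sqrt (1 + t^2)"
      by (simp add: add_nonneg_nonneg)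
    also have "\<dots> \<le> (K1 * cmod (of_real t - a)) * (K2 * cmod (of_real t - b))"
      using K1 K2 by (intro mult_mono) auto
    finally have le: "1 + t^2 \<le> (K1 * K2) * (cmod (of_real t - a) * cmod (of_real t - b))"
      by (simp add: mult_ac)
    have t: "0 < 1 + t^2" by (simp add: add_pos_nonneg)
    have inv: "1 / (cmod (of_real t - a) * cmod (of_real t - b)) \<le> (K1 * K2) / (1 + t^2)"
      using le pos t by (simp add: divide_simps mult_ac)
    have "1 / (of_real t - a) - 1 / (of_real t - b) = (a - b) / ((of_real t - a) * (of_real t - b))"
      using ne by (simp add: field_simps)
    then have "cmod (1 / (of_real t - a) - 1 / (of_real t - b))
        = cmod (a - b) * (1 / (cmod (of_real t - a) * cmod (of_real t - b)))"
      by (simp add: norm_divide norm_mult)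
    also have "\<dots> \<le> cmod (a - b) * ((K1 * K2) / (1 + t^2))"
      by (intro mult_left_mono inv) auto
    also have "\<dots> \<le> (cmod (a - b) * (K1 * K2) + 1) * (1 / (1 + t^2))"
      using t by (simp add: divide_simps)
    finally show ?thesis .
  qed
  moreover have "cmod (a - b) * (K1 * K2) + 1 > 0" using K1 K2 by (simp add: add_nonneg_pos)
  ultimately show ?thesis using that by blast
qed

lemma integrable_dominated_by_inverse_square:
  fixes f :: "real \<Rightarrow> complex"
  assumes "f \<in> borel_measurable lborel" and "\<And>t. cmod (f t) \<le> K * (1 / (1 + t^2))"
  shows "integrable lborel f"
proof (rule Bochner_Integration.integrable_bound[OF _ assms(1)])
  show "integrable lborel (\<lambda>t. K * (1 / (1 + t^2)))"
    by (intro integrable_mult_right integrable_inverse_1_plus_square_lborel)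
  show "AE t in lborel. cmod (f t) \<le> norm (K * (1 / (1 + t^2)))"
    using assms(2) by (intro AE_I2) (smt (verit) real_norm_def)
qed

text \<open>Cauchy's formula on the rectangles with base [-n, n] and height n. The second pole b
  lies outside the half-plane and leaves the value unchanged, but its subtraction makes the
  integrand O(1 / n^2) on the other three sides.\<close>

lemma half_plane_Cauchy:
  assumes cont: "continuous_on {z. 0 \<le> Im z} g" and hol: "g holomorphic_on {z. 0 < Im z}"
    and bdd: "\<And>z. 0 \<le> Im z \<Longrightarrow> cmod (g z) \<le> C" and a: "0 < Im a" and b: "Im b < 0"
  shows "integrable lborel (\<lambda>t. g (of_real t) * (1 / (of_real t - a) - 1 / (of_real t - b)))"
    and "(\<integral>t. g (of_real t) * (1 / (of_real t - a) - 1 / (of_real t - b)) \<partial>lborel) = 2 * of_real pi * \<i> * g a"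
proof -
  have C0: "0 \<le> C" using order_trans[OF norm_ge_zero bdd[of 0]] by simp
  have ab: "Im a \<noteq> 0" "Im b \<noteq> 0" using a b by auto
  define F where "F z = g z * (1 / (z - a) - 1 / (z - b))" for z
  have cr: "continuous_on UNIV (\<lambda>t::real. F (of_real t))"
    unfolding F_def using of_real_ne_nonreal ab
    by (intro continuous_intros continuous_on_compose2[OF cont]) auto
  then have meas: "(\<lambda>t::real. F (of_real t)) \<in> borel_measurable lborel"
    by (simp add: borel_measurable_continuous_onI)
  obtain K where K: "K > 0" "\<And>t::real. cmod (1 / (of_real t - a) - 1 / (of_real t - b)) \<le> K * (1 / (1 + t^2))"
    using kernel_difference_bound[OF ab] by blast
  have Fb: "cmod (F (of_real t)) \<le> C * K * (1 / (1 + t^2))" for t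
    unfolding F_def norm_mult mult.assoc using K bdd C0 by (intro mult_mono) auto
  have int: "integrable lborel (\<lambda>t. F (of_real t))"
    by (rule integrable_dominated_by_inverse_square[OF meas Fb])
  then show "integrable lborel (\<lambda>t. g (of_real t) * (1 / (of_real t - a) - 1 / (of_real t - b)))"
    by (simp add: F_def)
  have lim1: "(\<lambda>n. \<integral>t. indicator {- real n..real n} t *\<^sub>R F (of_real t) \<partial>lborel) \<longlonglongrightarrow> (\<integral>t. F (of_real t) \<partial>lborel)"
  proof (rule integral_dominated_convergence[where w="\<lambda>t. cmod (F (of_real t))"])
    show "AE t in lborel. (\<lambda>n. indicator {- real n..real n} t *\<^sub>R F (of_real t)) \<longlonglongrightarrow> F (of_real t)"
    proof (rule AE_I2)
      fix t :: real
      obtain N where N: "\<bar>t\<bar> \<le> real N" using real_arch_simple by blast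
      have "\<forall>\<^sub>F n in sequentially. indicator {- real n..real n} t *\<^sub>R F (of_real t) = F (of_real t)"
        using eventually_ge_at_top[of N] by eventually_elim (use N in \<open>auto simp: indicator_def\<close>)
      then show "(\<lambda>n. indicator {- real n..real n} t *\<^sub>R F (of_real t)) \<longlonglongrightarrow> F (of_real t)"
        by (rule tendsto_eventually)
    qed
  qed (use int meas in \<open>auto simp: indicator_def\<close>)
  \<comment> \<open>The three sides away from the real line have total length 4 n, and the fraction
    bounds the integrand on them.\<close>
  have est: "cmod ((\<integral>t. indicator {- real n..real n} t *\<^sub>R F (of_real t) \<partial>lborel) - 2 * of_real pi * \<i> * g a)
      \<le> 4 * real n * (C * cmod (a - b) / ((real n - cmod a) * (real n - cmod b)))"
    if n: "real n > cmod a" "real n > cmod b" for n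
  proof -
    define r where "r = real n"
    have r: "r > cmod a" "r > cmod b" "r > 0"
      using n norm_ge_zero[of a] unfolding r_def by linarith+
    define p1 p3 where "p1 = complex_of_real (- r)" and "p3 = Complex r r"
    define p2 p4 where "p2 = complex_of_real r" and "p4 = Complex (- r) r"
    have rect: "rectpath p1 p3 = linepath p1 p2 +++ linepath p2 p3 +++ linepath p3 p4 +++ linepath p4 p1"
      by (simp add: rectpath_def Let_def p1_def p2_def p3_def p4_def complex_of_real_def)
    let ?S = "{z. 0 \<le> Im z}"
    have intS: "interior ?S = {z. 0 < Im z}" 
      using interior_halfspace_ge[of \<i> 0] by (simp add: inner_complex_def)
    have abox: "a \<in> box p1 p3"
      using r a abs_Re_le_cmod[of a] abs_Im_le_cmod[of a] by (auto simp: in_box_complex_iff p1_def p3_def)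
    have img: "path_image (rectpath p1 p3) \<subseteq> ?S - {a}"
    proof -
      have "path_image (rectpath p1 p3) \<subseteq> ?S"
        using r by (subst path_image_rectpath) (auto simp: p1_def p3_def)
      moreover have "a \<notin> path_image (rectpath p1 p3)"
        using abox path_image_rectpath_inter_box[of p1 p3] r by (auto simp: p1_def p3_def)
      ultimately show ?thesis by blast
    qed
    \<comment> \<open>Then F z = f z / (z - a) and f a = g a. The base of the rectangle lies on the
      real line, where f is merely continuous, which is why the weak form of Cauchy's formula is
      applied.\<close>
    define f where "f z = g z * (a - b) / (z - b)" for z
    have "((\<lambda>w. f w / (w - a)) has_contour_integral
        (2 * pi * \<i> * winding_number (rectpath p1 p3) a * f a)) (rectpath p1 p3)"
    proof (rule Cauchy_integral_formula_weak[where S="?S" and k="{}"])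
      show "convex ?S" by (rule convex_halfspace_Im_ge)
      show "continuous_on ?S f" unfolding f_def using b by (intro continuous_intros cont) auto
      show "f field_differentiable at z" if "z \<in> interior ?S - {}" for z
      proof -
        have "f holomorphic_on {z. 0 < Im z}" unfolding f_def using b by (intro holomorphic_intros hol) auto
        then show ?thesis using that by (simp add: intS holomorphic_on_imp_differentiable_at open_halfspace_Im_gt)
      qed
      show "a \<in> interior ?S - {}" using a by (simp add: intS)
      show "path_image (rectpath p1 p3) \<subseteq> ?S - {a}" by (rule img)
    qed auto
    moreover have "f a = g a" using a b by (auto simp: f_def)
    moreover have "winding_number (rectpath p1 p3) a = 1" by (rule winding_number_rectpath[OF abox])
    moreover have "f w / (w - a) = F w" if "w \<in> path_image (rectpath p1 p3)" for w
    proof -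
      have "w \<noteq> a" "w \<noteq> b" using that img b by auto
      then show ?thesis by (simp add: f_def F_def field_simps)
    qed
    ultimately have FI: "(F has_contour_integral (2 * pi * \<i> * g a)) (rectpath p1 p3)"
      by (auto intro: has_contour_integral_eq)
    have cont_seg: "continuous_on (closed_segment x y) F"
      if "closed_segment x y \<subseteq> path_image (rectpath p1 p3)" for x y
    proof -
      have "continuous_on (path_image (rectpath p1 p3)) F"
        unfolding F_def using img b
        by (intro continuous_intros continuous_on_subset[OF cont]) auto
      then show ?thesis using that continuous_on_subset by blast
    qed
    have pim: "path_image (rectpath p1 p3) = closed_segment p1 p2 \<union> closed_segment p2 p3 \<union> closed_segment p3 p4 \<union> closed_segment p4 p1"
      unfolding rect by (simp add: path_image_join Un_assoc)
    have ci: "F contour_integrable_on linepath p1 p2" "F contour_integrable_on linepath p2 p3"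
      "F contour_integrable_on linepath p3 p4" "F contour_integrable_on linepath p4 p1"
      by (intro contour_integrable_continuous_linepath cont_seg; simp add: pim; blast)+
    have "contour_integral (rectpath p1 p3) F = contour_integral (linepath p1 p2) F + (contour_integral (linepath p2 p3) F
        + (contour_integral (linepath p3 p4) F + contour_integral (linepath p4 p1) F))"
      unfolding rect using ci by (simp add: contour_integrable_join)
    then have sum: "contour_integral (linepath p1 p2) F - 2 * pi * \<i> * g a
      = - (contour_integral (linepath p2 p3) F + contour_integral (linepath p3 p4) F + contour_integral (linepath p4 p1) F)"
      using contour_integral_unique[OF FI] by (simp add: algebra_simps)
    define B where "B = C * cmod (a - b) / ((r - cmod a) * (r - cmod b))"
    have B0: "B \<ge> 0" using C0 r by (simp add: B_def)
    have FB: "cmod (F w) \<le> B" if "r \<le> cmod w" "0 \<le> Im w" for w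
    proof -
      have 1: "r - cmod a \<le> cmod (w - a)" "r - cmod b \<le> cmod (w - b)"
        using that norm_triangle_ineq2[of w a] norm_triangle_ineq2[of w b] by linarith+
      then have ne: "w \<noteq> a" "w \<noteq> b" using r by auto
      have "F w = g w * (a - b) / ((w - a) * (w - b))"
        using ne by (simp add: F_def field_simps)
      then have "cmod (F w) = cmod (g w) * cmod (a - b) / (cmod (w - a) * cmod (w - b))"
        by (simp add: norm_mult norm_divide)
      also have "\<dots> \<le> B"
        unfolding B_def using bdd[OF that(2)] 1 r C0 by (intro frac_le mult_mono mult_right_mono) auto
      finally show ?thesis .
    qed
    have seg: "r \<le> cmod w \<and> 0 \<le> Im w" if "w \<in> closed_segment p2 p3 \<union> closed_segment p3 p4 \<union> closed_segment p4 p1" for w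
    proof -
      have "\<bar>Re w\<bar> = r \<or> Im w = r"
        using that r by (auto simp: closed_segment_same_Re closed_segment_same_Im p1_def p2_def p3_def p4_def)
      then have "r \<le> cmod w"
        using abs_Re_le_cmod[of w] abs_Im_le_cmod[of w] by linarith
      moreover have "0 \<le> Im w" using that img by (auto simp: pim)
      ultimately show ?thesis by simp
    qed
    have "cmod (contour_integral (linepath p2 p3) F) \<le> B * cmod (p3 - p2)"
      "cmod (contour_integral (linepath p3 p4) F) \<le> B * cmod (p4 - p3)"
      "cmod (contour_integral (linepath p4 p1) F) \<le> B * cmod (p1 - p4)"
      by (intro contour_integral_bound_linepath ci B0 FB; use seg in blast)+
    moreover have "p3 - p2 = of_real r * \<i>" "p4 - p3 = - of_real (2 * r)" "p1 - p4 = - (of_real r * \<i>)"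
      by (simp_all add: p1_def p2_def p3_def p4_def complex_eq_iff)
    ultimately have "cmod (contour_integral (linepath p2 p3) F) \<le> B * r"
      "cmod (contour_integral (linepath p3 p4) F) \<le> B * (2 * r)"
      "cmod (contour_integral (linepath p4 p1) F) \<le> B * r"
      using r by (simp_all add: norm_mult)
    then have "cmod (contour_integral (linepath p1 p2) F - 2 * pi * \<i> * g a) \<le> 4 * r * B"
      unfolding sum norm_minus_cancel
      using norm_triangle_ineq[of "contour_integral (linepath p2 p3) F + contour_integral (linepath p3 p4) F" "contour_integral (linepath p4 p1) F"]
        norm_triangle_ineq[of "contour_integral (linepath p2 p3) F" "contour_integral (linepath p3 p4) F"]
      by (simp add: mult.commute)
    moreover have "contour_integral (linepath p1 p2) F = (\<integral>t. indicator {- real n..real n} t *\<^sub>R F (of_real t) \<partial>lborel)"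
    proof -
      have "contour_integral (linepath p1 p2) F = integral {- r..r} (\<lambda>x. F (of_real x))"
        using r by (subst contour_integral_linepath_Reals_eq) (simp_all add: p1_def p2_def)
      also have "\<dots> = (LINT t:{- r..r}|lborel. F (of_real t))"
      proof (rule set_borel_integral_eq_integral(2)[symmetric])
        show "set_integrable lborel {- r..r} (\<lambda>t. F (of_real t))"
          unfolding set_integrable_def using integrable_mult_indicator[OF _ int, of "{- r..r}"] by simp
      qed
      finally show ?thesis by (simp add: set_lebesgue_integral_def r_def)
    qed
    ultimately show ?thesis by (simp add: r_def B_def)
  qed
  have lim2: "(\<lambda>n. 4 * real n * (C * cmod (a - b) / ((real n - cmod a) * (real n - cmod b)))) \<longlonglongrightarrow> 0"
    by real_asymp
  have "\<forall>\<^sub>F n in sequentially. real n > cmod a \<and> real n > cmod b"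
    by (intro eventually_conj; real_asymp)
  then have "\<forall>\<^sub>F n in sequentially. cmod ((\<integral>t. indicator {- real n..real n} t *\<^sub>R F (of_real t) \<partial>lborel) - 2 * of_real pi * \<i> * g a)
      \<le> 4 * real n * (C * cmod (a - b) / ((real n - cmod a) * (real n - cmod b)))"
    by eventually_elim (use est in auto)
  from Lim_null_comparison[OF this lim2]
  have "(\<lambda>n. \<integral>t. indicator {- real n..real n} t *\<^sub>R F (of_real t) \<partial>lborel) \<longlonglongrightarrow> 2 * of_real pi * \<i> * g a"
    by (simp add: LIM_zero_iff)
  from LIMSEQ_unique[OF lim1 this]
  show "(\<integral>t. g (of_real t) * (1 / (of_real t - a) - 1 / (of_real t - b)) \<partial>lborel) = 2 * of_real pi * \<i> * g a"
    by (simp add: F_def)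
qed

text \<open>Left unnormalized: its integral over the real line is pi.\<close>

abbreviation Poisson_kernel :: "complex \<Rightarrow> real \<Rightarrow> real" where
  "Poisson_kernel a t \<equiv> Im a / (cmod (of_real t - a))^2"

text \<open>The choice b = cnj a turns the difference of Cauchy kernels into 2 i times the Poisson
  kernel.\<close>

lemma half_plane_Poisson:
  assumes cont: "continuous_on {z. 0 \<le> Im z} g" and hol: "g holomorphic_on {z. 0 < Im z}"
    and bdd: "\<And>z. 0 \<le> Im z \<Longrightarrow> cmod (g z) \<le> C" and a: "0 < Im a"
  shows "integrable lborel (\<lambda>t. g (of_real t) * of_real (Poisson_kernel a t))"
    and "(\<integral>t. g (of_real t) * of_real (Poisson_kernel a t) \<partial>lborel) = of_real pi * g a"
proof -
  have b: "Im (cnj a) < 0" using a by simp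
  have ker: "1 / (of_real t - a) - 1 / (of_real t - cnj a) = 2 * \<i> * of_real (Poisson_kernel a t)" for t :: real
  proof -
    have ne: "of_real t - a \<noteq> 0" "of_real t - cnj a \<noteq> 0"
      using a by (auto simp: complex_eq_iff)
    have "(of_real t - a) * (of_real t - cnj a) = of_real ((cmod (of_real t - a))^2)"
      by (simp only: complex_norm_square) simp
    moreover have "1 / (of_real t - a) - 1 / (of_real t - cnj a) = (a - cnj a) / ((of_real t - a) * (of_real t - cnj a))"
      using ne by (simp add: field_simps)
    moreover have "a - cnj a = 2 * \<i> * of_real (Im a)" by (simp add: complex_eq_iff)
    ultimately show ?thesis by simp
  qed
  note I = half_plane_Cauchy[OF cont hol bdd a b, unfolded ker]
  have c: "y * p = (1 / (2 * \<i>)) * (y * (2 * \<i> * p))" for y p :: complex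
    by (simp add: complex_eq_iff)
  have eq: "(\<lambda>t. g (of_real t) * of_real (Poisson_kernel a t))
    = (\<lambda>t. (1 / (2 * \<i>)) * (g (of_real t) * (2 * \<i> * of_real (Poisson_kernel a t))))"
    by (rule ext) (rule c)
  show "integrable lborel (\<lambda>t. g (of_real t) * of_real (Poisson_kernel a t))"
    unfolding eq by (intro integrable_mult_right I)
  show "(\<integral>t. g (of_real t) * of_real (Poisson_kernel a t) \<partial>lborel) = of_real pi * g a"
    unfolding eq by (subst integral_mult_right_zero, subst I(2), assumption, rule trans[OF _ c[symmetric]], simp only: mult_ac)
qed

lemma half_plane_Poisson_linear:
  assumes T: "bounded_linear (T :: complex \<Rightarrow> real)"
    and g: "continuous_on {z. 0 \<le> Im z} g" "g holomorphic_on {z. 0 < Im z}"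
    and bdd: "\<And>z. 0 \<le> Im z \<Longrightarrow> cmod (g z) \<le> C" and a: "0 < Im a"
  shows "integrable lborel (\<lambda>t. T (g (of_real t)) * Poisson_kernel a t)"
    and "(\<integral>t. T (g (of_real t)) * Poisson_kernel a t \<partial>lborel) = pi * T (g a)"
proof -
  have T_mult: "T (w * of_real r) = T w * r" for w r
    using bounded_linear.linear[OF T] linear_scale[of T r w] by (simp add: scaleR_conv_of_real mult.commute)
  have T_pi: "T (of_real pi * g a) = pi * T (g a)"
    using T_mult[of "g a" pi] by (simp only: mult.commute)
  have P: "integrable lborel (\<lambda>t. g (of_real t) * of_real (Poisson_kernel a t))"
    "(\<integral>t. g (of_real t) * of_real (Poisson_kernel a t) \<partial>lborel) = of_real pi * g a"
    by (rule half_plane_Poisson[OF g bdd a], assumption)+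
  show "integrable lborel (\<lambda>t. T (g (of_real t)) * Poisson_kernel a t)"
    using integrable_bounded_linear[OF T P(1)] unfolding T_mult .
  show "(\<integral>t. T (g (of_real t)) * Poisson_kernel a t \<partial>lborel) = pi * T (g a)"
    using integral_bounded_linear[OF T P(1)] unfolding P(2) T_mult T_pi .
qed

abbreviation Schwarz_kernel :: "complex \<Rightarrow> real \<Rightarrow> complex" where
  "Schwarz_kernel z t \<equiv> 1 / (z - of_real t) + of_real (t / (1 + t^2))"

text \<open>A Cauchy kernel difference with poles z and -i, plus i times the Poisson kernel at i.
  This both bounds the kernel by a multiple of 1 / (1 + t^2) and lets it be integrated by the two
  formulas above.\<close>

lemma Schwarz_kernel_eq:
  "Schwarz_kernel z t = - (1 / (of_real t - z) - 1 / (of_real t - (-\<i>))) + \<i> * of_real (1 / (1 + t^2))"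
proof -
  have ne: "1 + t^2 \<noteq> 0" "of_real t + \<i> \<noteq> 0"
    by (simp_all add: complex_eq_iff add_nonneg_eq_0_iff)
  have "(of_real t + \<i>) * (of_real t - \<i>) = of_real (1 + t^2)"
    by (simp add: complex_eq_iff power2_eq_square)
  then have "1 / (of_real t + \<i>) = (of_real t - \<i>) / of_real (1 + t^2)"
    using ne by (subst frac_eq_eq) (auto simp only: of_real_eq_0_iff mult_1 mult.commute)
  then show ?thesis by (simp add: diff_divide_distrib minus_divide_right)
qed

text \<open>Re g is half of g + cnj g. The part with g is Cauchy's formula at z, the part with cnj g
  is the conjugate of Cauchy's formula at i, and the Poisson part of the kernel contributes Re (g
  i); only Im (g i) survives of the values at i.\<close>

lemma half_plane_Schwarz:
  assumes cont: "continuous_on {z. 0 \<le> Im z} g" and hol: "g holomorphic_on {z. 0 < Im z}"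
    and bdd: "\<And>z. 0 \<le> Im z \<Longrightarrow> cmod (g z) \<le> C" and z: "0 < Im z"
  shows "(\<integral>t. Schwarz_kernel z t * of_real (Re (g (of_real t))) \<partial>lborel)
       = - (of_real pi * \<i> * (g z - \<i> * of_real (Im (g \<i>))))"
proof -
  let ?k = "\<lambda>t. 1 / (of_real t - z) - 1 / (of_real t - (-\<i>))"
  have b: "Im (-\<i>) < 0" "Im (cnj z) < 0" "0 < Im \<i>" using z by simp_all
  note I1 = half_plane_Cauchy[OF cont hol bdd z b(1)]
  note I2 = half_plane_Cauchy[OF cont hol bdd b(3) b(2)]
  note I3 = half_plane_Poisson[OF cont hol bdd b(3)]
  \<comment> \<open>Conjugation sends the poles i and cnj z to -i and z and thus reproduces the
    kernel up to sign.\<close>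
  have k2: "cnj (g (of_real t) * (1 / (of_real t - \<i>) - 1 / (of_real t - cnj z))) = - (cnj (g (of_real t)) * ?k t)" for t
    by (simp add: algebra_simps)
  have J2: "integrable lborel (\<lambda>t. cnj (g (of_real t)) * ?k t)"
    using integrable_cnj[OF I2(1)] unfolding k2 by simp
  have "cnj (\<integral>t. g (of_real t) * (1 / (of_real t - \<i>) - 1 / (of_real t - cnj z)) \<partial>lborel)
      = (\<integral>t. - (cnj (g (of_real t)) * ?k t) \<partial>lborel)"
    unfolding k2[symmetric] by (rule Bochner_Integration.integral_cnj[symmetric])
  then have J2': "(\<integral>t. cnj (g (of_real t)) * ?k t \<partial>lborel) = 2 * of_real pi * \<i> * cnj (g \<i>)"
    by (simp add: I2(2))
  have i1: "cmod (of_real t - \<i>) ^ 2 = 1 + t^2" for t :: real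
    by (simp add: cmod_power2)
  have eq: "Schwarz_kernel z t * of_real (Re (g (of_real t)))
    = \<i> * of_real (Re (g (of_real t) * of_real (Poisson_kernel \<i> t)))
       - (1/2) * (g (of_real t) * ?k t + cnj (g (of_real t)) * ?k t)" for t
  proof -
    have "g (of_real t) + cnj (g (of_real t)) = 2 * of_real (Re (g (of_real t)))"
      by (simp add: complex_add_cnj)
    then have e2: "(1/2) * (g (of_real t) * ?k t + cnj (g (of_real t)) * ?k t) = of_real (Re (g (of_real t))) * ?k t"
      by (simp only: distrib_right[symmetric]) simp
    have e3: "of_real (Re (g (of_real t) * of_real (Poisson_kernel \<i> t))) = of_real (Re (g (of_real t))) * complex_of_real (1 / (1 + t^2))"
      unfolding i1 by simp
    have e4: "(- k + \<i> * p) * G = \<i> * (G * p) - G * k" for k p G :: complex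
      by (simp add: algebra_simps)
    show ?thesis unfolding e2 e3 Schwarz_kernel_eq by (rule e4)
  qed
  have "(\<integral>t. Schwarz_kernel z t * of_real (Re (g (of_real t))) \<partial>lborel)
    = \<i> * of_real (Re (of_real pi * g \<i>)) - (1/2) * (2 * of_real pi * \<i> * g z + 2 * of_real pi * \<i> * cnj (g \<i>))"
  proof -
    have R: "integrable lborel (\<lambda>t. of_real (Re (g (of_real t) * of_real (Poisson_kernel \<i> t))) :: complex)"
      by (intro integrable_of_real integrable_Re I3(1))
    have R': "(\<integral>t. of_real (Re (g (of_real t) * of_real (Poisson_kernel \<i> t))) \<partial>lborel) = complex_of_real (Re (of_real pi * g \<i>))"
      using integral_bounded_linear[OF bounded_linear_Re I3(1)]
      by (simp only: Bochner_Integration.integral_complex_of_real I3(2))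
    show ?thesis
      unfolding eq using I1 J2 J2' R R'
      by (intro has_bochner_integral_integral_eq has_bochner_integral_diff has_bochner_integral_add
          has_bochner_integral_mult_right) (auto simp only: has_bochner_integral_iff)
  qed
  also have "\<dots> = - (of_real pi * \<i> * (g z - \<i> * of_real (Im (g \<i>))))"
    by (simp add: complex_eq_iff field_simps)
  finally show ?thesis .
qed

section \<open>Almost everywhere differentiability of Lipschitz functions on the line\<close>

lemma emeasure_interval_measure_Ioo:
  assumes ab: "a \<le> b" and mono: "\<And>x y. x \<le> y \<Longrightarrow> F x \<le> F y" and cont: "continuous_on UNIV F"
  shows "emeasure (interval_measure F) {a<..<b} = ennreal (F b - F a)"
proof (cases "a = b")
  case False
  have "emeasure (interval_measure F) {a<..b} = emeasure (interval_measure F) ({a<..<b} \<union> {b})"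
    using ab False by (intro arg_cong[of _ _ "emeasure _"]) auto
  also have "\<dots> = emeasure (interval_measure F) {a<..<b} + emeasure (interval_measure F) {b..b}"
    by (subst plus_emeasure) auto
  also have "emeasure (interval_measure F) {b..b} = 0"
    by (subst emeasure_interval_measure_Icc[OF order_refl mono cont]) simp_all
  finally have "emeasure (interval_measure F) {a<..<b} = emeasure (interval_measure F) {a<..b}" by simp
  also have "\<dots> = F b - F a"
    using cont by (intro emeasure_interval_measure_Ioc ab mono)
      (auto simp: continuous_on_eq_continuous_within intro: continuous_within_subset)
  finally show ?thesis .
qed simp

text \<open>By the Lipschitz condition x - F x is monotone too. The Stieltjes measures of F and of x
  - F add up to the length of every interval, hence to Lebesgue measure.\<close>

lemma interval_measure_le_lborel:
  fixes F :: "real \<Rightarrow> real"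
  assumes mono: "\<And>x y. x \<le> y \<Longrightarrow> F x \<le> F y" and lip: "\<And>x y. x \<le> y \<Longrightarrow> F y - F x \<le> y - x"
    and cont: "continuous_on UNIV F" and A: "A \<in> sets borel"
  shows "emeasure (interval_measure F) A \<le> emeasure lborel A"
proof -
  let ?G = "\<lambda>x. x - F x"
  let ?m = "\<lambda>A. emeasure (interval_measure F) A + emeasure (interval_measure ?G) A"
  define N where "N = measure_of UNIV (sets borel) ?m"
  have sN: "sets N = sets borel"
    using sets.sigma_sets_eq[of "borel :: real measure"] by (simp add: N_def)
  have em: "emeasure N A = ?m A" if "A \<in> sets borel" for A
  proof (rule emeasure_measure_of[OF N_def])
    show "positive (sets N) ?m" by (simp add: positive_def)
    show "countably_additive (sets N) ?m"
    proof (rule countably_additiveI)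
      fix X :: "nat \<Rightarrow> real set" assume X: "range X \<subseteq> sets N" "disjoint_family X"
      have "(\<Sum>i. ?m (X i)) = (\<Sum>i. emeasure (interval_measure F) (X i)) + (\<Sum>i. emeasure (interval_measure ?G) (X i))"
        by (intro suminf_add[symmetric]) auto
      also have "\<dots> = ?m (\<Union>i. X i)"
        using X by (subst (1 2) suminf_emeasure) (auto simp: sN)
      finally show "(\<Sum>i. ?m (X i)) = ?m (\<Union>i. X i)" .
    qed
  qed (use that in \<open>auto simp: sN\<close>)
  have "lborel = N"
  proof (rule lborel_eqI)
    fix l u :: real assume "\<And>b. b \<in> Basis \<Longrightarrow> l \<bullet> b \<le> u \<bullet> b"
    then have lu: "l \<le> u" by simp
    have "emeasure N (box l u) = ennreal (F u - F l) + ennreal (?G u - ?G l)"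
      using lip lu
      by (simp add: em box_real emeasure_interval_measure_Ioo mono cont continuous_on_diff algebra_simps)
    also have "\<dots> = ennreal (u - l)"
      using mono[OF lu] lip[OF lu] by (subst ennreal_plus[symmetric]) auto
    finally show "emeasure N (box l u) = ennreal (\<Prod>b\<in>Basis. (u - l) \<bullet> b)" by simp
  qed (rule sN)
  then have "emeasure lborel A = ?m A" using em[OF A] by simp
  then show ?thesis by simp
qed

text \<open>Domination by Lebesgue measure gives absolute continuity, and the Radon-Nikodym density
  is the integrand sought.\<close>

lemma monotone_Lipschitz_has_density:
  fixes F :: "real \<Rightarrow> real"
  assumes mono: "\<And>x y. x \<le> y \<Longrightarrow> F x \<le> F y" and lip: "\<And>x y. x \<le> y \<Longrightarrow> F y - F x \<le> y - x"
  obtains f :: "real \<Rightarrow> real" where "\<And>a b. f integrable_on {a..b}"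
    "\<And>a b. a \<le> b \<Longrightarrow> integral {a..b} f = F b - F a"
proof -
  have absF: "\<bar>F x - F y\<bar> \<le> \<bar>x - y\<bar>" for x y
    using mono[of x y] mono[of y x] lip[of x y] lip[of y x] by (cases "x \<le> y") auto
  have cont: "continuous_on UNIV F"
    unfolding continuous_on_iff dist_real_def using absF by (meson UNIV_I le_less_trans)
  have "absolutely_continuous lborel (interval_measure F)"
    unfolding absolutely_continuous_def
  proof
    fix A assume A: "A \<in> null_sets (lborel :: real measure)"
    then have "emeasure (interval_measure F) A \<le> 0"
      using interval_measure_le_lborel[OF mono lip cont, of A] by (auto simp: null_sets_def)
    then show "A \<in> null_sets (interval_measure F)" using A by (auto simp: null_sets_def)
  qed
  then obtain g where g: "g \<in> borel_measurable lborel" "density lborel g = interval_measure F"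
    using sigma_finite_measure.Radon_Nikodym[OF sigma_finite_lborel, of "interval_measure F"] by auto
  define f where "f x = enn2real (g x)" for x
  have fm: "f \<in> borel_measurable borel" using g by (simp add: f_def[abs_def])
  have f0: "0 \<le> f x" for x by (simp add: f_def)
  have ifm: "(\<lambda>x. indicator {a..b} x *\<^sub>R f x) \<in> borel_measurable lborel" for a b
    using fm by measurable
  have nn: "(\<integral>\<^sup>+x. ennreal (indicator {a..b} x *\<^sub>R f x) \<partial>lborel) = ennreal (F b - F a)" if "a \<le> b" for a b
  proof -
    have I: "(\<integral>\<^sup>+x. g x * indicator {a..b} x \<partial>lborel) = ennreal (F b - F a)"
    proof -
      have "emeasure (density lborel g) {a..b} = ennreal (F b - F a)"
        unfolding g(2) by (rule emeasure_interval_measure_Icc[OF that mono cont])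
      then show ?thesis using g(1) by (simp add: emeasure_density)
    qed
    \<comment> \<open>The density may take the value infinity, which \<open>enn2real\<close> sends
      to 0; finite integrals over intervals confine this to a null set.\<close>
    have "AE x in lborel. g x * indicator {a..b} x \<noteq> \<infinity>"
      using g I by (intro nn_integral_PInf_AE) auto
    then have "AE x in lborel. ennreal (indicator {a..b} x *\<^sub>R f x) = g x * indicator {a..b} x"
      by eventually_elim (auto simp: f_def indicator_def less_top)
    then have "(\<integral>\<^sup>+x. ennreal (indicator {a..b} x *\<^sub>R f x) \<partial>lborel) = (\<integral>\<^sup>+x. g x * indicator {a..b} x \<partial>lborel)"
      by (rule nn_integral_cong_AE)
    then show ?thesis by (simp add: I)
  qed
  have si: "set_integrable lborel {a..b} f \<and> (LINT x:{a..b}|lborel. f x) = F b - F a" if "a \<le> b" for a b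
  proof -
    have "integrable lborel (\<lambda>x. indicator {a..b} x *\<^sub>R f x)"
      using nn[OF that] ifm f0 by (intro integrableI_nonneg) auto
    moreover have "(\<integral>x. indicator {a..b} x *\<^sub>R f x \<partial>lborel) = F b - F a"
      using nn[OF that] ifm f0 mono[OF that] by (subst integral_eq_nn_integral) auto
    ultimately show ?thesis by (simp add: set_integrable_def set_lebesgue_integral_def)
  qed
  show ?thesis
  proof (rule that)
    show "f integrable_on {a..b}" for a b
      using si[of a b] set_borel_integral_eq_integral(1)[of "{a..b}" f] by (cases "a \<le> b") auto
    show "integral {a..b} f = F b - F a" if "a \<le> b" for a b
      using si[OF that] set_borel_integral_eq_integral(2)[of "{a..b}" f] by auto
  qed
qed

text \<open>The differentiation theorem used here averages over intervals with left endpoint x and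
  so gives right derivatives of the integral; applied to f (- x) it gives the left ones.\<close>

lemma monotone_Lipschitz_differentiable_AE:
  fixes F :: "real \<Rightarrow> real"
  assumes mono: "\<And>x y. x \<le> y \<Longrightarrow> F x \<le> F y" and lip: "\<And>x y. x \<le> y \<Longrightarrow> F y - F x \<le> y - x"
  obtains N where "negligible N" "\<And>x. x \<notin> N \<Longrightarrow> \<exists>d. (F has_real_derivative d) (at x)"
proof -
  obtain f where f: "\<And>a b. f integrable_on {a..b}" "\<And>a b. a \<le> b \<Longrightarrow> integral {a..b} f = F b - F a"
    using monotone_Lipschitz_has_density[OF mono lip] by metis
  have refl: "(\<lambda>x. f (- x)) integrable_on {a..b} \<and> integral {a..b} (\<lambda>x. f (- x)) = integral {- b..- a} f" for a b
  proof -
    have "(f has_integral integral {- b..- a} f) {- b..- a}" using f(1) by (rule integrable_integral)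
    then have "((\<lambda>x. f (- x)) has_integral integral {- b..- a} f) {a..b}"
      using has_integral_reflect_real[of f "integral {- b..- a} f" "- a" "- b"] by simp
    then show ?thesis by (auto simp: has_integral_iff)
  qed
  obtain N1 where N1: "negligible N1" "\<And>x e. x \<notin> N1 \<Longrightarrow> 0 < e \<Longrightarrow>
      \<exists>d>0. \<forall>h. 0 < h \<and> h < d \<longrightarrow> norm (integral (cbox x (x + h *\<^sub>R One)) f /\<^sub>R h ^ DIM(real) - f x) < e"
    using integrable_ccontinuous_explicit[of f] f(1) by auto
  obtain N2 where N2: "negligible N2" "\<And>x e. x \<notin> N2 \<Longrightarrow> 0 < e \<Longrightarrow>
      \<exists>d>0. \<forall>h. 0 < h \<and> h < d \<longrightarrow> norm (integral (cbox x (x + h *\<^sub>R One)) (\<lambda>x. f (- x)) /\<^sub>R h ^ DIM(real) - f (- x)) < e"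
    using integrable_ccontinuous_explicit[of "\<lambda>x. f (- x)"] refl by auto
  have "negligible (N1 \<union> uminus ` N2)"
    using N1(1) N2(1)
    by (intro negligible_Un negligible_differentiable_image_negligible linear_imp_differentiable_on)
       (auto simp: linear_uminus)
  moreover have "\<exists>d. (F has_real_derivative d) (at x)" if x: "x \<notin> N1 \<union> uminus ` N2" for x
  proof (intro exI)
    have mx: "- x \<notin> N2" using x by force
    show "(F has_real_derivative f x) (at x)"
      unfolding has_field_derivative_iff LIM_def
    proof (intro allI impI)
      fix e :: real assume e: "0 < e"
      obtain d1 where d1: "d1 > 0" "\<And>h. 0 < h \<Longrightarrow> h < d1 \<Longrightarrow> \<bar>integral {x..x + h} f / h - f x\<bar> < e"
        using N1(2)[of x e] x e by (auto simp: divide_inverse_commute)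
      obtain d2 where d2: "d2 > 0" "\<And>h. 0 < h \<Longrightarrow> h < d2 \<Longrightarrow> \<bar>integral {- x..- x + h} (\<lambda>x. f (- x)) / h - f x\<bar> < e"
        using N2(2)[OF mx e] by (auto simp: divide_inverse_commute)
      show "\<exists>s>0. \<forall>y. y \<noteq> x \<and> dist y x < s \<longrightarrow> dist ((F y - F x) / (y - x)) (f x) < e"
      proof (intro exI[of _ "min d1 d2"] conjI allI impI)
        fix y assume "y \<noteq> x \<and> dist y x < min d1 d2"
        then have y: "y \<noteq> x \<and> norm (y - x) < min d1 d2" by (simp add: dist_norm)
        show "dist ((F y - F x) / (y - x)) (f x) < e"
        proof (cases "x < y")
          case True
          then show ?thesis using y d1(2)[of "y - x"] f(2)[of x y] by (simp add: dist_norm)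
        next
          case False
          then have "y < x" using y by simp
          then have "integral {- x..- x + (x - y)} (\<lambda>x. f (- x)) = F x - F y"
            using refl[of "- x" "- y"] f(2)[of y x] by simp
          moreover have "(F y - F x) / (y - x) = (F x - F y) / (x - y)"
            by (metis minus_diff_eq minus_divide_divide)
          ultimately show ?thesis using y d2(2)[of "x - y"] \<open>y < x\<close> by (simp add: dist_norm)
        qed
      qed (use d1 d2 in auto)
    qed
  qed
  ultimately show ?thesis using that by blast
qed

text \<open>F / M has slopes in [-1, 1]; adding x and halving brings them into [0, 1], the monotone
  case.\<close>

lemma Lipschitz_differentiable_AE:
  fixes F :: "real \<Rightarrow> real"
  assumes M: "M > 0" and lip: "\<And>x y. \<bar>F x - F y\<bar> \<le> M * \<bar>x - y\<bar>"
  obtains N where "negligible N" "\<And>x. x \<notin> N \<Longrightarrow> \<exists>d. (F has_real_derivative d) (at x)"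
proof -
  define G where "G x = (F x / M + x) / 2" for x
  have "\<bar>F y / M - F x / M\<bar> \<le> y - x" if "x \<le> y" for x y
    using lip[of y x] M that by (simp add: field_simps flip: diff_divide_distrib)
  then have "F y / M - F x / M \<le> y - x" "F x / M - F y / M \<le> y - x" if "x \<le> y" for x y
    using that by (fastforce simp: abs_le_iff)+
  moreover have "(q + x) / 2 \<le> (p + y) / 2 \<and> (p + y) / 2 - (q + x) / 2 \<le> y - x"
    if "p - q \<le> y - x" "q - p \<le> y - x" for p q x y :: real
    using that by (simp_all add: field_simps)
  ultimately have "G x \<le> G y" "G y - G x \<le> y - x" if "x \<le> y" for x y
    using that by (auto simp only: G_def)
  then obtain N where N: "negligible N" "\<And>x. x \<notin> N \<Longrightarrow> \<exists>d. (G has_real_derivative d) (at x)"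
    using monotone_Lipschitz_differentiable_AE[of G] by metis
  have "\<exists>d. (F has_real_derivative d) (at x)" if xN: "x \<notin> N" for x
  proof -
    obtain d where "(G has_real_derivative d) (at x)" using N(2)[OF xN] by blast
    then have "((\<lambda>x. M * (2 * G x - x)) has_real_derivative M * (2 * d - 1)) (at x)"
      by (auto intro!: derivative_eq_intros)
    moreover have "(\<lambda>x. M * (2 * G x - x)) = F" using M by (auto simp: G_def fun_eq_iff field_simps)
    ultimately show ?thesis by auto
  qed
  then show ?thesis using that N(1) by blast
qed

section \<open>Integrals over horizontal lines\<close>

text \<open>The Poisson formula above the line Im z = y, evaluated at height Y over it, bounds the
  integral of q against Y / (x^2 + Y^2) by pi |F| = O(1 / Y). After multiplication by Y the kernel
  tends to 1 as Y grows, and Fatou's lemma removes it.\<close>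

lemma half_plane_Hardy_bound:
  fixes q :: "complex \<Rightarrow> real"
  assumes hol: "F holomorphic_on {z. 0 < Im z}"
    and bd: "\<And>z. 0 < Im z \<Longrightarrow> cmod (F z) \<le> C1 / Im z + C2 / (Im z)^2" and C: "0 \<le> C1" "0 \<le> C2"
    and q: "\<And>z. 0 < Im z \<Longrightarrow> 0 \<le> q z \<and> q z \<le> Im (F z)"
    and meas: "(\<lambda>x. q (Complex x y)) \<in> borel_measurable lborel" and y: "0 < y"
  shows "(\<integral>\<^sup>+x. ennreal (q (Complex x y)) \<partial>lborel) \<le> ennreal (pi * (C1 + C2))"
proof -
  \<comment> \<open>On the shifted half-plane F is bounded and continuous up to the boundary,
    although it may blow up at the real line.\<close>
  define g where "g z = F (z + \<i> * of_real y)" for z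
  have contF: "continuous_on {z. 0 < Im z} F" by (rule holomorphic_on_imp_continuous_on[OF hol])
  have contg: "continuous_on {z. 0 \<le> Im z} g"
    unfolding g_def using y by (intro continuous_intros continuous_on_compose2[OF contF]) auto
  have holg: "g holomorphic_on {z. 0 < Im z}"
    unfolding g_def using y
    by (intro holomorphic_on_compose_gen[of "\<lambda>z. z + \<i> * of_real y" _ F, unfolded o_def, OF _ hol] holomorphic_intros) auto
  have bdg: "cmod (g z) \<le> C1 / y + C2 / y^2" if "0 \<le> Im z" for z
  proof -
    have "cmod (g z) \<le> C1 / (Im z + y) + C2 / (Im z + y)^2"
      using bd[of "z + \<i> * of_real y"] that y by (simp add: g_def)
    also have "\<dots> \<le> C1 / y + C2 / y^2"
      using that y C by (intro add_mono divide_left_mono power_mono mult_pos_pos zero_less_power) auto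
    finally show ?thesis .
  qed
  have le: "(\<integral>\<^sup>+x. ennreal (q (Complex x y) * (Y^2 / (x^2 + Y^2))) \<partial>lborel) \<le> ennreal (pi * (C1 + C2))"
    if Y: "1 \<le> Y" for Y :: real
  proof -
    have ImY: "0 < Im (\<i> * of_real Y)" using Y by simp
    have ker: "Poisson_kernel (\<i> * of_real Y) x = Y / (x^2 + Y^2)" for x
      by (simp add: cmod_power2)
    have int: "integrable lborel (\<lambda>x. Im (g (of_real x)) * (Y / (x^2 + Y^2)))"
      unfolding ker[symmetric] by (rule half_plane_Poisson_linear[OF bounded_linear_Im contg holg bdg ImY])
    have val: "(\<integral>x. Im (g (of_real x)) * (Y / (x^2 + Y^2)) \<partial>lborel) = pi * Im (g (\<i> * of_real Y))"
      unfolding ker[symmetric] by (rule half_plane_Poisson_linear[OF bounded_linear_Im contg holg bdg ImY])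
    have ge: "g (of_real x) = F (Complex x y)" for x
      by (simp add: g_def Complex_eq)
    have "(\<integral>\<^sup>+x. ennreal (q (Complex x y) * (Y^2 / (x^2 + Y^2))) \<partial>lborel)
        \<le> (\<integral>\<^sup>+x. ennreal (Y * (Im (g (of_real x)) * (Y / (x^2 + Y^2)))) \<partial>lborel)"
    proof (intro nn_integral_mono ennreal_leI)
      fix x
      have "q (Complex x y) * (Y^2 / (x^2 + Y^2)) \<le> Im (F (Complex x y)) * (Y^2 / (x^2 + Y^2))"
        using q[of "Complex x y"] y by (intro mult_right_mono) auto
      then show "q (Complex x y) * (Y^2 / (x^2 + Y^2)) \<le> Y * (Im (g (of_real x)) * (Y / (x^2 + Y^2)))"
        by (simp add: ge power2_eq_square mult_ac)
    qed
    also have "\<dots> = ennreal (\<integral>x. Y * (Im (g (of_real x)) * (Y / (x^2 + Y^2))) \<partial>lborel)"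
    proof (intro nn_integral_eq_integral integrable_mult_right int AE_I2 mult_nonneg_nonneg)
      show "0 \<le> Im (g (of_real x))" for x
        using q[of "Complex x y"] y by (simp add: ge)
    qed (use Y in auto)
    also have "(\<integral>x. Y * (Im (g (of_real x)) * (Y / (x^2 + Y^2))) \<partial>lborel) = Y * (pi * Im (g (\<i> * of_real Y)))"
      by (simp only: integral_mult_right_zero val)
    also have "ennreal \<dots> \<le> ennreal (pi * (C1 + C2))"
    proof (rule ennreal_leI)
      have "Im (g (\<i> * of_real Y)) \<le> cmod (g (\<i> * of_real Y))" using abs_Im_le_cmod by (metis abs_le_D1)
      also have "\<dots> \<le> C1 / (Y + y) + C2 / (Y + y)^2"
        using bd[of "\<i> * of_real Y + \<i> * of_real y"] Y y by (simp add: g_def)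
      also have "\<dots> \<le> C1 / Y + C2 / Y"
      \<comment> \<open>Here Y \<ge> 1 matters: it replaces the square by Y itself, so that the
        final constant is independent of y and Y.\<close>
      proof (intro add_mono divide_left_mono C)
        have "Y * 1 \<le> (Y + y) * (Y + y)" using Y y by (intro mult_mono) auto
        then show "Y \<le> (Y + y)^2" by (simp add: power2_eq_square)
      qed (use Y y in auto)
      finally have "Y * Im (g (\<i> * of_real Y)) \<le> Y * (C1 / Y + C2 / Y)"
        using Y by (intro mult_left_mono) auto
      also have "\<dots> = C1 + C2" using Y by (simp add: field_simps)
      finally show "Y * (pi * Im (g (\<i> * of_real Y))) \<le> pi * (C1 + C2)"
        using pi_gt_zero by (simp only: mult.left_commute[of Y]) (intro mult_left_mono, auto)
    qed
    finally show ?thesis .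
  qed
  have "(\<integral>\<^sup>+x. ennreal (q (Complex x y)) \<partial>lborel)
      = (\<integral>\<^sup>+x. liminf (\<lambda>n. ennreal (q (Complex x y) * ((real (Suc n))^2 / (x^2 + (real (Suc n))^2)))) \<partial>lborel)"
  proof (intro nn_integral_cong)
    fix x
    have "(\<lambda>n. (real (Suc n))^2 / (x^2 + (real (Suc n))^2)) \<longlonglongrightarrow> 1" by real_asymp
    then have "(\<lambda>n. q (Complex x y) * ((real (Suc n))^2 / (x^2 + (real (Suc n))^2))) \<longlonglongrightarrow> q (Complex x y) * 1"
      by (intro tendsto_mult tendsto_const)
    then have "(\<lambda>n. ennreal (q (Complex x y) * ((real (Suc n))^2 / (x^2 + (real (Suc n))^2)))) \<longlonglongrightarrow> ennreal (q (Complex x y))"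
      by (intro tendsto_ennrealI) simp
    then show "ennreal (q (Complex x y)) = liminf (\<lambda>n. ennreal (q (Complex x y) * ((real (Suc n))^2 / (x^2 + (real (Suc n))^2))))"
      using lim_imp_Liminf[OF sequentially_bot] by metis
  qed
  also have "\<dots> \<le> liminf (\<lambda>n. \<integral>\<^sup>+x. ennreal (q (Complex x y) * ((real (Suc n))^2 / (x^2 + (real (Suc n))^2))) \<partial>lborel)"
  proof (intro nn_integral_liminf)
    have "(\<lambda>x. q (Complex x y)) \<in> borel_measurable borel" using meas by simp
    then have "(\<lambda>x. ennreal (q (Complex x y) * ((real (Suc n))^2 / (x^2 + (real (Suc n))^2)))) \<in> borel_measurable borel" for n
      by measurable
    then show "(\<lambda>x. ennreal (q (Complex x y) * ((real (Suc n))^2 / (x^2 + (real (Suc n))^2)))) \<in> borel_measurable lborel" for n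
      by simp
  qed
  also have "\<dots> \<le> liminf (\<lambda>n::nat. ennreal (pi * (C1 + C2)))"
    using le by (intro Liminf_mono always_eventually allI) auto
  also have "\<dots> = ennreal (pi * (C1 + C2))" by (simp add: Liminf_const)
  finally show ?thesis .
qed

section \<open>Non-tangential boundary values\<close>

text \<open>Carries a smallness of \<Psi> near x0 on the real line into the half-plane. The quotient
  of \<Psi> by a linear function with zero below the line is analytic, at most \<eta> near x0 and at
  most L elsewhere; Poisson averaging at w sees the far part only with weight of order |w - x0| /
  \<rho>.\<close>

lemma half_plane_difference_quotient_bound:
  fixes \<Psi> :: "complex \<Rightarrow> complex" and x0 :: real
  assumes hol: "\<Psi> holomorphic_on {z. 0 < Im z}" and cont: "continuous_on {z. 0 \<le> Im z} \<Psi>"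
    and L: "\<And>z. 0 \<le> Im z \<Longrightarrow> cmod (\<Psi> z) \<le> L * cmod (z - of_real x0)" and L0: "0 \<le> L"
    and \<eta>: "\<And>t. \<bar>t - x0\<bar> < \<rho> \<Longrightarrow> cmod (\<Psi> (of_real t)) \<le> \<eta> * \<bar>t - x0\<bar>" and \<eta>0: "0 \<le> \<eta>" and \<rho>: "0 < \<rho>"
    and w: "0 < Im w"
  shows "cmod (\<Psi> w) \<le> 2 * cmod (w - of_real x0) * (\<eta> + 2 * L * cmod (w - of_real x0) / \<rho>)"
proof -
  define r where "r = cmod (w - of_real x0)"
  have r: "r > 0" using w by (auto simp: r_def complex_eq_iff)
  define g where "g z = \<Psi> z / (z - of_real x0 + \<i> * of_real r)" for z
  \<comment> \<open>Its real part is non-negative on the line and at least 1/2 where |t - x0| \<ge>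
    \<rho>, so 2 Re k majorizes the indicator of the far part. Being the real part of a bounded
    analytic function, its Poisson integral is known exactly.\<close>
  define k where "k z = (z - of_real x0) / (z - of_real x0 + \<i> * of_real \<rho>)" for z
  have far: "cmod (z - of_real x0) \<le> cmod (z - of_real x0 + \<i> * of_real s)" "z - of_real x0 + \<i> * of_real s \<noteq> 0"
    if "0 \<le> Im z" "0 < s" for z s
  proof -
    have "(cmod (z - of_real x0))^2 \<le> (cmod (z - of_real x0 + \<i> * of_real s))^2"
      using that by (simp add: cmod_power2 power_mono)
    then show "cmod (z - of_real x0) \<le> cmod (z - of_real x0 + \<i> * of_real s)" by (rule power2_le_imp_le) simp
    show "z - of_real x0 + \<i> * of_real s \<noteq> 0" using that by (auto simp: complex_eq_iff)
  qed
  have g: "continuous_on {z. 0 \<le> Im z} g" "g holomorphic_on {z. 0 < Im z}"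
    unfolding g_def using far(2) r by (intro continuous_intros holomorphic_intros cont hol; force)+
  have k: "continuous_on {z. 0 \<le> Im z} k" "k holomorphic_on {z. 0 < Im z}"
    unfolding k_def using far(2) \<rho> by (intro continuous_intros holomorphic_intros; force)+
  have gb: "cmod (g z) \<le> L" if "0 \<le> Im z" for z
  proof -
    have "cmod (\<Psi> z) \<le> L * cmod (z - of_real x0 + \<i> * of_real r)"
      using L[OF that] mult_left_mono[OF far(1)[OF that r] L0] by linarith
    then show ?thesis using far(2)[OF that r] by (simp add: g_def norm_divide divide_le_eq)
  qed
  have kb: "cmod (k z) \<le> 1" if "0 \<le> Im z" for z
    using far[OF that \<rho>] by (simp add: k_def norm_divide divide_le_eq)
  have kr: "Re (k (of_real t)) = (t - x0)^2 / ((t - x0)^2 + \<rho>^2)" for t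
  proof -
    have "k (of_real t) = of_real (t - x0) / Complex (t - x0) \<rho>"
      by (simp add: k_def Complex_eq)
    then show ?thesis by (simp add: Re_divide power2_eq_square)
  qed
  let ?P = "Poisson_kernel w"
  have P0: "0 \<le> ?P t" for t using w by simp
  have ig: "integrable lborel (\<lambda>t. g (of_real t) * of_real (?P t))"
    and Ig: "(\<integral>t. g (of_real t) * of_real (?P t) \<partial>lborel) = of_real pi * g w"
    using half_plane_Poisson[OF g gb w] by blast+
  have ik: "integrable lborel (\<lambda>t. Re (k (of_real t)) * ?P t)"
    and Ik: "(\<integral>t. Re (k (of_real t)) * ?P t \<partial>lborel) = pi * Re (k w)"
    using half_plane_Poisson_linear[OF bounded_linear_Re k kb w] by blast+
  have i1: "integrable lborel ?P" and I1: "(\<integral>t. ?P t \<partial>lborel) = pi"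
    using half_plane_Poisson_linear[OF bounded_linear_Re, of "\<lambda>_. 1" 1 w] w by simp_all
  have bnd: "cmod (g (of_real t)) \<le> \<eta> + 2 * L * Re (k (of_real t))" for t
  proof (cases "\<bar>t - x0\<bar> < \<rho>")
    case True
    have "cmod (\<Psi> (of_real t)) \<le> \<eta> * \<bar>t - x0\<bar>" by (rule \<eta>[OF True])
    also have "\<dots> = \<eta> * cmod (of_real t - of_real x0)" by (simp flip: of_real_diff)
    also have "\<dots> \<le> \<eta> * cmod (of_real t - of_real x0 + \<i> * of_real r)"
      by (intro mult_left_mono far(1) \<eta>0 r) simp
    finally have "cmod (g (of_real t)) \<le> \<eta>"
      using far(2)[of "of_real t" r] r by (simp add: g_def norm_divide divide_le_eq)
    moreover have "0 \<le> L * Re (k (of_real t))" unfolding kr using L0 by simp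
    ultimately show ?thesis by simp
  next
    case False
    then have "\<rho>^2 \<le> (t - x0)^2" using \<rho> by (metis abs_of_pos not_le power2_abs power_mono less_imp_le)
    then have "1 \<le> 2 * Re (k (of_real t))"
      unfolding kr using \<rho> by (simp add: le_divide_eq add_nonneg_pos)
    from mult_left_mono[OF this L0] show ?thesis using gb[of "of_real t"] \<eta>0 by simp
  qed
  have "pi * cmod (g w) = cmod (\<integral>t. g (of_real t) * of_real (?P t) \<partial>lborel)"
    unfolding Ig by (simp add: norm_mult)
  also have "\<dots> \<le> (\<integral>t. cmod (g (of_real t) * of_real (?P t)) \<partial>lborel)"
    by (rule integral_norm_bound)
  also have "\<dots> \<le> (\<integral>t. \<eta> * ?P t + 2 * L * (Re (k (of_real t)) * ?P t) \<partial>lborel)"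
  proof (rule integral_mono)
    show "integrable lborel (\<lambda>t. cmod (g (of_real t) * of_real (?P t)))"
      by (rule integrable_norm[OF ig])
    show "integrable lborel (\<lambda>t. \<eta> * ?P t + 2 * L * (Re (k (of_real t)) * ?P t))"
      by (intro Bochner_Integration.integrable_add integrable_mult_right i1 ik)
    fix t
    have "cmod (g (of_real t) * of_real (?P t)) = cmod (g (of_real t)) * ?P t"
      using P0[of t] by (simp only: norm_mult norm_of_real abs_of_nonneg)
    also have "\<dots> \<le> (\<eta> + 2 * L * Re (k (of_real t))) * ?P t"
      by (rule mult_right_mono[OF bnd P0])
    finally show "cmod (g (of_real t) * of_real (?P t)) \<le> \<eta> * ?P t + 2 * L * (Re (k (of_real t)) * ?P t)"
      by (simp only: distrib_right mult.assoc)
  qed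
  also have "\<dots> = \<eta> * (\<integral>t. ?P t \<partial>lborel) + 2 * L * (\<integral>t. Re (k (of_real t)) * ?P t \<partial>lborel)"
    using i1 ik
    by (subst Bochner_Integration.integral_add; (intro integrable_mult_right)?) (simp_all only: integral_mult_right_zero)
  also have "\<dots> = \<eta> * pi + 2 * L * (pi * Re (k w))" by (simp only: Ik I1)
  finally have "pi * cmod (g w) \<le> pi * (\<eta> + 2 * L * Re (k w))" by (simp add: algebra_simps)
  then have gw: "cmod (g w) \<le> \<eta> + 2 * L * Re (k w)" by simp
  have "Re (k w) \<le> cmod (k w)" by (rule complex_Re_le_cmod)
  also have "cmod (k w) \<le> r / \<rho>"
  proof -
    have "\<rho> \<le> cmod (w - of_real x0 + \<i> * of_real \<rho>)"
      using abs_Im_le_cmod[of "w - of_real x0 + \<i> * of_real \<rho>"] w \<rho> by simp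
    then show ?thesis unfolding k_def norm_divide r_def[symmetric] using \<rho> r by (intro frac_le) auto
  qed
  finally have "2 * L * Re (k w) \<le> 2 * L * (r / \<rho>)" using L0 by (intro mult_left_mono) auto
  with gw have gw: "cmod (g w) \<le> \<eta> + 2 * L * r / \<rho>" by simp
  have "cmod (\<Psi> w) = cmod (g w) * cmod (w - of_real x0 + \<i> * of_real r)"
    using far(2)[of w r] w r by (simp add: g_def norm_divide)
  also have "\<dots> \<le> (\<eta> + 2 * L * r / \<rho>) * (2 * r)"
  proof (rule mult_mono[OF gw])
    show "cmod (w - of_real x0 + \<i> * of_real r) \<le> 2 * r"
      using norm_triangle_ineq[of "w - of_real x0" "\<i> * of_real r"] r by (simp add: r_def norm_mult)
    show "0 \<le> \<eta> + 2 * L * r / \<rho>" using \<eta>0 L0 r \<rho> by simp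
  qed simp
  finally show ?thesis by (simp add: r_def mult_ac)
qed

abbreviation nontangential_cone :: "real \<Rightarrow> real \<Rightarrow> complex set" where
  "nontangential_cone a t \<equiv> {z. Im z > 0 \<and> \<bar>Re z - t\<bar> < a * Im z}"

text \<open>After subtraction of the linear approximation at x0 the remainder \<Psi> is o(|t - x0|)
  on the line, hence o(|z - x0|) in the half-plane. Cauchy's estimate on a disc of radius Im w / 2
  makes its derivative f - l small, because in a cone |w - x0| is at most (1 + a) Im w.\<close>

lemma Lipschitz_boundary_derivative_imp_nontangential_limit:
  fixes \<Phi> f :: "complex \<Rightarrow> complex" and x0 :: real
  assumes deriv: "\<And>z. 0 < Im z \<Longrightarrow> (\<Phi> has_field_derivative f z) (at z)"
    and lip: "\<And>z w. 0 \<le> Im z \<Longrightarrow> 0 \<le> Im w \<Longrightarrow> cmod (\<Phi> z - \<Phi> w) \<le> M * cmod (z - w)" and M: "0 \<le> M"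
    and l: "((\<lambda>t. \<Phi> (of_real t)) has_vector_derivative l) (at x0)" and a: "0 < a"
  shows "(f \<longlongrightarrow> l) (at (of_real x0) within nontangential_cone a x0)"
  unfolding tendsto_iff eventually_at
proof (intro allI impI)
  fix e :: real assume e: "0 < e"
  define \<Psi> where "\<Psi> z = \<Phi> z - \<Phi> (of_real x0) - l * (z - of_real x0)" for z
  define L where "L = M + cmod l + 1"
  have L: "0 < L" using M by (simp add: L_def add_nonneg_pos)
  \<comment> \<open>The final estimate is 8 (1 + a) (\<eta> + \<eta>), which this choice makes e /
    2.\<close>
  define \<eta> where "\<eta> = e / (32 * (1 + a))"
  have \<eta>: "0 < \<eta>" using e a by (simp add: \<eta>_def)
  have d\<Psi>: "(\<Psi> has_field_derivative (f z - l)) (at z)" if "0 < Im z" for z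
    unfolding \<Psi>_def using deriv[OF that] by (auto intro!: derivative_eq_intros)
  then have hol: "\<Psi> holomorphic_on {z. 0 < Im z}"
    by (auto simp: holomorphic_on_def field_differentiable_def intro: has_field_derivative_at_within)
  have "M-lipschitz_on {z. 0 \<le> Im z} \<Phi>"
    using lip M by (intro lipschitz_onI) (auto simp: dist_norm)
  then have cont: "continuous_on {z. 0 \<le> Im z} \<Psi>"
    unfolding \<Psi>_def by (intro continuous_intros lipschitz_on_continuous_on)
  have \<Psi>L: "cmod (\<Psi> z) \<le> L * cmod (z - of_real x0)" if "0 \<le> Im z" for z
  proof -
    have "cmod (\<Psi> z) \<le> cmod (\<Phi> z - \<Phi> (of_real x0)) + cmod (l * (z - of_real x0))"
      unfolding \<Psi>_def by (rule norm_triangle_ineq4)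
    also have "\<dots> \<le> M * cmod (z - of_real x0) + cmod l * cmod (z - of_real x0)"
      using lip[of z "of_real x0"] that by (simp add: norm_mult)
    also have "\<dots> \<le> L * cmod (z - of_real x0)" by (simp add: L_def algebra_simps)
    finally show ?thesis .
  qed
  obtain \<rho> where \<rho>: "\<rho> > 0" "\<And>t. \<bar>t - x0\<bar> < \<rho> \<Longrightarrow> cmod (\<Psi> (of_real t)) \<le> \<eta> * \<bar>t - x0\<bar>"
  proof -
    have "\<exists>d>0. \<forall>y. norm (y - x0) < d \<longrightarrow> norm (\<Phi> (of_real y) - \<Phi> (of_real x0) - (y - x0) *\<^sub>R l) \<le> \<eta> * norm (y - x0)"
      using l \<eta> unfolding has_vector_derivative_def has_derivative_at_alt by blast
    then show ?thesis
      using that by (auto simp: \<Psi>_def scaleR_conv_of_real mult.commute)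
  qed
  \<comment> \<open>Chosen so that the contribution 4 L r / \<rho> of the far part is at most
    \<eta>.\<close>
  define \<delta> where "\<delta> = \<eta> * \<rho> / (4 * L)"
  have \<delta>: "0 < \<delta>" using \<eta> \<rho> L by (simp add: \<delta>_def)
  show "\<exists>d>0. \<forall>z\<in>nontangential_cone a x0. z \<noteq> of_real x0 \<and> dist z (of_real x0) < d \<longrightarrow> dist (f z) l < e"
  proof (intro exI[of _ \<delta>] conjI ballI impI \<delta>)
    fix w assume w: "w \<in> nontangential_cone a x0" and wd: "w \<noteq> of_real x0 \<and> dist w (of_real x0) < \<delta>"
    define r where "r = cmod (w - of_real x0)"
    define y where "y = Im w"
    have y: "0 < y" using w by (simp add: y_def)
    have r\<delta>: "r < \<delta>" using wd by (simp add: r_def dist_norm)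
    have ry: "r \<le> (1 + a) * y"
    proof -
      have "r \<le> \<bar>Re (w - of_real x0)\<bar> + \<bar>Im (w - of_real x0)\<bar>" unfolding r_def by (rule cmod_le)
      also have "\<dots> \<le> a * y + y" using w by (simp add: y_def)
      finally show ?thesis by (simp add: algebra_simps)
    qed
    have yr: "y \<le> r" using abs_Im_le_cmod[of "w - of_real x0"] y by (simp add: r_def y_def)
    have Im_ball: "0 < Im v" if "v \<in> cball w (y / 2)" for v
    proof -
      have "\<bar>Im (w - v)\<bar> \<le> y / 2" using that abs_Im_le_cmod[of "w - v"] by (simp add: dist_norm)
      from abs_le_D1[OF this] have "y - Im v \<le> y / 2" by (simp add: y_def)
      then show ?thesis using y by simp
    qed
    \<comment> \<open>The bound of the previous lemma at points of the circle, which are at distance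
      at most 2 r from x0.\<close>
    define B where "B = 4 * r * (\<eta> + 4 * L * r / \<rho>)"
    have "norm ((deriv ^^ 1) \<Psi> w) \<le> fact 1 * B / (y / 2) ^ 1"
    proof (rule Cauchy_inequality)
      show "\<Psi> holomorphic_on ball w (y / 2)"
        using Im_ball by (intro holomorphic_on_subset[OF hol]) (auto simp: subset_iff)
      show "continuous_on (cball w (y / 2)) \<Psi>"
        using Im_ball by (intro continuous_on_subset[OF cont]) (auto intro: less_imp_le)
      show "0 < y / 2" using y by simp
      fix v assume v: "norm (w - v) = y / 2"
      then have "v \<in> cball w (y / 2)" by (simp add: dist_norm)
      then have iv: "0 < Im v" by (rule Im_ball)
      have rv: "cmod (v - of_real x0) \<le> 2 * r"
        using norm_triangle_ineq[of "v - w" "w - of_real x0"] v yr y by (simp add: r_def norm_minus_commute)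
      have "cmod (\<Psi> v) \<le> 2 * cmod (v - of_real x0) * (\<eta> + 2 * L * cmod (v - of_real x0) / \<rho>)"
        by (rule half_plane_difference_quotient_bound[OF hol cont \<Psi>L _ \<rho>(2) _ \<rho>(1) iv]) (use L \<eta> in auto)
      also have "\<dots> \<le> 2 * (2 * r) * (\<eta> + 2 * L * (2 * r) / \<rho>)"
        using rv yr y L \<eta> \<rho>(1) by (intro mult_mono add_left_mono divide_right_mono mult_left_mono add_nonneg_nonneg) auto
      finally show "norm (\<Psi> v) \<le> B" by (simp add: B_def mult_ac)
    qed
    moreover have "deriv \<Psi> w = f w - l" using d\<Psi> y by (intro DERIV_imp_deriv) (simp add: y_def)
    ultimately have "cmod (f w - l) \<le> 8 * (r / y) * (\<eta> + 4 * L * r / \<rho>)"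
      by (simp add: B_def field_simps)
    also have "\<dots> \<le> 8 * (1 + a) * (\<eta> + \<eta>)"
    proof (intro mult_mono add_left_mono)
      show "r / y \<le> 1 + a" using ry y by (simp add: divide_le_eq)
      have "4 * L * r \<le> 4 * L * \<delta>" using r\<delta> L by simp
      also have "\<dots> = \<eta> * \<rho>" using L by (simp add: \<delta>_def)
      finally show "4 * L * r / \<rho> \<le> \<eta>" using \<rho>(1) by (simp add: divide_le_eq)
      show "0 \<le> \<eta> + 4 * L * r / \<rho>" using \<eta> L \<rho>(1) by (simp add: r_def)
    qed (use a y yr in auto)
    also have "\<dots> = 16 * (\<eta> * (1 + a))" by (simp add: algebra_simps)
    also have "\<eta> * (1 + a) = e / 32" using a by (simp add: \<eta>_def field_simps)
    also have "16 * (e / 32) < e" using e by simp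
    finally show "dist (f w) l < e" by (simp add: dist_norm)
  qed
qed

theorem Fatou_nontangential_limits:
  assumes hol: "f holomorphic_on {z. 0 < Im z}" and bdd: "\<And>z. 0 < Im z \<Longrightarrow> cmod (f z) \<le> M"
  obtains N where "negligible N"
    "\<And>t. t \<notin> N \<Longrightarrow> \<exists>l. \<forall>a>0. (f \<longlongrightarrow> l) (at (of_real t) within nontangential_cone a t)"
proof -
  let ?H = "{z. 0 < Im z}"
  have oH: "open ?H" by (rule open_halfspace_Im_gt)
  have cH: "convex ?H" by (rule convex_halfspace_Im_gt)
  have M: "0 \<le> M" using order_trans[OF norm_ge_zero bdd[of \<i>]] by simp
  obtain \<phi> where \<phi>: "\<And>z. z \<in> ?H \<Longrightarrow> (\<phi> has_field_derivative f z) (at z within ?H)"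
    using holomorphic_convex_primitive'[OF cH oH hol] by metis
  have "M-lipschitz_on ?H \<phi>"
  proof (rule lipschitz_onI[OF _ M])
    fix z w assume "z \<in> ?H" "w \<in> ?H"
    then show "dist (\<phi> z) (\<phi> w) \<le> M * dist z w"
      using field_differentiable_bound[OF cH \<phi>, of M z w] bdd by (simp add: dist_norm)
  qed
  from lipschitz_extend_closure[OF this] obtain \<Phi>
    where \<Phi>: "M-lipschitz_on (closure ?H) \<Phi>" "\<And>z. z \<in> ?H \<Longrightarrow> \<Phi> z = \<phi> z" by auto
  have clH: "closure ?H = {z. 0 \<le> Im z}"
    using closure_halfspace_gt[of \<i> 0] by (simp add: inner_complex_def)
  have lip: "cmod (\<Phi> z - \<Phi> w) \<le> M * cmod (z - w)" if "0 \<le> Im z" "0 \<le> Im w" for z w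
    using lipschitz_onD[OF \<Phi>(1), of z w] that by (simp add: clH dist_norm)
  have d\<Phi>: "(\<Phi> has_field_derivative f z) (at z)" if "0 < Im z" for z
  proof -
    have zH: "z \<in> ?H" using that by simp
    have "(\<phi> has_field_derivative f z) (at z)" using \<phi>[OF zH] by (simp only: at_within_open[OF zH oH])
    from has_field_derivative_transform_within_open[OF this oH zH \<Phi>(2)[symmetric]]
    show ?thesis .
  qed
  \<comment> \<open>M may be 0, while the differentiability lemma asks for a positive Lipschitz
    constant; hence M + 1.\<close>
  have lr: "cmod (\<Phi> (of_real s) - \<Phi> (of_real t)) \<le> (M + 1) * \<bar>s - t\<bar>" for s t
  proof -
    have "cmod (\<Phi> (of_real s) - \<Phi> (of_real t)) \<le> M * \<bar>s - t\<bar>"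
      using lip[of "of_real s" "of_real t"] by (simp flip: of_real_diff)
    also have "\<dots> \<le> (M + 1) * \<bar>s - t\<bar>" by (intro mult_right_mono) auto
    finally show ?thesis .
  qed
  have M1: "M + 1 > 0" using M by simp
  have "\<bar>Re (\<Phi> (of_real s)) - Re (\<Phi> (of_real t))\<bar> \<le> (M + 1) * \<bar>s - t\<bar>" for s t
    using order_trans[OF abs_Re_le_cmod lr[of s t]] by simp
  then obtain N1 where N1: "negligible N1" "\<And>t. t \<notin> N1 \<Longrightarrow> \<exists>d. ((\<lambda>t. Re (\<Phi> (of_real t))) has_real_derivative d) (at t)"
    by (rule Lipschitz_differentiable_AE[OF M1, of "\<lambda>t. Re (\<Phi> (of_real t))"]) (rule that)
  have "\<bar>Im (\<Phi> (of_real s)) - Im (\<Phi> (of_real t))\<bar> \<le> (M + 1) * \<bar>s - t\<bar>" for s t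
    using order_trans[OF abs_Im_le_cmod lr[of s t]] by simp
  then obtain N2 where N2: "negligible N2" "\<And>t. t \<notin> N2 \<Longrightarrow> \<exists>d. ((\<lambda>t. Im (\<Phi> (of_real t))) has_real_derivative d) (at t)"
    by (rule Lipschitz_differentiable_AE[OF M1, of "\<lambda>t. Im (\<Phi> (of_real t))"]) (rule that)
  show ?thesis
  proof (rule that)
    show "negligible (N1 \<union> N2)" using N1 N2 by (intro negligible_Un)
    fix t assume "t \<notin> N1 \<union> N2"
    then obtain d1 d2 where d: "((\<lambda>t. Re (\<Phi> (of_real t))) has_real_derivative d1) (at t)"
      "((\<lambda>t. Im (\<Phi> (of_real t))) has_real_derivative d2) (at t)"
      using N1(2) N2(2) by blast
    have "((\<lambda>t. \<Phi> (of_real t)) has_vector_derivative Complex d1 d2) (at t)"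
      unfolding has_vector_derivative_complex_iff using d by simp
    then show "\<exists>l. \<forall>a>0. (f \<longlongrightarrow> l) (at (of_real t) within nontangential_cone a t)"
      using Lipschitz_boundary_derivative_imp_nontangential_limit[OF d\<Phi> lip M] by blast
  qed
qed

section \<open>Outer functions with positive real part\<close>

text \<open>One vertical sequence lies in every cone. It makes the cone limit unique and exhibits
  boundary values as limits of continuous functions, hence as Borel functions.\<close>

lemma filterlim_vertical_cone:
  assumes "0 < a"
  shows "filterlim (\<lambda>n. complex_of_real t + \<i> * of_real (1 / Suc n)) (at (of_real t) within nontangential_cone a t) sequentially"
  unfolding filterlim_at
proof
  have "(\<lambda>n. complex_of_real t + \<i> * of_real (1 / Suc n)) \<longlonglongrightarrow> of_real t + \<i> * of_real 0"
    by (intro tendsto_intros LIMSEQ_Suc[OF lim_1_over_n])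
  then show "(\<lambda>n. complex_of_real t + \<i> * of_real (1 / Suc n)) \<longlonglongrightarrow> of_real t" by simp
  show "\<forall>\<^sub>F n in sequentially. complex_of_real t + \<i> * of_real (1 / Suc n) \<in> nontangential_cone a t \<and>
      complex_of_real t + \<i> * of_real (1 / Suc n) \<noteq> of_real t"
    using assms by (intro always_eventually allI) (simp add: complex_eq_iff)
qed

lemma boundary_value_eqI:
  assumes "\<And>a. 0 < a \<Longrightarrow> (f \<longlongrightarrow> l) (at (of_real t) within nontangential_cone a t)"
  shows "boundary_value f t = l"
  unfolding boundary_value_def
proof (rule the_equality)
  show "\<forall>a>0. (f \<longlongrightarrow> l) (at (of_real t) within nontangential_cone a t)" using assms by blast
next
  fix l' assume "\<forall>a>0. (f \<longlongrightarrow> l') (at (of_real t) within nontangential_cone a t)"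
  then have l': "(f \<longlongrightarrow> l') (at (of_real t) within nontangential_cone 1 t)"
    using zero_less_one by blast
  have l: "(f \<longlongrightarrow> l) (at (of_real t) within nontangential_cone 1 t)" by (rule assms) simp
  have v: "filterlim (\<lambda>n. complex_of_real t + \<i> * of_real (1 / Suc n)) (at (of_real t) within nontangential_cone 1 t) sequentially"
    by (rule filterlim_vertical_cone) simp
  show "l' = l"
    by (rule LIMSEQ_unique[OF filterlim_compose[OF l' v] filterlim_compose[OF l v]])
qed

lemma AE_lborel_negligible:
  assumes "negligible N" and "\<And>x. x \<notin> N \<Longrightarrow> P x"
  shows "AE x in lborel. P x"
proof -
  have "N \<in> null_sets lebesgue" using assms(1) by (simp add: negligible_iff_null_sets)
  then obtain N' where "N' \<in> null_sets lborel" "N \<subseteq> N'"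
    by (auto simp: null_sets_completion_iff2)
  then show ?thesis using assms(2) by (intro AE_I'[of N']) auto
qed

text \<open>Completeness of Lebesgue measure absorbs an arbitrary change on a null set; it is
  applied to \<open>boundary_value\<close>, whose values are uncontrolled where no limit
  exists.\<close>

lemma borel_measurable_lebesgue_cong:
  fixes f g :: "real \<Rightarrow> 'a::{second_countable_topology, metric_space}"
  assumes N: "negligible N" and eq: "\<And>x. x \<notin> N \<Longrightarrow> f x = g x" and g: "g \<in> borel_measurable lebesgue"
  shows "f \<in> borel_measurable lebesgue"
proof (rule measurableI)
  fix A :: "'a set" assume A: "A \<in> sets borel"
  have "g -` A \<in> sets lebesgue" using measurable_sets[OF g A] by simp
  moreover have sub: "negligible (f -` A \<inter> N)" by (rule negligible_subset[OF N]) auto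
  ultimately have "(g -` A - N) \<union> (f -` A \<inter> N) \<in> sets lebesgue"
    using negligible_imp_sets[OF N] negligible_imp_sets[OF sub] by auto
  also have "(g -` A - N) \<union> (f -` A \<inter> N) = f -` A" using eq by auto
  finally show "f -` A \<inter> space lebesgue \<in> sets lebesgue" by simp
qed simp

lemma Schwarz_kernel_bound:
  assumes z: "0 < Im z"
  obtains K where "K > 0" "\<And>t. cmod (Schwarz_kernel z t) \<le> K * (1 / (1 + t^2))"
proof -
  obtain K where K: "K > 0" "\<And>t::real. cmod (1 / (of_real t - z) - 1 / (of_real t - (-\<i>))) \<le> K * (1 / (1 + t^2))"
    using kernel_difference_bound[of z "-\<i>"] z by auto
  let ?k = "Schwarz_kernel z"
  have kb: "cmod (?k t) \<le> (K + 1) * (1 / (1 + t^2))" for t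
  proof -
    have "cmod (?k t) = cmod (- (1 / (of_real t - z) - 1 / (of_real t - (-\<i>))) + \<i> * of_real (1 / (1 + t^2)))"
      by (simp only: Schwarz_kernel_eq)
    also have "\<dots> \<le> K * (1 / (1 + t^2)) + 1 / (1 + t^2)"
      by (rule norm_triangle_le, rule add_mono) (use K(2)[of t] in \<open>simp_all add: norm_minus_commute norm_mult norm_divide del: of_real_add\<close>)
    finally show ?thesis by (simp only: distrib_right mult_1)
  qed
  moreover have "K + 1 > 0" using K by simp
  ultimately show ?thesis using that by blast
qed

text \<open>The functions G (z + i / (n + 1)) are continuous up to the line and share the bound C,
  so dominated convergence transfers the formulas to the boundary function r. The Poisson formula at
  i is included to control logarithmic integrals later.\<close>

lemma half_plane_Schwarz_boundary:
  fixes r :: "real \<Rightarrow> real"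
  assumes hol: "G holomorphic_on {z. 0 < Im z}" and bdd: "\<And>z. 0 < Im z \<Longrightarrow> cmod (G z) \<le> C"
    and r: "r \<in> borel_measurable lborel"
    and lim: "AE t in lborel. (\<lambda>n. Re (G (of_real t + \<i> * of_real (1 / Suc n)))) \<longlonglongrightarrow> r t"
  shows "0 < Im z \<Longrightarrow>
      (\<integral>t. Schwarz_kernel z t * of_real (r t) \<partial>lborel)
       = - (of_real pi * \<i> * (G z - \<i> * of_real (Im (G \<i>))))"
    and "integrable lborel (\<lambda>t. r t * (1 / (1 + t^2)))"
    and "(\<integral>t. r t * (1 / (1 + t^2)) \<partial>lborel) = pi * Re (G \<i>)"
proof -
  define g where "g n z = G (z + \<i> * of_real (1 / Suc n))" for n :: nat and z
  have contG: "continuous_on {z. 0 < Im z} G" by (rule holomorphic_on_imp_continuous_on[OF hol])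
  have up: "0 < Im (z + \<i> * of_real (1 / Suc n))" if "0 \<le> Im z" for z and n :: nat
    using that by (simp add: add_nonneg_pos)
  have cg: "continuous_on {z. 0 \<le> Im z} (g n)" for n
    unfolding g_def using up by (intro continuous_intros continuous_on_compose2[OF contG]) auto
  have hg: "g n holomorphic_on {z. 0 < Im z}" for n
    unfolding g_def using up
    by (intro holomorphic_on_compose_gen[of "\<lambda>z. z + \<i> * of_real (1 / Suc n)" _ G, unfolded o_def, OF _ hol] holomorphic_intros)
       (auto intro: less_imp_le)
  have bg: "cmod (g n z) \<le> C" if "0 \<le> Im z" for n z
    unfolding g_def by (rule bdd[OF up[OF that]])
  have glim: "(\<lambda>n. g n z) \<longlonglongrightarrow> G z" if z: "0 < Im z" for z
  proof -
    have "isCont G z"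
      using contG z by (simp add: continuous_on_eq_continuous_at open_halfspace_Im_gt)
    moreover have "(\<lambda>n. z + \<i> * of_real (1 / Suc n)) \<longlonglongrightarrow> z + \<i> * of_real 0"
      by (intro tendsto_intros LIMSEQ_Suc[OF lim_1_over_n])
    ultimately show ?thesis unfolding g_def by (intro isCont_tendsto_compose[of z G]) auto
  qed
  have cgr: "continuous_on UNIV (\<lambda>t. g n (of_real t))" for n
    by (intro continuous_on_compose2[OF cg] continuous_intros) auto
  then have mg: "(\<lambda>t. Re (g n (of_real t))) \<in> borel_measurable lborel" for n
    by (simp add: borel_measurable_continuous_onI continuous_on_Re)
  have glim': "AE t in lborel. (\<lambda>n. Re (g n (of_real t))) \<longlonglongrightarrow> r t"
    using lim unfolding g_def .
  have C0: "0 \<le> C" using order_trans[OF norm_ge_zero bdd[of \<i>]] by simp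
  have reg: "\<bar>Re (g n (of_real t))\<bar> \<le> C" for n t
    by (rule order_trans[OF abs_Re_le_cmod bg]) simp
  show "(\<integral>t. Schwarz_kernel z t * of_real (r t) \<partial>lborel)
       = - (of_real pi * \<i> * (G z - \<i> * of_real (Im (G \<i>))))" if z: "0 < Im z" for z
  proof -
    let ?k = "Schwarz_kernel z"
    obtain K where K: "K > 0" and kb: "\<And>t. cmod (?k t) \<le> K * (1 / (1 + t^2))"
      using Schwarz_kernel_bound[OF z] by blast
    let ?R = "\<lambda>n. - (of_real pi * \<i> * (g n z - \<i> * of_real (Im (g n \<i>))))"
    have mk: "?k \<in> borel_measurable borel" by measurable
    have "(\<lambda>n. \<integral>t. ?k t * of_real (Re (g n (of_real t))) \<partial>lborel) \<longlonglongrightarrow> (\<integral>t. ?k t * of_real (r t) \<partial>lborel)"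
    proof (rule integral_dominated_convergence[where w="\<lambda>t. C * (K * (1 / (1 + t^2)))"])
      show "integrable lborel (\<lambda>t. C * (K * (1 / (1 + t^2))))"
        by (intro integrable_mult_right integrable_inverse_1_plus_square_lborel)
      show "AE t in lborel. (\<lambda>n. ?k t * of_real (Re (g n (of_real t)))) \<longlonglongrightarrow> ?k t * of_real (r t)"
        using glim' by eventually_elim (intro tendsto_intros)
      show "AE t in lborel. cmod (?k t * of_real (Re (g n (of_real t)))) \<le> C * (K * (1 / (1 + t^2)))" for n
      proof (rule AE_I2)
        fix t
        have "cmod (?k t * of_real (Re (g n (of_real t)))) = cmod (?k t) * \<bar>Re (g n (of_real t))\<bar>"
          by (simp only: norm_mult norm_of_real)
        also have "\<dots> \<le> (K * (1 / (1 + t^2))) * C"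
          using K by (intro mult_mono kb reg) auto
        finally show "cmod (?k t * of_real (Re (g n (of_real t)))) \<le> C * (K * (1 / (1 + t^2)))"
          by (simp only: mult.commute)
      qed
    qed (use mk mg r in \<open>measurable\<close>)
    moreover have "(\<integral>t. ?k t * of_real (Re (g n (of_real t))) \<partial>lborel) = - (of_real pi * \<i> * (g n z - \<i> * of_real (Im (g n \<i>))))" for n
      by (rule half_plane_Schwarz[OF cg hg bg z])
    ultimately have "?R \<longlonglongrightarrow> (\<integral>t. ?k t * of_real (r t) \<partial>lborel)"
      by simp
    moreover have "?R
        \<longlonglongrightarrow> - (of_real pi * \<i> * (G z - \<i> * of_real (Im (G \<i>))))"
      by (intro tendsto_intros glim z) simp
    ultimately show ?thesis by (rule LIMSEQ_unique)
  qed
  have w: "integrable lborel (\<lambda>t. C * (1 / (1 + t^2)))"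
    by (intro integrable_mult_right integrable_inverse_1_plus_square_lborel)
  have l: "AE t in lborel. (\<lambda>n. Re (g n (of_real t)) * (1 / (1 + t^2))) \<longlonglongrightarrow> r t * (1 / (1 + t^2))"
    using glim' by eventually_elim (intro tendsto_intros)
  have b: "AE t in lborel. norm (Re (g n (of_real t)) * (1 / (1 + t^2))) \<le> C * (1 / (1 + t^2))" for n
    unfolding norm_mult by (intro AE_I2 mult_mono) (use reg C0 in auto)
  have m1: "(\<lambda>t. r t * (1 / (1 + t^2))) \<in> borel_measurable lborel"
    and m2: "(\<lambda>t. Re (g n (of_real t)) * (1 / (1 + t^2))) \<in> borel_measurable lborel" for n
    using r mg by measurable
  note lim2 = integral_dominated_convergence[OF m1 m2 w l b]
  show "integrable lborel (\<lambda>t. r t * (1 / (1 + t^2)))"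
    by (rule integrable_dominated_convergence[OF m1 m2 w l b])
  have "(\<integral>t. Re (g n (of_real t)) * (1 / (1 + t^2)) \<partial>lborel) = pi * Re (g n \<i>)" for n
  proof -
    have i: "0 < Im \<i>" by simp
    have ker: "Poisson_kernel \<i> t = 1 / (1 + t^2)" for t by (simp add: cmod_power2)
    show ?thesis
      unfolding ker[symmetric] by (rule half_plane_Poisson_linear[OF bounded_linear_Re cg hg bg i])
  qed
  then have "(\<lambda>n. pi * Re (g n \<i>)) \<longlonglongrightarrow> (\<integral>t. r t * (1 / (1 + t^2)) \<partial>lborel)"
    using lim2 by simp
  moreover have "(\<lambda>n. pi * Re (g n \<i>)) \<longlonglongrightarrow> pi * Re (G \<i>)"
    by (intro tendsto_intros glim) simp
  ultimately show "(\<integral>t. r t * (1 / (1 + t^2)) \<partial>lborel) = pi * Re (G \<i>)"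
    by (rule LIMSEQ_unique)
qed

text \<open>The limit in the regularized formula needs an integrable majorant, that is,
  integrability of ln |D| against 1 / (1 + t^2) for the boundary function D. This comes from the
  Poisson formula at i: the integrals of ln |D + c k| are bounded below by pi ln |d i|, and Fatou's
  lemma passes to ln |D|.\<close>

theorem outer_plus_if_Re_pos:
  assumes hol: "d holomorphic_on {z. 0 < Im z}" and d1: "\<And>z. 0 < Im z \<Longrightarrow> cmod (d z) \<le> 1"
    and dpos: "\<And>z. 0 < Im z \<Longrightarrow> 0 < Re (d z)"
  shows "outer_plus d"
proof -
  obtain N where N: "negligible N"
    and Nlim: "\<And>t. t \<notin> N \<Longrightarrow> \<exists>l. \<forall>a>0. (d \<longlongrightarrow> l) (at (of_real t) within nontangential_cone a t)"
    using Fatou_nontangential_limits[OF hol d1] by metis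
  let ?v = "\<lambda>t n. complex_of_real t + \<i> * of_real (1 / Suc n)"
  have up: "0 < Im (?v t n)" for t n by simp
  \<comment> \<open>A Borel representative of the boundary function; it agrees with
    \<open>boundary_value\<close> outside N.\<close>
  define D where "D t = lim (\<lambda>n. d (?v t n))" for t
  have D: "(\<lambda>n. d (?v t n)) \<longlonglongrightarrow> D t \<and> boundary_value d t = D t" if t: "t \<notin> N" for t
  proof -
    obtain l where l: "\<And>a. 0 < a \<Longrightarrow> (d \<longlongrightarrow> l) (at (of_real t) within nontangential_cone a t)"
      using Nlim[OF t] by blast
    have "(\<lambda>n. d (?v t n)) \<longlonglongrightarrow> l"
      by (rule filterlim_compose[OF l filterlim_vertical_cone[of 1]]) simp_all
    moreover have "boundary_value d t = l" using boundary_value_eqI[OF l] .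
    ultimately show ?thesis using limI[of "\<lambda>n. d (?v t n)" l] by (simp add: D_def)
  qed
  have contd: "continuous_on {z. 0 < Im z} d" by (rule holomorphic_on_imp_continuous_on[OF hol])
  have Dm: "D \<in> borel_measurable borel"
  proof -
    have "continuous_on UNIV (\<lambda>t. d (?v t n))" for n
      using up by (intro continuous_on_compose2[OF contd] continuous_intros) auto
    then have "(\<lambda>t. d (?v t n)) \<in> borel_measurable borel" for n
      by (rule borel_measurable_continuous_onI)
    then show ?thesis unfolding D_def[abs_def] by (rule borel_measurable_lim_metric)
  qed
  have ReD: "0 \<le> Re (D t)" and normD: "cmod (D t) \<le> 1" if t: "t \<notin> N" for t
  proof -
    have l: "(\<lambda>n. d (?v t n)) \<longlonglongrightarrow> D t" using D[OF t] by simp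
    show "0 \<le> Re (D t)"
      by (rule LIMSEQ_le_const[OF tendsto_Re[OF l]]) (use dpos[OF up] in \<open>auto intro: less_imp_le\<close>)
    show "cmod (D t) \<le> 1"
      by (rule LIMSEQ_le_const2[OF tendsto_norm[OF l]]) (use d1[OF up] in auto)
  qed
  define L where "L c t = ln (cmod (D t + of_real c))" for c t
  have Lm: "L c \<in> borel_measurable lborel" for c
    unfolding L_def[abs_def] using Dm by measurable
  have reg: "(0 < Im z \<longrightarrow> (\<integral>t. Schwarz_kernel z t * of_real (L c t) \<partial>lborel)
       = - (of_real pi * \<i> * (Ln (d z + of_real c) - \<i> * of_real (Im (Ln (d \<i> + of_real c))))))
     \<and> integrable lborel (\<lambda>t. L c t * (1 / (1 + t^2)))
     \<and> (\<integral>t. L c t * (1 / (1 + t^2)) \<partial>lborel) = pi * Re (Ln (d \<i> + of_real c))"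
    if c: "0 < c" "c \<le> 1" for z and c :: real
  proof -
    define G where "G z = Ln (d z + of_real c)" for z
    \<comment> \<open>Non-negative real part and c > 0 keep d + c, and its boundary values, off the
      cut of \<open>Ln\<close>, so one branch serves the whole half-plane.\<close>
    have nonpos: "w + of_real c \<notin> \<real>\<^sub>\<le>\<^sub>0" "w + of_real c \<noteq> 0" if "0 \<le> Re w" for w
      using that c by (auto simp: complex_nonpos_Reals_iff complex_eq_iff)
    have hG: "G holomorphic_on {z. 0 < Im z}"
      unfolding G_def using nonpos dpos by (intro holomorphic_intros hol) (auto intro: less_imp_le)
    have bG: "cmod (G z) \<le> (ln 2 + \<bar>ln c\<bar>) + pi" if z: "0 < Im z" for z
    proof -
      have ge: "c \<le> cmod (d z + of_real c)"
        using complex_Re_le_cmod[of "d z + of_real c"] dpos[OF z] by simp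
      have le: "cmod (d z + of_real c) \<le> 2"
        using norm_triangle_ineq[of "d z" "of_real c"] d1[OF z] c by simp
      have ne: "d z + of_real c \<noteq> 0" using ge c by auto
      have "cmod (G z) \<le> \<bar>Re (G z)\<bar> + \<bar>Im (G z)\<bar>" by (rule cmod_le)
      also have "\<bar>Re (G z)\<bar> \<le> ln 2 + \<bar>ln c\<bar>"
      proof -
        have "ln c \<le> ln (cmod (d z + of_real c))" "ln (cmod (d z + of_real c)) \<le> ln 2"
          using ge le c by (subst ln_le_cancel_iff; linarith)+
        moreover have "0 \<le> ln (2::real)" by simp
        ultimately show ?thesis unfolding G_def Re_Ln[OF ne] by linarith
      qed
      also have "\<bar>Im (G z)\<bar> \<le> pi"
        unfolding G_def using Im_Ln_le_pi[OF ne] mpi_less_Im_Ln[OF ne] by linarith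
      finally show ?thesis by simp
    qed
    have lim: "AE t in lborel. (\<lambda>n. Re (G (?v t n))) \<longlonglongrightarrow> L c t"
    proof (rule AE_lborel_negligible[OF N])
      fix t assume t: "t \<notin> N"
      have "(\<lambda>n. ln (cmod (d (?v t n) + of_real c))) \<longlonglongrightarrow> ln (cmod (D t + of_real c))"
        using D[OF t] nonpos[OF ReD[OF t]] by (intro tendsto_intros) auto
      moreover have "Re (G (?v t n)) = ln (cmod (d (?v t n) + of_real c))" for n
        unfolding G_def using nonpos(2) dpos[OF up] by (intro Re_Ln) (auto intro: less_imp_le)
      ultimately show "(\<lambda>n. Re (G (?v t n))) \<longlonglongrightarrow> L c t" by (simp add: L_def)
    qed
    show ?thesis
      using half_plane_Schwarz_boundary[OF hG bG Lm lim] unfolding G_def by blast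
  qed
  define c where "c k = 1 / real (Suc k)" for k
  have c: "0 < c k" "c k \<le> 1" for k by (auto simp: c_def)
  have c0: "c \<longlonglongrightarrow> 0" unfolding c_def by (rule LIMSEQ_Suc[OF lim_1_over_n])
  have ge: "cmod (w + of_real (c k)) \<ge> cmod w" "cmod (w + of_real (c k)) \<ge> c k" if "0 \<le> Re w" for w k
  proof -
    have "(cmod w)^2 \<le> (cmod (w + of_real (c k)))^2"
      using that c(1)[of k] by (simp add: cmod_power2 power_mono)
    then show "cmod (w + of_real (c k)) \<ge> cmod w" by (rule power2_le_imp_le) simp
    show "cmod (w + of_real (c k)) \<ge> c k"
      using complex_Re_le_cmod[of "w + of_real (c k)"] that by simp
  qed
  have L2: "L (c k) t \<le> ln 2" if t: "t \<notin> N" for k t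
  proof -
    have "cmod (D t + of_real (c k)) \<le> 2"
      using norm_triangle_ineq[of "D t" "of_real (c k)"] normD[OF t] c[of k] by simp
    moreover have "0 < cmod (D t + of_real (c k))" using ge(2)[OF ReD[OF t], of k] c(1)[of k] by linarith
    ultimately show ?thesis unfolding L_def by (subst ln_le_cancel_iff) auto
  qed
  \<comment> \<open>Subtracting from ln 2 makes this non-negative off N, since |D + c k| \<le> 2, as
    Fatou's lemma requires.\<close>
  define h where "h k t = (ln 2 - L (c k) t) * (1 / (1 + t^2))" for k t
  \<comment> \<open>A common bound for the integrals of all \<open>h k\<close>: by the Poisson
    formula ln |D + c k| integrates to pi ln |d i + c k|, which is at least pi ln |d i|.\<close>
  define B where "B = (\<integral>t. ln 2 * (1 / (1 + t^2)) \<partial>lborel) - pi * ln (cmod (d \<i>))"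
  have w0: "0 < 1 / (1 + t^2)" for t :: real by (simp add: add_pos_nonneg)
  have "h k \<in> borel_measurable lborel" for k
    unfolding h_def[abs_def] using Lm by measurable
  then have hm [measurable]: "h k \<in> borel_measurable borel" for k by simp
  have hint: "(\<integral>\<^sup>+t. ennreal (h k t) \<partial>lborel) \<le> ennreal B" for k
  proof -
    note I = reg[OF c[of k]]
    have hI: "integrable lborel (h k)"
      unfolding h_def[abs_def] left_diff_distrib using I
      by (intro Bochner_Integration.integrable_diff integrable_mult_right integrable_inverse_1_plus_square_lborel) auto
    have "AE t in lborel. 0 \<le> h k t"
      by (rule AE_lborel_negligible[OF N]) (use L2 w0 in \<open>auto simp: h_def intro!: mult_nonneg_nonneg less_imp_le[OF w0]\<close>)
    then have "(\<integral>\<^sup>+t. ennreal (h k t) \<partial>lborel) = ennreal (\<integral>t. h k t \<partial>lborel)"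
      by (rule nn_integral_eq_integral[OF hI])
    also have "(\<integral>t. h k t \<partial>lborel) = (\<integral>t. ln 2 * (1 / (1 + t^2)) \<partial>lborel) - (\<integral>t. L (c k) t * (1 / (1 + t^2)) \<partial>lborel)"
      unfolding h_def left_diff_distrib using I
      by (intro Bochner_Integration.integral_diff integrable_mult_right integrable_inverse_1_plus_square_lborel) auto
    also have "\<dots> \<le> B"
    proof -
      have p: "0 < Re (d \<i>)" using dpos[of \<i>] by simp
      then have ne: "d \<i> + of_real (c k) \<noteq> 0" "d \<i> \<noteq> 0" using c(1)[of k] by (auto simp: complex_eq_iff)
      have "ln (cmod (d \<i>)) \<le> ln (cmod (d \<i> + of_real (c k)))"
        using ge(1)[of "d \<i>" k] p ne by (subst ln_le_cancel_iff) auto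
      then have "pi * ln (cmod (d \<i>)) \<le> pi * Re (Ln (d \<i> + of_real (c k)))"
        unfolding Re_Ln[OF ne(1)] by (intro mult_left_mono) auto
      then show ?thesis using I by (simp add: B_def)
    qed
    finally show ?thesis by (simp add: ennreal_leI)
  qed
  have liminf_le: "(\<integral>\<^sup>+t. liminf (\<lambda>k. ennreal (h k t)) \<partial>lborel) \<le> ennreal B"
  proof -
    have "(\<integral>\<^sup>+t. liminf (\<lambda>k. ennreal (h k t)) \<partial>lborel) \<le> liminf (\<lambda>k. \<integral>\<^sup>+t. ennreal (h k t) \<partial>lborel)"
      by (intro nn_integral_liminf) measurable
    also have "\<dots> \<le> liminf (\<lambda>k::nat. ennreal B)"
      using hint by (intro Liminf_mono always_eventually allI)
    also have "\<dots> = ennreal B" by (simp add: Liminf_const)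
    finally show ?thesis .
  qed
  have "AE t in lborel. liminf (\<lambda>k. ennreal (h k t)) \<noteq> \<infinity>"
  proof (rule nn_integral_PInf_AE)
    show "(\<lambda>t. liminf (\<lambda>k. ennreal (h k t))) \<in> borel_measurable lborel" by measurable
    show "(\<integral>\<^sup>+t. liminf (\<lambda>k. ennreal (h k t)) \<partial>lborel) \<noteq> \<infinity>"
      using liminf_le by (metis ennreal_less_top infinity_ennreal_def leD)
  qed
  moreover have "AE t in lborel. t \<notin> N" by (rule AE_lborel_negligible[OF N])
  \<comment> \<open>At a zero of D the values \<open>h k t\<close> grow like ln (k + 1), against the
    finiteness of their lower limit. So D vanishes only on a null set, and the convention for
    \<open>ln 0\<close> has no effect on the integrals.\<close>
  ultimately have good: "AE t in lborel. t \<notin> N \<and> D t \<noteq> 0"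
  proof eventually_elim
    case (elim t)
    have "D t \<noteq> 0"
    proof
      assume D0: "D t = 0"
      obtain R where R: "liminf (\<lambda>k. ennreal (h k t)) = ennreal R" "0 \<le> R"
        using elim(1) by (cases "liminf (\<lambda>k. ennreal (h k t))") auto
      have "filterlim (\<lambda>k. (ln 2 + ln (real (Suc k))) * (1 / (1 + t^2))) at_top sequentially"
        using w0[of t] by real_asymp
      moreover have "h k t = (ln 2 + ln (real (Suc k))) * (1 / (1 + t^2))" for k
      proof -
        have "L (c k) t = ln (c k)"
          using c(1)[of k] by (simp only: L_def D0 add_0 norm_of_real abs_of_pos)
        also have "\<dots> = - ln (real (Suc k))" by (simp add: c_def ln_div)
        finally show ?thesis by (simp add: h_def)
      qed
      ultimately have "\<forall>\<^sub>F k in sequentially. R + 1 \<le> h k t"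
        by (simp add: filterlim_at_top)
      then have "\<forall>\<^sub>F k in sequentially. ennreal (R + 1) \<le> ennreal (h k t)"
        by eventually_elim (rule ennreal_leI)
      from Liminf_bounded[OF this] have "ennreal (R + 1) \<le> ennreal R" by (simp add: R)
      then show False using R(2) by (simp add: ennreal_le_iff)
    qed
    then show ?case using elim(2) by simp
  qed
  \<comment> \<open>The limit of \<open>h k\<close>, and up to the kernel constant K the dominating
    function below: |D| \<le> |D + c k| \<le> 2 and |D| \<le> 1 give |L (c k) t| \<le> ln 2 - ln |D
    t|.\<close>
  define H where "H t = (ln 2 - ln (cmod (D t))) * (1 / (1 + t^2))" for t
  have Hm: "H \<in> borel_measurable lborel" unfolding H_def[abs_def] using Dm by measurable
  have Llim: "(\<lambda>k. L (c k) t) \<longlonglongrightarrow> ln (cmod (D t))" if "D t \<noteq> 0" for t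
  proof -
    have "(\<lambda>k. ln (cmod (D t + of_real (c k)))) \<longlonglongrightarrow> ln (cmod (D t + of_real 0))"
      using that by (intro tendsto_intros c0) auto
    then show ?thesis by (simp add: L_def)
  qed
  have "(\<integral>\<^sup>+t. ennreal (H t) \<partial>lborel) \<le> ennreal B"
  proof -
    have "AE t in lborel. ennreal (H t) = liminf (\<lambda>k. ennreal (h k t))"
      using good
    proof eventually_elim
      case (elim t)
      then have "(\<lambda>k. h k t) \<longlonglongrightarrow> H t"
        unfolding h_def H_def by (intro tendsto_intros Llim) auto
      then have "(\<lambda>k. ennreal (h k t)) \<longlonglongrightarrow> ennreal (H t)" by (rule tendsto_ennrealI)
      then show ?case using lim_imp_Liminf[OF sequentially_bot] by metis
    qed
    then show ?thesis using liminf_le by (simp add: nn_integral_cong_AE)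
  qed
  then have HI: "integrable lborel H"
  proof -
    assume le: "(\<integral>\<^sup>+t. ennreal (H t) \<partial>lborel) \<le> ennreal B"
    have "AE t in lborel. 0 \<le> H t"
      using good
    proof eventually_elim
      case (elim t)
      then have "ln (cmod (D t)) \<le> ln 1" using normD[of t] by (subst ln_le_cancel_iff) auto
      then have "0 \<le> ln 2 - ln (cmod (D t))" using ln_gt_zero[of "2::real"] by (simp only: ln_one) linarith
      then show ?case unfolding H_def by (intro mult_nonneg_nonneg less_imp_le[OF w0])
    qed
    then show ?thesis
      using Hm le by (intro integrableI_nonneg) (auto intro: le_less_trans)
  qed
  have main: "(\<integral>t. Schwarz_kernel z t * of_real (ln (cmod (D t))) \<partial>lborel)
       = - (of_real pi * \<i> * (Ln (d z) - \<i> * of_real (Im (Ln (d \<i>)))))" if z: "0 < Im z" for z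
  proof -
    let ?k = "Schwarz_kernel z"
    obtain K where K: "K > 0" "\<And>t. cmod (?k t) \<le> K * (1 / (1 + t^2))"
      using Schwarz_kernel_bound[OF z] by blast
    let ?R = "\<lambda>k. - (of_real pi * \<i> * (Ln (d z + of_real (c k)) - \<i> * of_real (Im (Ln (d \<i> + of_real (c k))))))"
    have mk: "?k \<in> borel_measurable borel" by measurable
    have "(\<lambda>k. \<integral>t. ?k t * of_real (L (c k) t) \<partial>lborel) \<longlonglongrightarrow> (\<integral>t. ?k t * of_real (ln (cmod (D t))) \<partial>lborel)"
    proof (rule integral_dominated_convergence[where w="\<lambda>t. K * H t"])
      show "integrable lborel (\<lambda>t. K * H t)" by (intro integrable_mult_right HI)
      show "AE t in lborel. (\<lambda>k. ?k t * of_real (L (c k) t)) \<longlonglongrightarrow> ?k t * of_real (ln (cmod (D t)))"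
        using good by eventually_elim (intro tendsto_intros Llim, simp)
      show "AE t in lborel. cmod (?k t * of_real (L (c k) t)) \<le> K * H t" for k
        using good
      proof eventually_elim
        case (elim t)
        have "ln (cmod (D t)) \<le> L (c k) t"
          unfolding L_def using elim ge(1)[OF ReD[of t], of k] ge(2)[OF ReD[of t], of k] c(1)[of k]
          by (subst ln_le_cancel_iff) auto
        moreover have "L (c k) t \<le> ln 2" using L2 elim by simp
        moreover have "ln (cmod (D t)) \<le> ln 1" using elim normD[of t] by (subst ln_le_cancel_iff) auto
        moreover have "0 \<le> ln (2::real)" by simp
        ultimately have "\<bar>L (c k) t\<bar> \<le> ln 2 - ln (cmod (D t))"
          by (simp only: ln_one abs_le_iff) linarith
        then have "cmod (?k t) * \<bar>L (c k) t\<bar> \<le> (K * (1 / (1 + t^2))) * (ln 2 - ln (cmod (D t)))"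
          using K w0[of t] by (intro mult_mono) auto
        then show ?case unfolding norm_mult norm_of_real H_def by (simp only: mult_ac)
      qed
      show "(\<lambda>t. ?k t * of_real (ln (cmod (D t)))) \<in> borel_measurable lborel"
        using mk Dm by measurable
      show "(\<lambda>t. ?k t * of_real (L (c k) t)) \<in> borel_measurable lborel" for k
        using mk Lm by measurable
    qed
    moreover have "(\<integral>t. ?k t * of_real (L (c k) t) \<partial>lborel)
        = - (of_real pi * \<i> * (Ln (d z + of_real (c k)) - \<i> * of_real (Im (Ln (d \<i> + of_real (c k))))))" for k
      using reg[OF c[of k], of z] z by simp
    ultimately have "?R
        \<longlonglongrightarrow> (\<integral>t. ?k t * of_real (ln (cmod (D t))) \<partial>lborel)"
      by simp
    moreover have Lnlim: "(\<lambda>k. Ln (d v + of_real (c k))) \<longlonglongrightarrow> Ln (d v)" if v: "0 < Im v" for v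
    proof -
      have "(\<lambda>k. Ln (d v + of_real (c k))) \<longlonglongrightarrow> Ln (d v + of_real 0)"
        using dpos[OF v] by (intro tendsto_intros c0) (auto simp: complex_nonpos_Reals_iff)
      then show ?thesis by simp
    qed
    have "?R
        \<longlonglongrightarrow> - (of_real pi * \<i> * (Ln (d z) - \<i> * of_real (Im (Ln (d \<i>)))))"
      by (intro tendsto_intros Lnlim z) simp
    ultimately show ?thesis using LIMSEQ_unique by blast
  qed
  have leb: "(\<integral>t. Schwarz_kernel z t * of_real (ln (cmod (boundary_value d t))) \<partial>lebesgue)
      = (\<integral>t. Schwarz_kernel z t * of_real (ln (cmod (D t))) \<partial>lborel)" for z :: complex
  proof -
    let ?f = "\<lambda>u t. Schwarz_kernel z t * complex_of_real (ln (cmod (u t)))"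
    have mD: "?f D \<in> borel_measurable lborel" using Dm by measurable
    then have mD': "?f D \<in> borel_measurable lebesgue" by (rule measurable_completion)
    have eq: "?f (boundary_value d) t = ?f D t" if "t \<notin> N" for t using D[OF that] by simp
    have mb: "?f (boundary_value d) \<in> borel_measurable lebesgue"
      by (rule borel_measurable_lebesgue_cong[OF N eq mD'])
    have "AE t in lebesgue. ?f (boundary_value d) t = ?f D t"
      using AE_lborel_negligible[OF N eq] by (rule AE_completion)
    then have "integral\<^sup>L lebesgue (?f (boundary_value d)) = integral\<^sup>L lebesgue (?f D)"
      by (rule integral_cong_AE[OF mb mD'])
    also have "\<dots> = integral\<^sup>L lborel (?f D)" by (rule integral_completion[OF mD])
    finally show ?thesis .
  qed
  show ?thesis
    unfolding outer_plus_def
  proof (intro conjI)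
    show "d holomorphic_on upper_half_plane" by (rule hol)
    show "bounded (d ` upper_half_plane)" using d1 by (auto simp: bounded_iff)
    show "\<exists>z\<in>upper_half_plane. d z \<noteq> 0"
      using dpos[of \<i>] by (intro bexI[of _ \<i>]) auto
    show "\<exists>c. \<forall>z\<in>upper_half_plane. d z = exp (\<i> * complex_of_real c) *
          exp (\<i> / complex_of_real pi *
            (\<integral>t. (1 / (z - complex_of_real t) + complex_of_real (t / (1 + t^2))) *
                complex_of_real (ln (cmod (boundary_value d t))) \<partial>lebesgue))"
    \<comment> \<open>The Schwarz integral recovers Ln d up to an imaginary constant, which the
      kernel normalizes at i.\<close>
    proof (intro exI[of _ "Im (Ln (d \<i>))"] ballI)
      fix z :: complex assume "z \<in> upper_half_plane"
      then have z: "0 < Im z" by simp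
      have ne: "d z \<noteq> 0" using dpos[OF z] by auto
      have "\<i> / of_real pi * (- (of_real pi * \<i> * (Ln (d z) - \<i> * of_real (Im (Ln (d \<i>))))))
          = Ln (d z) - \<i> * of_real (Im (Ln (d \<i>)))"
        by (simp add: field_simps complex_eq_iff)
      then show "d z = exp (\<i> * complex_of_real (Im (Ln (d \<i>)))) *
          exp (\<i> / complex_of_real pi *
            (\<integral>t. (1 / (z - complex_of_real t) + complex_of_real (t / (1 + t^2))) *
                complex_of_real (ln (cmod (boundary_value d t))) \<partial>lebesgue))"
        unfolding leb main[OF z] using ne by (simp add: exp_add[symmetric] exp_Ln)
    qed
  qed
qed

section \<open>The Hardy-class factorization\<close>

text \<open>For self-adjoint S this is the trace of S R(z) S in the basis B, with one S moved to the
  second argument.\<close>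

definition resolvent_trace :: "(complex \<Rightarrow> 'a::complex_hilbert \<Rightarrow> 'a) \<Rightarrow> ('a \<Rightarrow> 'a) \<Rightarrow> 'a set \<Rightarrow> complex \<Rightarrow> complex" where
  "resolvent_trace R S B z = (\<Sum>\<^sub>\<infinity>e\<in>B. cinner (R z (S e)) (S e))"

locale Hilbert_Schmidt_resolvent = selfadjoint_resolvent R
  for R :: "complex \<Rightarrow> 'a::complex_hilbert \<Rightarrow> 'a" +
  fixes S :: "'a \<Rightarrow> 'a" and B :: "'a set"
  assumes S: "bounded_selfadjoint S" and B: "orthonormal_basis B"
    and HS: "(\<lambda>e. (norm (S e))^2) summable_on B"
begin

lemma S_op: "bounded_op S" and S_sym: "cinner (S x) y = cinner x (S y)"
  using S by (auto simp: bounded_selfadjoint_def)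

lemma R_diff_conj:
  assumes z: "0 < Im z"
  shows "R z u - R (cnj z) u = (2 * \<i> * of_real (Im z)) *\<^sub>C R (cnj z) (R z u)"
proof -
  have "R (cnj z) u - R z u = (cnj z - z) *\<^sub>C R (cnj z) (R z u)"
    using z by (intro R_identity) auto
  then have "R z u - R (cnj z) u = - ((cnj z - z) *\<^sub>C R (cnj z) (R z u))"
    by (simp add: algebra_simps)
  also have "\<dots> = (- (cnj z - z)) *\<^sub>C R (cnj z) (R z u)" by (simp only: scaleC_minus_left)
  also have "- (cnj z - z) = 2 * \<i> * of_real (Im z)" by (simp add: complex_eq_iff)
  finally show ?thesis .
qed

text \<open>The source of both positivity and smallness: v = u gives the imaginary part of <R z u,
  u>, and v = S e gives the coefficients of S R(z) u - S R(cnj z) u.\<close>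

lemma cinner_R_diff:
  assumes z: "0 < Im z"
  shows "cinner (R z u - R (cnj z) u) v = 2 * \<i> * of_real (Im z) * cinner (R z u) (R z v)"
  using R_adjoint[of "cnj z" "R z u" v] z by (simp add: R_diff_conj cinner_scaleC_left)

lemma Im_cinner_R:
  assumes z: "0 < Im z"
  shows "Im (cinner (R z u) u) = Im z * (norm (R z u))^2"
proof -
  have "cinner (R (cnj z) u) u = cnj (cinner (R z u) u)"
    using R_adjoint[of "cnj z" u u] z cinner_commute[of u "R z u"] by simp
  then have "cinner (R z u) u - cnj (cinner (R z u) u) = 2 * \<i> * of_real (Im z) * of_real ((norm (R z u))^2)"
    using cinner_R_diff[OF z, of u u] by (simp only: cinner_diff_left cinner_self)
  then have "Im (cinner (R z u) u - cnj (cinner (R z u) u)) = Im (2 * \<i> * of_real (Im z) * of_real ((norm (R z u))^2))"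
    by (rule arg_cong)
  then show ?thesis by simp
qed

lemma cmod_cinner_R_le:
  assumes z: "0 < Im z"
  shows "cmod (cinner (R z u) v) \<le> norm u * norm v / Im z"
proof -
  have "cmod (cinner (R z u) v) \<le> norm (R z u) * norm v" by (rule cinner_Cauchy_Schwarz)
  also have "\<dots> \<le> norm u / Im z * norm v"
    using R_bound[of z u] z by (intro mult_right_mono) auto
  finally show ?thesis by simp
qed

abbreviation \<phi> :: "complex \<Rightarrow> complex" where "\<phi> \<equiv> resolvent_trace R S B"
abbreviation \<tau> :: real where "\<tau> \<equiv> (\<Sum>\<^sub>\<infinity>e\<in>B. (norm (S e))^2)"

lemma trace_sum_bound:
  assumes T: "\<And>e. e \<in> B \<Longrightarrow> cmod (T e) \<le> K * (norm (S e))^2"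
  shows "T summable_on B" "cmod (\<Sum>\<^sub>\<infinity>e\<in>B. T e) \<le> K * \<tau>"
proof -
  have K: "(\<lambda>e. K * (norm (S e))^2) summable_on B" by (rule summable_on_cmult_right[OF HS])
  have abs: "(\<lambda>e. cmod (T e)) summable_on B"
    by (rule Infinite_Sum.abs_summable_on_comparison_test'[OF K T])
  then show "T summable_on B" by (rule abs_summable_summable)
  have "cmod (\<Sum>\<^sub>\<infinity>e\<in>B. T e) \<le> (\<Sum>\<^sub>\<infinity>e\<in>B. cmod (T e))" by (rule norm_infsum_bound[OF abs])
  also have "\<dots> \<le> (\<Sum>\<^sub>\<infinity>e\<in>B. K * (norm (S e))^2)" by (rule infsum_mono[OF abs K T])
  also have "\<dots> = K * \<tau>" by (rule infsum_cmult_right) (rule HS)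
  finally show "cmod (\<Sum>\<^sub>\<infinity>e\<in>B. T e) \<le> K * \<tau>" .
qed

lemma trace_summable:
  assumes z: "0 < Im z"
  shows "(\<lambda>e. cinner (R z (S e)) (S e)) summable_on B"
  by (rule trace_sum_bound[where K="1 / Im z"])
     (use cmod_cinner_R_le[OF z] in \<open>simp add: power2_eq_square\<close>)

lemma Im_trace:
  assumes z: "0 < Im z"
  shows "Im (\<phi> z) = (\<Sum>\<^sub>\<infinity>e\<in>B. Im z * (norm (R z (S e)))^2)" (is ?eq)
    and "(\<lambda>e. Im z * (norm (R z (S e)))^2) summable_on B" (is ?sum)
    and "0 \<le> Im (\<phi> z)"
proof -
  have hs: "((\<lambda>e. Im z * (norm (R z (S e)))^2) has_sum Im (\<phi> z)) B"
    using has_sum_bounded_linear[OF bounded_linear_Im has_sum_infsum[OF trace_summable[OF z]]]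
    by (simp add: Im_cinner_R[OF z] resolvent_trace_def)
  show ?eq using infsumI[OF hs] by simp
  show ?sum using hs by (rule has_sum_imp_summable)
  show "0 \<le> Im (\<phi> z)"
    unfolding \<open>?eq\<close> using z by (intro infsum_nonneg) auto
qed

lemma Re_denominator:
  assumes z: "0 < Im z"
  shows "1 \<le> Re (1 - \<i> * \<phi> z)" "1 \<le> cmod (1 - \<i> * \<phi> z)" "1 - \<i> * \<phi> z \<noteq> 0"
proof -
  show "1 \<le> Re (1 - \<i> * \<phi> z)" using Im_trace(3)[OF z] by simp
  then show le: "1 \<le> cmod (1 - \<i> * \<phi> z)" using complex_Re_le_cmod order_trans by blast
  then show "1 - \<i> * \<phi> z \<noteq> 0" by auto
qed

text \<open>The coefficient at e is 2 i Im z <R z u, R z (S e)>. After Cauchy-Schwarz one factor Im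
  z completes |R z u|^2 to the imaginary part of <R z u, u>, the other completes the sum over e to
  the imaginary part of the trace.\<close>

lemma norm_SR_diff_le:
  assumes z: "0 < Im z"
  shows "(norm (S (R z u) - S (R (cnj z) u)))^2 \<le> 4 * Im (\<phi> z) * Im (cinner (R z u) u)"
proof (rule norm_sq_le_if_coefficients_bounded[OF B])
  fix F assume F: "finite F" "F \<subseteq> B"
  let ?c = "Im (cinner (R z u) u)"
  have c0: "0 \<le> ?c" using z by (simp add: Im_cinner_R[OF z])
  have "(cmod (cinner (S (R z u) - S (R (cnj z) u)) e))^2 \<le> 4 * ?c * (Im z * (norm (R z (S e)))^2)" for e
  proof -
    have "cinner (S (R z u) - S (R (cnj z) u)) e = 2 * \<i> * of_real (Im z) * cinner (R z u) (R z (S e))"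
      using cinner_R_diff[OF z, of u "S e"] by (simp add: cinner_diff_left S_sym)
    then have "cmod (cinner (S (R z u) - S (R (cnj z) u)) e) = 2 * Im z * cmod (cinner (R z u) (R z (S e)))"
      using z by (simp add: norm_mult)
    also have "\<dots> \<le> 2 * Im z * (norm (R z u) * norm (R z (S e)))"
      using z by (intro mult_left_mono cinner_Cauchy_Schwarz) auto
    finally have "(cmod (cinner (S (R z u) - S (R (cnj z) u)) e))^2 \<le> (2 * Im z * (norm (R z u) * norm (R z (S e))))^2"
      by (intro power_mono) auto
    also have "\<dots> = 4 * ?c * (Im z * (norm (R z (S e)))^2)"
      by (simp add: Im_cinner_R[OF z] power2_eq_square mult_ac)
    finally show ?thesis .
  qed
  then have "(\<Sum>e\<in>F. (cmod (cinner (S (R z u) - S (R (cnj z) u)) e))^2) \<le> (\<Sum>e\<in>F. 4 * ?c * (Im z * (norm (R z (S e)))^2))"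
    by (intro sum_mono)
  also have "\<dots> = 4 * ?c * (\<Sum>e\<in>F. Im z * (norm (R z (S e)))^2)" by (simp only: sum_distrib_left)
  also have "\<dots> \<le> 4 * ?c * Im (\<phi> z)"
    unfolding Im_trace(1)[OF z] using c0 z F
    by (intro mult_left_mono finite_sum_le_infsum Im_trace(2)) auto
  finally show "(\<Sum>e\<in>F. (cmod (cinner (S (R z u) - S (R (cnj z) u)) e))^2) \<le> 4 * Im (\<phi> z) * ?c"
    by (simp only: mult_ac)
qed

text \<open>The function F of the overview. Conjugate-linearity in the second slot cancels the
  conjugation of z, which makes the numerator analytic.\<close>

definition majorant :: "'a \<Rightarrow> complex \<Rightarrow> complex" where
  "majorant u z = cinner (R z u) u + \<i> * cinner (S (R z u)) (S (R (cnj z) u)) / (1 - \<i> * \<phi> z)"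

text \<open>
  This is the energy identity for the resolvent of the rank-one dissipative perturbation
  \<open>L = A - i \<langle>\<cdot>,v\<rangle> v\<close> of the direct sum of copies of \<open>A\<close>, with \<open>v = (S e)\<^sub>e\<close>, read off in terms of \<open>A\<close> alone.
\<close>

lemma norm_SR_le_majorant:
  assumes z: "0 < Im z"
  shows "(norm (S (R z u)))^2 \<le> (cmod (1 - \<i> * \<phi> z))^2 * Im (majorant u z)"
proof -
  define x where "x = S (R z u)"
  define D where "D = x - S (R (cnj z) u)"
  define q where "q = 1 - \<i> * \<phi> z"
  define b where "b = Im (\<phi> z)"
  define c where "c = Im (cinner (R z u) u)"
  have q0: "q \<noteq> 0" using Re_denominator(3)[OF z] by (simp add: q_def)
  have b0: "0 \<le> b" using Im_trace(3)[OF z] by (simp add: b_def)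
  have c0: "0 \<le> c" using z by (simp add: c_def Im_cinner_R[OF z])
  have D2: "(norm D)^2 \<le> 4 * b * c"
    using norm_SR_diff_le[OF z, of u] by (simp add: D_def x_def b_def c_def)
  have Req: "Re q = 1 + b" by (simp add: q_def b_def)
  define \<xi> where "\<xi> = cinner x (S (R (cnj z) u))"
  have \<xi>: "\<xi> = of_real ((norm x)^2) - cinner x D"
    by (simp add: \<xi>_def D_def cinner_diff_right cinner_self)
  have "majorant u z = cinner (R z u) u + \<i> * (\<xi> / q)"
    by (simp add: majorant_def \<xi>_def x_def q_def)
  moreover have "Im (\<i> * w) = Re w" for w by simp
  ultimately have "Im (majorant u z) = c + Re (\<xi> / q)" by (simp only: plus_complex.sel c_def)
  then have "(cmod q)^2 * Im (majorant u z) = c * (cmod q)^2 + (cmod q)^2 * Re (\<xi> / q)"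
    by (simp add: algebra_simps)
  \<comment> \<open>Multiplication by |q|^2 clears the denominator and leaves Re q = 1 + b as the
    factor of |x|^2.\<close>
  also have "(cmod q)^2 * Re (\<xi> / q) = Re (\<xi> * cnj q)"
  proof -
    have "of_real ((cmod q)^2) * (\<xi> / q) = \<xi> * cnj q"
      unfolding complex_norm_square using q0 by simp
    then have "Re (of_real ((cmod q)^2) * (\<xi> / q)) = Re (\<xi> * cnj q)" by (rule arg_cong)
    moreover have "Re (of_real r * w) = r * Re w" for r w by simp
    ultimately show ?thesis by (simp only:)
  qed
  also have "\<dots> = (1 + b) * (norm x)^2 - Re (cinner x D * cnj q)"
    unfolding \<xi> by (simp add: Req algebra_simps)
  finally have eq: "(cmod q)^2 * Im (majorant u z) = c * (cmod q)^2 + (1 + b) * (norm x)^2 - Re (cinner x D * cnj q)"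
    by simp
  have "Re (cinner x D * cnj q) \<le> cmod (cinner x D * cnj q)" by (rule complex_Re_le_cmod)
  also have "\<dots> \<le> norm x * norm D * cmod q"
    unfolding norm_mult complex_mod_cnj by (intro mult_right_mono cinner_Cauchy_Schwarz) auto
  \<comment> \<open>From |D|^2 \<le> 4 b c by 4 s t \<le> (s + t)^2 with s = b |x|^2 and t = c
    |q|^2. These are exactly the terms of \<open>eq\<close> beyond |x|^2.\<close>
  also have "\<dots> \<le> b * (norm x)^2 + c * (cmod q)^2"
  proof (rule power2_le_imp_le)
    have "(norm x * norm D * cmod q)^2 = (norm x)^2 * (norm D)^2 * (cmod q)^2"
      by (simp add: power_mult_distrib)
    also have "\<dots> \<le> (norm x)^2 * (4 * b * c) * (cmod q)^2"
      by (intro mult_right_mono mult_left_mono D2) auto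
    also have "\<dots> = 4 * (b * (norm x)^2) * (c * (cmod q)^2)" by (simp only: mult_ac)
    also have "\<dots> \<le> (b * (norm x)^2 + c * (cmod q)^2)^2"
    proof -
      have "4 * s * t \<le> (s + t)^2" for s t :: real
        using zero_le_power2[of "s - t"] by (simp add: power2_sum power2_diff)
      then show ?thesis .
    qed
    finally show "(norm x * norm D * cmod q)^2 \<le> (b * (norm x)^2 + c * (cmod q)^2)^2" .
  qed (use b0 c0 in auto)
  finally have "(norm x)^2 \<le> (cmod q)^2 * Im (majorant u z)"
    unfolding eq by (simp add: distrib_right)
  then show ?thesis by (simp add: x_def q_def)
qed

section \<open>Analyticity and growth of the trace and the majorant\<close>

lemma R_tendsto:
  assumes z: "Im z \<noteq> 0"
  shows "((\<lambda>w. R w v) \<longlongrightarrow> R z v) (at z)"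
proof -
  have "((\<lambda>w. R w v - R z v) \<longlongrightarrow> 0) (at z)"
  proof (rule Lim_null_comparison)
    from eventually_Im_nonzero[OF z]
    show "\<forall>\<^sub>F w in at z. norm (R w v - R z v) \<le> cmod (w - z) * (norm v / \<bar>Im z\<bar> / \<bar>Im w\<bar>)"
    proof eventually_elim
      case (elim w)
      note w = elim
      have "norm (R w (R z v)) \<le> norm v / \<bar>Im z\<bar> / \<bar>Im w\<bar>"
        by (rule order_trans[OF R_bound[OF w] divide_right_mono[OF R_bound[OF z]]]) simp
      then show ?case unfolding R_identity[OF w z] norm_scaleC by (intro mult_left_mono) auto
    qed
    have "((\<lambda>w. cmod (w - z) * (norm v / \<bar>Im z\<bar> / \<bar>Im w\<bar>)) \<longlongrightarrow> cmod (z - z) * (norm v / \<bar>Im z\<bar> / \<bar>Im z\<bar>)) (at z)"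
      using z by (intro tendsto_intros) auto
    then show "((\<lambda>w. cmod (w - z) * (norm v / \<bar>Im z\<bar> / \<bar>Im w\<bar>)) \<longlongrightarrow> 0) (at z)" by simp
  qed
  then show ?thesis by (simp add: LIM_zero_iff)
qed

lemma bounded_linear_scaleC_left: "bounded_linear (\<lambda>h. h *\<^sub>C (x::'a))"
  by (rule bounded_bilinear.bounded_linear_left[OF bounded_bilinear_scaleC])

text \<open>By the resolvent identity the error of the difference quotient has the same norm as R w
  v - R z v at v = R z u, so continuity of the resolvent suffices.\<close>

lemma R_has_derivative:
  assumes z: "Im z \<noteq> 0"
  shows "((\<lambda>w. R w u) has_derivative (\<lambda>h. h *\<^sub>C R z (R z u))) (at z)"
  unfolding has_derivative_iff_norm
proof (intro conjI bounded_linear_scaleC_left)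
  show "((\<lambda>w. norm (R w u - R z u - (w - z) *\<^sub>C R z (R z u)) / norm (w - z)) \<longlongrightarrow> 0) (at z)"
  proof (rule Lim_null_comparison)
    from eventually_Im_nonzero[OF z]
    show "\<forall>\<^sub>F w in at z. norm (norm (R w u - R z u - (w - z) *\<^sub>C R z (R z u)) / norm (w - z))
        \<le> norm (R w (R z u) - R z (R z u))"
    proof eventually_elim
      case (elim w)
      note w = elim
      have "R w u - R z u - (w - z) *\<^sub>C R z (R z u) = (w - z) *\<^sub>C (R w (R z u) - R z (R z u))"
        by (simp only: R_identity[OF w z, of u] scaleC_diff_right)
      then show ?case by (simp add: norm_scaleC)
    qed
    show "((\<lambda>w. norm (R w (R z u) - R z (R z u))) \<longlongrightarrow> 0) (at z)"
      using R_tendsto[OF z, of "R z u"] by (intro tendsto_norm_zero) (simp add: LIM_zero_iff)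
  qed
qed

text \<open>Two applications of the resolvent identity give a second-order expansion of each term
  with exact remainder. The remainders are bounded by |S e|^2 times a factor that stays bounded as w
  tends to z, so the sum can be differentiated directly.\<close>

lemma trace_has_field_derivative:
  assumes z: "0 < Im z"
  shows "(\<phi> has_field_derivative (\<Sum>\<^sub>\<infinity>e\<in>B. cinner (R z (R z (S e))) (S e))) (at z)"
proof -
  let ?T1 = "\<Sum>\<^sub>\<infinity>e\<in>B. cinner (R z (R z (S e))) (S e)"
  have z0: "Im z \<noteq> 0" using z by simp
  have s1: "(\<lambda>e. cinner (R z (R z (S e))) (S e)) summable_on B"
  proof (rule trace_sum_bound)
    fix e
    have "cmod (cinner (R z (R z (S e))) (S e)) \<le> norm (R z (S e)) * norm (S e) / Im z"
      by (rule cmod_cinner_R_le[OF z])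
    also have "\<dots> \<le> (norm (S e) / \<bar>Im z\<bar>) * norm (S e) / Im z"
      using z by (intro divide_right_mono mult_right_mono R_bound) auto
    finally show "cmod (cinner (R z (R z (S e))) (S e)) \<le> (1 / \<bar>Im z\<bar> / Im z) * (norm (S e))^2"
      by (simp add: power2_eq_square)
  qed
  have quot: "cmod ((\<phi> w - \<phi> z) / (w - z) - ?T1) \<le> cmod (w - z) * (1 / Im w / Im z / Im z * \<tau>)"
    if w: "0 < Im w" and ne: "w \<noteq> z" for w
  proof -
    have w0: "Im w \<noteq> 0" using w by simp
    let ?t = "\<lambda>e. cinner (R w (R z (R z (S e)))) (S e)"
    have tb: "cmod (?t e) \<le> (1 / Im w / Im z / Im z) * (norm (S e))^2" for e
    proof -
      have "norm (R z (R z (S e))) \<le> norm (S e) / \<bar>Im z\<bar> / \<bar>Im z\<bar>"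
        by (rule order_trans[OF R_bound[OF z0] divide_right_mono[OF R_bound[OF z0]]]) simp
      then have "norm (R z (R z (S e))) * norm (S e) / Im w \<le> norm (S e) / \<bar>Im z\<bar> / \<bar>Im z\<bar> * norm (S e) / Im w"
        using w by (intro divide_right_mono mult_right_mono) auto
      then show ?thesis
        using cmod_cinner_R_le[OF w, of "R z (R z (S e))" "S e"] z w
        by (simp add: power2_eq_square mult_ac divide_divide_eq_left)
    qed
    have t: "?t summable_on B" "cmod (\<Sum>\<^sub>\<infinity>e\<in>B. ?t e) \<le> (1 / Im w / Im z / Im z) * \<tau>"
      by (rule trace_sum_bound[OF tb])+
    have expand: "cinner (R w (S e)) (S e) = cinner (R z (S e)) (S e)
        + ((w - z) * cinner (R z (R z (S e))) (S e) + (w - z)^2 * ?t e)" for e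
    proof -
      have 1: "R w (S e) = R z (S e) + (w - z) *\<^sub>C R w (R z (S e))"
        using R_identity[OF w0 z0, of "S e"] by (simp add: algebra_simps)
      have 2: "R w (R z (S e)) = R z (R z (S e)) + (w - z) *\<^sub>C R w (R z (R z (S e)))"
        using R_identity[OF w0 z0, of "R z (S e)"] by (simp add: algebra_simps)
      show ?thesis
        by (subst 1, subst 2) (simp add: cinner_add_left cinner_scaleC_left power2_eq_square algebra_simps)
    qed
    have "\<phi> w = \<phi> z + ((w - z) * ?T1 + (w - z)^2 * (\<Sum>\<^sub>\<infinity>e\<in>B. ?t e))"
      unfolding resolvent_trace_def expand
      using trace_summable[OF z] s1 t(1)
      by (subst infsum_add; (intro summable_on_add summable_on_cmult_right)?;
          (subst infsum_add)?; (intro summable_on_cmult_right)?; simp add: infsum_cmult_right)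
    then have "(\<phi> w - \<phi> z) / (w - z) - ?T1 = (w - z) * (\<Sum>\<^sub>\<infinity>e\<in>B. ?t e)"
      using ne by (simp add: field_simps power2_eq_square)
    then have "cmod ((\<phi> w - \<phi> z) / (w - z) - ?T1) = cmod (w - z) * cmod (\<Sum>\<^sub>\<infinity>e\<in>B. ?t e)"
      by (simp only: norm_mult)
    also have "\<dots> \<le> cmod (w - z) * (1 / Im w / Im z / Im z * \<tau>)"
      by (intro mult_left_mono t(2)) simp
    finally show ?thesis .
  qed
  have "((\<lambda>w. (\<phi> w - \<phi> z) / (w - z) - ?T1) \<longlongrightarrow> 0) (at z)"
  proof (rule Lim_null_comparison)
    have "\<forall>\<^sub>F w in at z. w \<in> {w. 0 < Im w}"
      using z by (intro topological_tendstoD[OF tendsto_ident_at]) (auto simp: open_halfspace_Im_gt)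
    moreover have "\<forall>\<^sub>F w in at z. w \<noteq> z" by (simp add: eventually_at_filter)
    ultimately show "\<forall>\<^sub>F w in at z. cmod ((\<phi> w - \<phi> z) / (w - z) - ?T1) \<le> cmod (w - z) * (1 / Im w / Im z / Im z * \<tau>)"
      by eventually_elim (use quot in auto)
    have "((\<lambda>w. cmod (w - z) * (1 / Im w / Im z / Im z * \<tau>)) \<longlongrightarrow> cmod (z - z) * (1 / Im z / Im z / Im z * \<tau>)) (at z)"
      using z by (intro tendsto_intros) auto
    then show "((\<lambda>w. cmod (w - z) * (1 / Im w / Im z / Im z * \<tau>)) \<longlongrightarrow> 0) (at z)" by simp
  qed
  then show ?thesis by (simp add: has_field_derivative_iff LIM_zero_iff)
qed

lemma trace_holomorphic: "\<phi> holomorphic_on {z. 0 < Im z}"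
  using trace_has_field_derivative
  by (auto simp: holomorphic_on_def field_differentiable_def intro: has_field_derivative_at_within)

lemma majorant_holomorphic: "majorant u holomorphic_on {z. 0 < Im z}"
proof -
  have 1: "((\<lambda>z. cinner (R z u) u) has_field_derivative cinner (R z (R z u)) u) (at z)" if "Im z \<noteq> 0" for z
  proof -
    have "((\<lambda>z. cinner (R z u) u) has_derivative (\<lambda>h. cinner (h *\<^sub>C R z (R z u)) u)) (at z)"
      by (rule bounded_linear.has_derivative[OF bounded_bilinear.bounded_linear_left[OF bounded_bilinear_cinner] R_has_derivative[OF that]])
    then show ?thesis by (simp add: has_field_derivative_def cinner_scaleC_left mult_commute_abs)
  qed
  have 2: "\<exists>d. ((\<lambda>z. cinner (S (R z u)) (S (R (cnj z) u))) has_field_derivative d) (at z)" if z: "Im z \<noteq> 0" for z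
  proof -
    let ?c = "cnj z"
    \<comment> \<open>The product rule gives only a real-linear map at first; \<open>cnj h\<close>
      in the second slot of \<open>cinner\<close> comes out as h, so the map is
      complex-linear.\<close>
    let ?D = "\<lambda>h. cinner (S (R z u)) (S (cnj h *\<^sub>C R ?c (R ?c u))) + cinner (S (h *\<^sub>C R z (R z u))) (S (R ?c u))"
    have c: "Im ?c \<noteq> 0" using z by simp
    note S' = bounded_op_linear[OF S_op]
    have f: "((\<lambda>z. S (R z u)) has_derivative (\<lambda>h. S (h *\<^sub>C R z (R z u)))) (at z)"
      by (rule bounded_linear.has_derivative[OF S' R_has_derivative[OF z]])
    have "((\<lambda>z. R (cnj z) u) has_derivative (\<lambda>h. cnj h *\<^sub>C R ?c (R ?c u))) (at z)"
      by (rule has_derivative_compose[OF bounded_linear_imp_has_derivative[OF bounded_linear_cnj] R_has_derivative[OF c]])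
    then have g: "((\<lambda>z. S (R (cnj z) u)) has_derivative (\<lambda>h. S (cnj h *\<^sub>C R ?c (R ?c u)))) (at z)"
      by (rule bounded_linear.has_derivative[OF S'])
    have "((\<lambda>z. cinner (S (R z u)) (S (R (cnj z) u))) has_derivative
        ?D) (at z)"
      by (rule bounded_bilinear.FDERIV[OF bounded_bilinear_cinner f g])
    also have "?D
        = (*) (cinner (S (R z u)) (S (R ?c (R ?c u))) + cinner (S (R z (R z u))) (S (R ?c u)))"
      by (simp add: fun_eq_iff bounded_op_scaleC[OF S_op] cinner_scaleC_left cinner_scaleC_right algebra_simps)
    finally show ?thesis unfolding has_field_derivative_def by blast
  qed
  have "(\<lambda>z. cinner (R z u) u) holomorphic_on {z. 0 < Im z}"
    unfolding holomorphic_on_def field_differentiable_def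
  proof
    fix z assume "z \<in> {z. 0 < Im z}"
    then have "Im z \<noteq> 0" by simp
    from has_field_derivative_at_within[OF 1[OF this]]
    show "\<exists>f'. ((\<lambda>z. cinner (R z u) u) has_field_derivative f') (at z within {z. 0 < Im z})" by blast
  qed
  moreover have "(\<lambda>z. cinner (S (R z u)) (S (R (cnj z) u))) holomorphic_on {z. 0 < Im z}"
    unfolding holomorphic_on_def field_differentiable_def
  proof
    fix z assume "z \<in> {z. 0 < Im z}"
    then have "Im z \<noteq> 0" by simp
    from 2[OF this] show "\<exists>f'. ((\<lambda>z. cinner (S (R z u)) (S (R (cnj z) u))) has_field_derivative f') (at z within {z. 0 < Im z})"
      using has_field_derivative_at_within by blast
  qed
  ultimately show ?thesis
    unfolding majorant_def using Re_denominator(3) by (intro holomorphic_intros trace_holomorphic) auto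
qed

text \<open>The denominator has modulus at least 1. The extra power of 1 / Im z in the second term
  is harmless, as the Hardy bound uses the estimate far from the line.\<close>

lemma majorant_bound:
  assumes K: "0 \<le> K" "\<And>x. norm (S x) \<le> K * norm x" and z: "0 < Im z"
  shows "cmod (majorant u z) \<le> (norm u)^2 / Im z + (K * norm u)^2 / (Im z)^2"
proof -
  have SR: "norm (S (R w u)) \<le> K * norm u / Im z" if "\<bar>Im w\<bar> = Im z" for w
  proof -
    have "norm (S (R w u)) \<le> K * norm (R w u)" by (rule K)
    also have "\<dots> \<le> K * (norm u / Im z)"
      using R_bound[of w u] that z K by (intro mult_left_mono) auto
    finally show ?thesis by simp
  qed
  have "cmod (majorant u z) \<le> cmod (cinner (R z u) u) + cmod (\<i> * cinner (S (R z u)) (S (R (cnj z) u)) / (1 - \<i> * \<phi> z))"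
    unfolding majorant_def by (rule norm_triangle_ineq)
  also have "cmod (cinner (R z u) u) \<le> (norm u)^2 / Im z"
    using cmod_cinner_R_le[OF z, of u u] by (simp add: power2_eq_square)
  also have "cmod (\<i> * cinner (S (R z u)) (S (R (cnj z) u)) / (1 - \<i> * \<phi> z)) \<le> (K * norm u)^2 / (Im z)^2"
  proof -
    have "cmod (\<i> * cinner (S (R z u)) (S (R (cnj z) u)) / (1 - \<i> * \<phi> z))
        = cmod (cinner (S (R z u)) (S (R (cnj z) u))) / cmod (1 - \<i> * \<phi> z)"
      by (simp add: norm_divide norm_mult)
    also have "\<dots> \<le> cmod (cinner (S (R z u)) (S (R (cnj z) u))) / 1"
      by (intro divide_left_mono Re_denominator z) (use Re_denominator(2)[OF z] in auto)
    also have "\<dots> \<le> norm (S (R z u)) * norm (S (R (cnj z) u))"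
      using cinner_Cauchy_Schwarz by simp
    also have "\<dots> \<le> (K * norm u / Im z) * (K * norm u / Im z)"
      using z K by (intro mult_mono SR) auto
    finally show ?thesis by (simp add: power2_eq_square)
  qed
  finally show ?thesis by simp
qed

section \<open>The scalar denominator and the Hardy class\<close>

definition denominator :: "complex \<Rightarrow> complex" where
  "denominator z = 1 / (1 - \<i> * \<phi> z)"

lemma denominator_nonzero: "0 < Im z \<Longrightarrow> denominator z \<noteq> 0"
  using Re_denominator(3) by (simp add: denominator_def)

lemma denominator_holomorphic: "denominator holomorphic_on {z. 0 < Im z}"
  unfolding denominator_def using Re_denominator(3) by (intro holomorphic_intros trace_holomorphic) auto

lemma outer_plus_denominator: "outer_plus denominator"
proof (rule outer_plus_if_Re_pos[OF denominator_holomorphic])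
  fix z assume z: "0 < Im z"
  show "cmod (denominator z) \<le> 1"
    using Re_denominator(2)[OF z] by (simp add: denominator_def norm_divide divide_le_eq)
  show "0 < Re (denominator z)"
    using Im_trace(3)[OF z]
    by (auto simp: denominator_def Re_divide intro!: divide_pos_pos add_pos_nonneg zero_less_power)
qed

lemma hardy2_plus_denominator:
  assumes E: "csubspace E" "range S \<subseteq> E"
  shows "(\<lambda>z. denominator z *\<^sub>C S (R z u)) \<in> hardy2_plus E"
proof -
  let ?h = "\<lambda>z. denominator z *\<^sub>C S (R z u)"
  obtain K where K: "K > 0" "\<And>x. norm (S x) \<le> K * norm x"
    using bounded_op_bound[OF S_op] by blast
  have deriv: "\<exists>d. (?h has_derivative (\<lambda>h. h *\<^sub>C d)) (at z)" if z: "0 < Im z" for z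
  proof -
    let ?D = "\<lambda>h. denominator z *\<^sub>C S (h *\<^sub>C R z (R z u)) + (deriv denominator z * h) *\<^sub>C S (R z u)"
    have z0: "Im z \<noteq> 0" using z by simp
    have d: "(denominator has_derivative (*) (deriv denominator z)) (at z)"
      using holomorphic_derivI[OF denominator_holomorphic open_halfspace_Im_gt, of z] z
      by (simp add: has_field_derivative_def)
    have s: "((\<lambda>z. S (R z u)) has_derivative (\<lambda>h. S (h *\<^sub>C R z (R z u)))) (at z)"
      by (rule bounded_linear.has_derivative[OF bounded_op_linear[OF S_op] R_has_derivative[OF z0]])
    have "(?h has_derivative ?D) (at z)"
      by (rule bounded_bilinear.FDERIV[OF bounded_bilinear_scaleC d s])
    also have "?D
        = (\<lambda>h. h *\<^sub>C (denominator z *\<^sub>C S (R z (R z u)) + deriv denominator z *\<^sub>C S (R z u)))"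
      by (simp add: fun_eq_iff bounded_op_scaleC[OF S_op] scaleC_add_right scaleC_scaleC mult.commute)
    finally show ?thesis by blast
  qed
  have cont: "continuous_on {z. 0 < Im z} ?h"
    using deriv by (intro continuous_at_imp_continuous_on ballI) (auto dest: has_derivative_continuous)
  \<comment> \<open>Multiplication by \<open>denominator\<close> cancels the factor |1 - i phi|^2 of
    the energy estimate, leaving the imaginary part of the majorant alone.\<close>
  have q: "0 \<le> (norm (?h z))^2 \<and> (norm (?h z))^2 \<le> Im (majorant u z)" if z: "0 < Im z" for z
  proof -
    have pos: "0 < (cmod (1 - \<i> * \<phi> z))^2" using Re_denominator(3)[OF z] by simp
    have "(norm (?h z))^2 = (norm (S (R z u)))^2 / (cmod (1 - \<i> * \<phi> z))^2"
      by (simp add: norm_scaleC denominator_def norm_divide power_divide)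
    also have "\<dots> \<le> Im (majorant u z)"
      using norm_SR_le_majorant[OF z, of u] pos by (simp add: divide_le_eq mult.commute)
    finally show ?thesis by simp
  qed
  have le: "(\<integral>\<^sup>+x. ennreal ((norm (?h (Complex x y)))^2) \<partial>lborel) \<le> ennreal (pi * ((norm u)^2 + (K * norm u)^2))"
    if y: "0 < y" for y
  proof (rule half_plane_Hardy_bound[OF majorant_holomorphic[of u] _ _ _ q _ y])
    show "cmod (majorant u z) \<le> (norm u)^2 / Im z + (K * norm u)^2 / (Im z)^2" if "0 < Im z" for z
      by (rule majorant_bound[OF _ K(2) that]) (use K in simp)
    have "continuous_on UNIV (\<lambda>x. ?h (Complex x y))"
      using y by (intro continuous_on_compose2[OF cont]) (auto intro!: continuous_intros)
    then have "continuous_on UNIV (\<lambda>x. (norm (?h (Complex x y)))^2)" by (intro continuous_intros)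
    then show "(\<lambda>x. (norm (?h (Complex x y)))^2) \<in> borel_measurable lborel"
      by (simp add: borel_measurable_continuous_onI)
  qed auto
  have "(SUP y\<in>{0<..}. \<integral>\<^sup>+x. ennreal ((norm (?h (Complex x y)))^2) \<partial>lborel) \<le> ennreal (pi * ((norm u)^2 + (K * norm u)^2))"
    by (rule SUP_least) (use le in auto)
  then have "(SUP y\<in>{0<..}. \<integral>\<^sup>+x. ennreal ((norm (?h (Complex x y)))^2) \<partial>lborel) < \<infinity>"
    by (rule le_less_trans) simp
  moreover have "?h ` upper_half_plane \<subseteq> E"
    using E by (auto simp: csubspace_iff image_subset_iff)
  ultimately show ?thesis
    using deriv by (simp add: hardy2_plus_def vector_analytic_on_def)
qed

end

section \<open>Reflection to the lower half-plane and assembly\<close>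

text \<open>The map z -> -z exchanges the half-planes and reverses each horizontal line, which
  preserves its integrals. The outer sign undoes the one in the resolvent of -A.\<close>

lemma hardy2_minus_reflect:
  assumes h: "h \<in> hardy2_plus E" and E: "csubspace E"
  shows "(\<lambda>z. - h (- z)) \<in> hardy2_minus E"
proof -
  have E': "- x \<in> E" if "x \<in> E" for x
    using E that by (metis csubspace_iff scaleC_of_real_neg)
  have img: "(\<lambda>z. - h (- z)) ` lower_half_plane \<subseteq> E"
    using h E' by (auto simp: hardy2_plus_def image_subset_iff)
  have "vector_analytic_on (\<lambda>z. - h (- z)) lower_half_plane"
    unfolding vector_analytic_on_def
  proof
    fix z :: complex assume "z \<in> lower_half_plane"
    then have "- z \<in> upper_half_plane" by simp
    then obtain d where d: "(h has_derivative (\<lambda>k. k *\<^sub>C d)) (at (- z))"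
      using h unfolding hardy2_plus_def vector_analytic_on_def by blast
    have "((\<lambda>z. - h (- z)) has_derivative (\<lambda>k. - ((- k) *\<^sub>C d))) (at z)"
      using has_derivative_compose[of uminus uminus z UNIV h "\<lambda>k. k *\<^sub>C d"] d
      by (intro has_derivative_minus) (auto intro: derivative_intros)
    then show "\<exists>d. ((\<lambda>z. - h (- z)) has_derivative (\<lambda>k. k *\<^sub>C d)) (at z)"
      by (auto simp: scaleC_minus_left)
  qed
  moreover have "(\<integral>\<^sup>+x. ennreal ((norm (- h (- Complex x (- y))))^2) \<partial>lborel) = (\<integral>\<^sup>+x. ennreal ((norm (h (Complex x y)))^2) \<partial>lborel)"
    if y: "0 < y" for y
  proof -
    have cont: "continuous_on {z. 0 < Im z} h"
      using h by (intro continuous_at_imp_continuous_on ballI)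
        (auto simp: hardy2_plus_def vector_analytic_on_def dest: has_derivative_continuous)
    have "continuous_on UNIV (\<lambda>x. h (Complex x y))"
      using y by (intro continuous_on_compose2[OF cont]) (auto intro!: continuous_intros)
    then have "continuous_on UNIV (\<lambda>x. (norm (h (Complex x y)))^2)" by (intro continuous_intros)
    then have m: "(\<lambda>x. ennreal ((norm (h (Complex x y)))^2)) \<in> borel_measurable borel"
      by (intro measurable_compose[OF borel_measurable_continuous_onI measurable_ennreal])
    have "(\<integral>\<^sup>+x. ennreal ((norm (h (Complex x y)))^2) \<partial>lborel)
        = (\<integral>\<^sup>+x. ennreal ((norm (h (Complex (- x) y)))^2) \<partial>lborel)"
      using nn_integral_real_affine[OF m, of "-1" 0] by simp
    moreover have "- Complex x (- y) = Complex (- x) y" for x by (simp add: complex_eq_iff)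
    ultimately show ?thesis by simp
  qed
  then have "(SUP y\<in>{0<..}. \<integral>\<^sup>+x. ennreal ((norm (- h (- Complex x (- y))))^2) \<partial>lborel)
      = (SUP y\<in>{0<..}. \<integral>\<^sup>+x. ennreal ((norm (h (Complex x y)))^2) \<partial>lborel)"
    by (intro SUP_cong) auto
  ultimately show ?thesis using h img by (simp add: hardy2_plus_def hardy2_minus_def)
qed

theorem theorem4p1:
  fixes A :: "'a::complex_hilbert \<rightharpoonup> 'a"
    and V :: "'a \<Rightarrow> 'a"
    and E :: "'a set"
  assumes "selfadjoint_operator A"
    and "nonneg_selfadjoint V"
    and "trace_class V"
    and "closed_cspan (\<Union>z\<in>{z. Im z \<noteq> 0}. range (\<lambda>x. resolvent A z (V x))) = UNIV"
    and "E = closure (range V)"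
  shows "\<exists>\<delta>\<^sub>p \<delta>\<^sub>m. outer_plus \<delta>\<^sub>p \<and> outer_minus \<delta>\<^sub>m \<and>
    (\<forall>u\<in>singular_subspace A.
       (\<lambda>z. op_sqrt V (resolvent A z u)) \<in> smirnov2_plus E \<inter> smirnov2_minus E \<and>
       (\<exists>h\<in>hardy2_plus E. \<forall>z\<in>upper_half_plane.
          op_sqrt V (resolvent A z u) = (1 / \<delta>\<^sub>p z) *\<^sub>C h z) \<and>
       (\<exists>h\<in>hardy2_minus E. \<forall>z\<in>lower_half_plane.
          op_sqrt V (resolvent A z u) = (1 / \<delta>\<^sub>m z) *\<^sub>C h z))"
proof -
  let ?S = "op_sqrt V" and ?R = "resolvent A"
  note V = \<open>nonneg_selfadjoint V\<close>
  have S: "bounded_selfadjoint ?S"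
    using op_sqrt_works(1)[OF V] by (simp add: nonneg_selfadjoint_def)
  obtain B where B: "orthonormal_basis B" "(\<lambda>e. (norm (?S e))\<^sup>2) summable_on B"
    using trace_class_sqrt_Hilbert_Schmidt[OF V \<open>trace_class V\<close>] by blast
  interpret selfadjoint_resolvent ?R
    by (rule selfadjoint.selfadjoint_resolvent) (unfold_locales, fact)
  interpret up: Hilbert_Schmidt_resolvent ?R ?S B
    by unfold_locales (fact S B)+
  interpret lo: selfadjoint_resolvent "\<lambda>z u. - ?R (- z) u" by (rule reflected)
  interpret lo: Hilbert_Schmidt_resolvent "\<lambda>z u. - ?R (- z) u" ?S B
    by unfold_locales (fact S B)+
  have Esub: "csubspace E"
    unfolding \<open>E = closure (range V)\<close> by (rule csubspace_closure_range[OF nonneg_selfadjointD(1)[OF V]])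
  have ES: "range ?S \<subseteq> E"
    unfolding \<open>E = closure (range V)\<close> using op_sqrt_in_closure_range[OF V] by blast
  \<comment> \<open>Defined by conjugate reflection, so that \<open>outer_minus\<close> reduces to
    the outer function of the upper half-plane.\<close>
  define \<delta>m where "\<delta>m z = cnj (up.denominator (cnj z))" for z
  have outer_m: "outer_minus \<delta>m"
    using up.outer_plus_denominator by (simp add: outer_minus_def \<delta>m_def)
  \<comment> \<open>Conjugation turns -i into i, and the adjoint relation identifies the conjugated
    trace with minus the trace for -A at -z. The two sign changes cancel, so the denominator of the
    reflected problem is the same function.\<close>
  have \<delta>m_eq: "\<delta>m z = lo.denominator (- z)" if z: "Im z < 0" for z
  proof -
    have cz: "0 < Im (cnj z)" using z by simp
    have "cnj (resolvent_trace ?R ?S B (cnj z)) = (\<Sum>\<^sub>\<infinity>e\<in>B. cnj (cinner (?R (cnj z) (?S e)) (?S e)))"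
      unfolding resolvent_trace_def by (rule infsum_cnj[symmetric])
    also have "\<dots> = (\<Sum>\<^sub>\<infinity>e\<in>B. cinner (?R z (?S e)) (?S e))"
    proof (rule infsum_cong)
      fix e
      have "cnj (cinner (?R (cnj z) (?S e)) (?S e)) = cinner (?S e) (?R (cnj z) (?S e))"
        using cinner_commute[of "?S e" "?R (cnj z) (?S e)"] by simp
      also have "\<dots> = cinner (?R z (?S e)) (?S e)" using R_adjoint[of z "?S e" "?S e"] z by simp
      finally show "cnj (cinner (?R (cnj z) (?S e)) (?S e)) = cinner (?R z (?S e)) (?S e)" .
    qed
    also have "\<dots> = - resolvent_trace (\<lambda>z u. - ?R (- z) u) ?S B (- z)"
      by (simp add: resolvent_trace_def cinner_minus_left infsum_uminus)
    finally show ?thesis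
      by (simp add: \<delta>m_def up.denominator_def lo.denominator_def)
  qed
  have plus: "\<exists>h\<in>hardy2_plus E. \<forall>z\<in>upper_half_plane. ?S (?R z u) = (1 / up.denominator z) *\<^sub>C h z" for u
    using up.hardy2_plus_denominator[OF Esub ES, of u] up.denominator_nonzero
    by (intro bexI[of _ "\<lambda>z. up.denominator z *\<^sub>C ?S (?R z u)"]) (auto simp: scaleC_scaleC)
  have minus: "\<exists>h\<in>hardy2_minus E. \<forall>z\<in>lower_half_plane. ?S (?R z u) = (1 / \<delta>m z) *\<^sub>C h z" for u
  proof (intro bexI ballI)
    let ?h = "\<lambda>z. lo.denominator z *\<^sub>C ?S (- ?R (- z) u)"
    show "(\<lambda>z. - ?h (- z)) \<in> hardy2_minus E"
      by (rule hardy2_minus_reflect[OF lo.hardy2_plus_denominator[OF Esub ES] Esub])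
    fix z assume "z \<in> lower_half_plane"
    then have z: "Im z < 0" by simp
    have "lo.denominator (- z) \<noteq> 0" using z by (intro lo.denominator_nonzero) simp
    then show "?S (?R z u) = (1 / \<delta>m z) *\<^sub>C - ?h (- z)"
      by (simp add: \<delta>m_eq[OF z] bounded_op_minus[OF up.S_op] scaleC_minus_right scaleC_scaleC)
  qed
  show ?thesis
  proof (rule exI[of _ up.denominator], rule exI[of _ \<delta>m], intro conjI ballI)
    fix u
    show "(\<lambda>z. ?S (?R z u)) \<in> smirnov2_plus E \<inter> smirnov2_minus E"
      using plus[of u] minus[of u] up.outer_plus_denominator outer_m
      unfolding smirnov2_plus_def smirnov2_minus_def by blast
  qed (use up.outer_plus_denominator outer_m plus minus in blast)+
qed

end
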